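(* Let $n\ge2$ be such that for every $t\in(0,1)$ with $V'(t)=0$ one has $V''(t)\neq0$ and $\eta'(t)<0$. Let $t_0\in(0,1]$. If $V'(t_0)<0$, then the CMC unduloid $\Sigma_{t_0}$ defined by $v(\cdot;t_0)$ is unstable; if $V'(t_0)>0$, then $\Sigma_{t_0}$ is stable.
   Context: Fix an integer $n\ge2$ and $d>0$; let $\omega_n$ be the volume of the unit ball in $\mathbb{R}^n$. Define $Q:(0,\infty)\to\mathbb{R}$ by $Q(t)=\frac{1-t^{n-1}}{1-t^n}$ for $t\neq1$, $Q(1)=\frac{n-1}{n}$. For $0\le x\le1$, $t>0$ let $R(x;t)=\frac{1}{|1-t|}\sqrt{\left(\frac{(1-(1-t)x)^{n-1}}{1-Q(t)+Q(t)(1-(1-t)x)^n}\right)^2-1}$ for $t\ne1$, $R(x;1)=\sqrt{(n-1)(1-x)x}$. Let $\zeta(x;t)=\int_x^1R(\tilde x;t)^{-1}d\tilde x$ ($0\le x<1$), $\zeta(1;t)=0$, $P(t)=\zeta(0;t)$, and $\zeta^{-1}(\cdot;t)$ the inverse of $x\mapsto\zeta(x;t)$. For $z\in[0,d]$ put $v(z;t)=\frac{d}{P(t)}\left(1-(1-t)\zeta^{-1}\left(\frac{P(t)z}{d};t\right)\right)$, $\eta(t)=\frac{nQ(t)P(t)}{d}$, and $V(t)=\omega_n\int_0^dv(z;t)^n\,dz$. The unduloid defined by $v(\cdot;t)$ is the hypersurface $\Sigma_t=\{(z,v(z;t)\theta):z\in[0,d],\theta\in\mathbb{S}^{n-1}\}$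 in the slab $M=[0,d]\times\mathbb{R}^n\subset\mathbb{R}^{n+1}$; it has constant mean curvature $\eta(t)$ and meets $\partial M$ orthogonally. A constant mean curvature hypersurface $\Sigma$ with $\partial\Sigma\subset\partial M$ meeting $\partial M$ orthogonally is called stable if $J_\Sigma(u)=\frac{\int_\Sigma(|\nabla u|^2-|A|^2u^2)\,d\mu}{\int_\Sigma u^2\,d\mu}\ge0$ for every smooth nonzero function $u$ on $\Sigma$ with $\int_\Sigma u\,d\mu=0$, where $|A|$ is the norm of the second fundamental form; it is unstable otherwise. *)

theory Defs
  imports "HOL-Analysis.Analysis"
begin

definition Qf :: "nat \<Rightarrow> real \<Rightarrow> real" where
  "Qf n t = (if t = 1 then (real n - 1) / real n else (1 - t ^ (n - 1)) / (1 - t ^ n))"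

definition Rf :: "nat \<Rightarrow> real \<Rightarrow> real \<Rightarrow> real" where
  "Rf n x t = (if t = 1 then sqrt ((real n - 1) * (1 - x) * x)
     else (1 / \<bar>1 - t\<bar>) * sqrt (((1 - (1 - t) * x) ^ (n - 1)
            / (1 - Qf n t + Qf n t * (1 - (1 - t) * x) ^ n)) ^ 2 - 1))"

text \<open>zeta(x;t) = integral from x to 1 of 1/R (improper at the endpoints; Henstock-Kurzweil
  integral, which agrees with the improper integral); zeta(1;t) = 0 automatically.\<close>
definition zeta :: "nat \<Rightarrow> real \<Rightarrow> real \<Rightarrow> real" where
  "zeta n x t = integral {x..1} (\<lambda>s. 1 / Rf n s t)"

definition Pf :: "nat \<Rightarrow> real \<Rightarrow> real" where
  "Pf n t = zeta n 0 t"

definition zeta_inv :: "nat \<Rightarrow> real \<Rightarrow> real \<Rightarrow> real" where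
  "zeta_inv n y t = (THE x. 0 \<le> x \<and> x \<le> 1 \<and> zeta n x t = y)"

definition vprof :: "nat \<Rightarrow> real \<Rightarrow> real \<Rightarrow> real \<Rightarrow> real" where
  "vprof n d t z = d / Pf n t * (1 - (1 - t) * zeta_inv n (Pf n t * z / d) t)"

definition eta :: "nat \<Rightarrow> real \<Rightarrow> real \<Rightarrow> real" where
  "eta n d t = real n * Qf n t * Pf n t / d"

definition Vol :: "nat \<Rightarrow> real \<Rightarrow> real \<Rightarrow> real" where
  "Vol n d t = unit_ball_vol (real n) * integral {0..d} (\<lambda>z. vprof n d t z ^ n)"

text \<open>Ambient space R^{n+1} = R x R^n with R^n = real^'n, n = CARD('n).\<close>

fun Ck :: "nat \<Rightarrow> ('a::euclidean_space \<Rightarrow> real) \<Rightarrow> bool" where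
  "Ck 0 f = continuous_on UNIV f"
| "Ck (Suc k) f = ((\<forall>x. f differentiable (at x)) \<and>
      (\<forall>b\<in>Basis. Ck k (\<lambda>x. frechet_derivative f (at x) b)))"

definition smooth_fun :: "('a::euclidean_space \<Rightarrow> real) \<Rightarrow> bool" where
  "smooth_fun f = (\<forall>k. Ck k f)"

definition grad :: "('a::euclidean_space \<Rightarrow> real) \<Rightarrow> 'a \<Rightarrow> 'a" where
  "grad f x = (\<Sum>b\<in>Basis. frechet_derivative f (at x) b *\<^sub>R b)"

definition rot_surf :: "(real \<Rightarrow> real) \<Rightarrow> real \<Rightarrow> (real \<times> (real ^ 'n)) set" where
  "rot_surf w d = {(z, w z *\<^sub>R \<theta>) | z \<theta>. 0 \<le> z \<and> z \<le> d \<and> norm \<theta> = 1}"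

text \<open>Integral over the unit sphere S^{n-1} w.r.t. its (unnormalised) surface measure,
  via the cone-measure identity: integral over S^{n-1} of g = n * integral over B^n of g(x/|x|).\<close>
definition sphere_int :: "(real ^ 'n \<Rightarrow> real) \<Rightarrow> real" where
  "sphere_int g = real CARD('n) * integral (ball 0 1) (\<lambda>x. g (x /\<^sub>R norm x))"

text \<open>Integral over the hypersurface w.r.t. its induced Riemannian measure
  d mu = w(z)^{n-1} sqrt(1 + w'(z)^2) dz d sigma(theta) (area formula for the parametrisation).\<close>
definition surf_int :: "(real \<Rightarrow> real) \<Rightarrow> real \<Rightarrow> (real \<times> (real ^ 'n) \<Rightarrow> real) \<Rightarrow> real" where
  "surf_int w d f = integral {0..d} (\<lambda>z. w z ^ (CARD('n) - 1) * sqrt (1 + (deriv w z)\<^sup>2)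
       * sphere_int (\<lambda>\<theta>. f (z, w z *\<^sub>R \<theta>)))"

text \<open>The hypersurface is the zero set of F(z,y) = |y| - w(z); its unit normal field
  (extended to a neighbourhood) is grad F / |grad F|.\<close>
definition levelfun :: "(real \<Rightarrow> real) \<Rightarrow> real \<times> (real ^ 'n) \<Rightarrow> real" where
  "levelfun w p = norm (snd p) - w (fst p)"

definition unit_normal :: "(real \<Rightarrow> real) \<Rightarrow> real \<times> (real ^ 'n) \<Rightarrow> real \<times> (real ^ 'n)" where
  "unit_normal w p = (1 / norm (grad (levelfun w) p)) *\<^sub>R grad (levelfun w) p"

text \<open>|grad^Sigma u|^2 for u the restriction of an ambient function U: squared norm of the
  tangential projection of the ambient gradient.\<close>
definition tang_grad_sq :: "(real \<Rightarrow> real) \<Rightarrow> (real \<times> (real ^ 'n) \<Rightarrow> real) \<Rightarrow> real \<times> (real ^ 'n) \<Rightarrow> real" where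
  "tang_grad_sq w U p = (norm (grad U p))\<^sup>2 - (grad U p \<bullet> unit_normal w p)\<^sup>2"

text \<open>|A|^2: squared Hilbert-Schmidt norm of the shape operator, i.e. of the differential of
  the unit normal composed with the orthogonal projection onto the tangent space.\<close>
definition sff_sq :: "(real \<Rightarrow> real) \<Rightarrow> real \<times> (real ^ 'n) \<Rightarrow> real" where
  "sff_sq w p = (\<Sum>b\<in>Basis. (norm (frechet_derivative (unit_normal w) (at p)
       (b - (b \<bullet> unit_normal w p) *\<^sub>R unit_normal w p)))\<^sup>2)"

definition Jfun :: "(real \<Rightarrow> real) \<Rightarrow> real \<Rightarrow> (real \<times> (real ^ 'n) \<Rightarrow> real) \<Rightarrow> real" where
  "Jfun w d U = surf_int w d (\<lambda>p. tang_grad_sq w U p - sff_sq w p * (U p)\<^sup>2)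
                 / surf_int w d (\<lambda>p. (U p)\<^sup>2)"

text \<open>Stability: J(u) >= 0 for every smooth nonzero u on Sigma with mean zero. Smooth functions
  on the compact hypersurface-with-boundary are represented as restrictions of smooth ambient
  functions.\<close>
definition stable_rot :: "'n::finite itself \<Rightarrow> (real \<Rightarrow> real) \<Rightarrow> real \<Rightarrow> bool" where
  "stable_rot _ w d = (\<forall>U :: real \<times> (real ^ 'n) \<Rightarrow> real.
      smooth_fun U \<longrightarrow> (\<exists>p\<in>(rot_surf w d :: (real \<times> (real ^ 'n)) set). U p \<noteq> 0)
      \<longrightarrow> surf_int w d U = 0 \<longrightarrow> Jfun w d U \<ge> 0)"

end

theory Submission
  imports Defs
begin

text \<open>
  Translation along the axis, dilation and the variation of \<open>t\<close> give three explicit rotationally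
  symmetric solutions of the (inhomogeneous) Jacobi equation. The translation field is positive
  and vanishes at both ends, so the index form is nonnegative on functions vanishing on the
  boundary. Subtracting from a rotationally symmetric function with mean zero the combination of
  the other two fields with the same boundary values therefore reduces its index form to finitely
  many constants. Symmetry of the form applied to the two fields is a linear relation among these
  constants; it shows that \<open>V' > 0\<close> forces \<open>\<eta>' < 0\<close> and makes the form nonnegative. If \<open>V' < 0\<close>, the
  same fields, corrected by a multiple of the translation field to have mean zero, yield a
  direction of negative second variation, which is then approximated by polynomials in the height.

  Functions with mean zero on every parallel are controlled by the positive radial part of the
  translations orthogonal to the axis and the sharp Poincare inequality on the sphere. At \<open>t = 1\<close>
  the symmetry \<open>V(1/t) = V(t)\<close> gives \<open>V'(1) = 0\<close>, so that neither case occurs.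
\<close>

section \<open>One-dimensional quadratic forms\<close>

text \<open>Along the family the height and the mean curvature change together, while the slab fixes
  the height. Normalising the maximal radius to 1 makes both explicit: the profile has height
  \<open>P\<close> and mean curvature \<open>n Q\<close>, and a dilation can then hold either one
  fixed. Hence two natural combinations: \<open>P u1 - P' us\<close>, the velocity at fixed height,
  whose conormal derivative vanishes at both ends, and \<open>Q u1 + Q' us\<close>, the velocity at
  fixed mean curvature, a solution of the homogeneous Jacobi equation. Their transition determinant
  is \<open>N1 = P Q' + Q P'\<close>, a positive multiple of \<eta>'. In the corresponding
  coordinates \<gamma>, \<delta> the constants left over in the stable case form a diagonal matrix
  with entries \<open>- n N1 V1\<close> and \<open>kap N1 Q'\<close>, where \<open>V1\<close> has
  the sign of V'. As Q' < 0, all is decided by the signs of \<open>N1\<close> and \<open>V1\<close>.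
  Since 1/R is singular at both ends, differentiation in t takes place in an angle variable, where
  the integrands are regular on a fixed interval.\<close>

lemma integral_ge_boundary_diff:
  fixes g \<Phi> :: "real \<Rightarrow> real"
  assumes "a \<le> b" and contg: "continuous_on {a..b} g" and cont\<Phi>: "continuous_on {a..b} \<Phi>"
    and der: "\<And>x. a < x \<Longrightarrow> x < b \<Longrightarrow> \<exists>y. (\<Phi> has_real_derivative y) (at x) \<and> y \<le> g x"
  shows "\<Phi> b - \<Phi> a \<le> integral {a..b} g"
proof -
  define G where "G x = integral {a..x} g - \<Phi> x" for x
  have "G a \<le> G b"
  proof (rule DERIV_nonneg_imp_increasing_open[where f = G])
    show "continuous_on {a..b} G" unfolding G_def
      by (intro continuous_intros cont\<Phi> indefinite_integral_continuous_1 integrable_continuous_real contg)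
    fix x assume x: "a < x" "x < b"
    obtain y where y: "(\<Phi> has_real_derivative y) (at x)" "y \<le> g x" using der[OF x] by blast
    have "((\<lambda>u. integral {a..u} g) has_real_derivative g x) (at x within {a..b})"
      by (rule integral_has_real_derivative[OF contg]) (use x in auto)
    then have "((\<lambda>u. integral {a..u} g) has_real_derivative g x) (at x)"
      using x by (simp add: at_within_Icc_at)
    then have "(G has_real_derivative g x - y) (at x)" unfolding G_def
      by (intro derivative_intros y)
    then show "\<exists>y. (G has_real_derivative y) (at x) \<and> 0 \<le> y" using y by force
  qed (use assms in auto)
  then show ?thesis by (simp add: G_def)
qed

lemma integral_eq_boundary_diff:
  fixes g \<Phi> :: "real \<Rightarrow> real"
  assumes "a \<le> b" and "continuous_on {a..b} \<Phi>"
    and "\<And>x. a < x \<Longrightarrow> x < b \<Longrightarrow> (\<Phi> has_real_derivative g x) (at x)"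
  shows "integral {a..b} g = \<Phi> b - \<Phi> a"
  by (rule integral_unique, rule fundamental_theorem_of_calculus_interior)
     (use assms in \<open>auto simp: has_real_derivative_iff_has_vector_derivative[symmetric]\<close>)

text \<open>Jacobi's substitution: in the interior the integrand equals
  \<open>p (f' - f \<tau>'/\<tau>)\<^sup>2\<close> plus the derivative of \<open>p \<tau>' f\<^sup>2/\<tau>\<close>, and l'Hopital's rule shows
  that the latter vanishes at the end points.\<close>

lemma dirichlet_form_nonneg:
  fixes p q f f' \<tau> \<tau>' :: "real \<Rightarrow> real"
  assumes ab: "a < b"
    and cont: "continuous_on {a..b} p" "continuous_on {a..b} q" "continuous_on {a..b} f"
      "continuous_on {a..b} f'" "continuous_on {a..b} \<tau>" "continuous_on {a..b} \<tau>'"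
    and p: "\<And>x. a < x \<Longrightarrow> x < b \<Longrightarrow> 0 \<le> p x"
    and df: "\<And>x. a < x \<Longrightarrow> x < b \<Longrightarrow> (f has_real_derivative f' x) (at x)"
    and dt: "\<And>x. a < x \<Longrightarrow> x < b \<Longrightarrow> (\<tau> has_real_derivative \<tau>' x) (at x)"
    and dpt: "\<And>x. a < x \<Longrightarrow> x < b \<Longrightarrow> ((\<lambda>x. p x * \<tau>' x) has_real_derivative - q x * \<tau> x) (at x)"
    and pos: "\<And>x. a < x \<Longrightarrow> x < b \<Longrightarrow> 0 < \<tau> x"
    and zero: "f a = 0" "f b = 0" "\<tau> a = 0" "\<tau> b = 0" and nz: "\<tau>' a \<noteq> 0" "\<tau>' b \<noteq> 0"
  shows "0 \<le> integral {a..b} (\<lambda>x. p x * (f' x)\<^sup>2 - q x * (f x)\<^sup>2)"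
proof -
  \<comment> \<open>At the end points the quotient is 0/0 = 0 by convention and the factor
    \<open>f x\<close> vanishes, so \<open>\<Phi>\<close> is 0 there; its continuity needs only that
    \<open>f x / \<tau> x\<close> has finite limits.\<close>
  define \<Phi> where "\<Phi> x = p x * \<tau>' x * f x * (f x / \<tau> x)" for x
  have at_a: "at a within {a..b} = at_right a" and at_b: "at b within {a..b} = at_left b"
    using ab by (simp_all add: at_within_Icc_at_right at_within_Icc_at_left)
  have ra: "(g \<longlongrightarrow> g a) (at_right a)" and lb: "(g \<longlongrightarrow> g b) (at_left b)"
    if "continuous_on {a..b} g" for g :: "real \<Rightarrow> real"
    using that ab at_a at_b unfolding continuous_on_def by (metis atLeastAtMost_iff less_le order_refl)+
  have eva: "\<forall>\<^sub>F x in at_right a. a < x \<and> x < b"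
    using ab eventually_at_right_field by blast
  have evb: "\<forall>\<^sub>F x in at_left b. a < x \<and> x < b"
    using ab eventually_at_left_field by blast
  have qa: "((\<lambda>x. f x / \<tau> x) \<longlongrightarrow> f' a / \<tau>' a) (at_right a)"
  proof (rule lhopital_right)
    show "(f \<longlongrightarrow> 0) (at_right a)" "(\<tau> \<longlongrightarrow> 0) (at_right a)"
      using ra[OF cont(3)] ra[OF cont(5)] zero by auto
    show "\<forall>\<^sub>F x in at_right a. \<tau> x \<noteq> 0" using eva by eventually_elim (use pos in force)
    show "\<forall>\<^sub>F x in at_right a. \<tau>' x \<noteq> 0"
      using ra[OF cont(6)] nz(1) by (simp add: tendsto_imp_eventually_ne)
    show "\<forall>\<^sub>F x in at_right a. (f has_real_derivative f' x) (at x)"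
      using eva by eventually_elim (use df in force)
    show "\<forall>\<^sub>F x in at_right a. (\<tau> has_real_derivative \<tau>' x) (at x)"
      using eva by eventually_elim (use dt in force)
    show "((\<lambda>x. f' x / \<tau>' x) \<longlongrightarrow> f' a / \<tau>' a) (at_right a)"
      by (intro tendsto_intros ra cont nz)
  qed
  have qb: "((\<lambda>x. f x / \<tau> x) \<longlongrightarrow> f' b / \<tau>' b) (at_left b)"
  proof (rule lhopital_left)
    show "(f \<longlongrightarrow> 0) (at_left b)" "(\<tau> \<longlongrightarrow> 0) (at_left b)"
      using lb[OF cont(3)] lb[OF cont(5)] zero by auto
    show "\<forall>\<^sub>F x in at_left b. \<tau> x \<noteq> 0" using evb by eventually_elim (use pos in force)
    show "\<forall>\<^sub>F x in at_left b. \<tau>' x \<noteq> 0"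
      using lb[OF cont(6)] nz(2) by (simp add: tendsto_imp_eventually_ne)
    show "\<forall>\<^sub>F x in at_left b. (f has_real_derivative f' x) (at x)"
      using evb by eventually_elim (use df in force)
    show "\<forall>\<^sub>F x in at_left b. (\<tau> has_real_derivative \<tau>' x) (at x)"
      using evb by eventually_elim (use dt in force)
    show "((\<lambda>x. f' x / \<tau>' x) \<longlongrightarrow> f' b / \<tau>' b) (at_left b)"
      by (intro tendsto_intros lb cont nz)
  qed
  have "((\<lambda>x. p x * \<tau>' x * f x * (f x / \<tau> x)) \<longlongrightarrow> p a * \<tau>' a * f a * (f' a / \<tau>' a)) (at_right a)"
    by (intro tendsto_intros ra cont qa)
  then have \<Phi>a: "(\<Phi> \<longlongrightarrow> \<Phi> a) (at a within {a..b})" by (simp add: at_a \<Phi>_def[abs_def] zero)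
  have "((\<lambda>x. p x * \<tau>' x * f x * (f x / \<tau> x)) \<longlongrightarrow> p b * \<tau>' b * f b * (f' b / \<tau>' b)) (at_left b)"
    by (intro tendsto_intros lb cont qb)
  then have \<Phi>b: "(\<Phi> \<longlongrightarrow> \<Phi> b) (at b within {a..b})" by (simp add: at_b \<Phi>_def[abs_def] zero)
  have d\<Phi>: "(\<Phi> has_real_derivative
      (- q x * \<tau> x) * ((f x)\<^sup>2 / \<tau> x) + (2 * f x * f' x * \<tau> x - (f x)\<^sup>2 * \<tau>' x) / (\<tau> x)\<^sup>2 * (p x * \<tau>' x)) (at x)"
    if x: "a < x" "x < b" for x
  proof -
    have "\<Phi> = (\<lambda>x. (p x * \<tau>' x) * ((f x)\<^sup>2 / \<tau> x))"
      by (auto simp: \<Phi>_def power2_eq_square)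
    moreover have "((\<lambda>x. (f x)\<^sup>2 / \<tau> x) has_real_derivative (2 * f x * f' x * \<tau> x - (f x)\<^sup>2 * \<tau>' x) / (\<tau> x)\<^sup>2) (at x)"
      using pos[OF x] by (auto intro!: derivative_eq_intros df[OF x] dt[OF x] simp: power2_eq_square)
    ultimately show ?thesis using DERIV_mult[OF dpt[OF x]] by blast
  qed
  have "\<Phi> b - \<Phi> a \<le> integral {a..b} (\<lambda>x. p x * (f' x)\<^sup>2 - q x * (f x)\<^sup>2)"
  proof (rule integral_ge_boundary_diff)
    show "continuous_on {a..b} (\<lambda>x. p x * (f' x)\<^sup>2 - q x * (f x)\<^sup>2)"
      by (intro continuous_intros cont)
    show "continuous_on {a..b} \<Phi>"
      unfolding continuous_on_def
    proof
      fix x assume "x \<in> {a..b}"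
      then consider "x = a" | "x = b" | "a < x" "x < b" by fastforce
      then show "(\<Phi> \<longlongrightarrow> \<Phi> x) (at x within {a..b})"
      proof cases
        case 3
        then have "isCont \<Phi> x" using d\<Phi> DERIV_isCont by blast
        then show ?thesis by (meson continuous_at_imp_continuous_at_within continuous_within)
      qed (use \<Phi>a \<Phi>b in auto)
    qed
    fix x assume x: "a < x" "x < b"
    have "p x * (f' x)\<^sup>2 - q x * (f x)\<^sup>2 -
       ((- q x * \<tau> x) * ((f x)\<^sup>2 / \<tau> x) + (2 * f x * f' x * \<tau> x - (f x)\<^sup>2 * \<tau>' x) / (\<tau> x)\<^sup>2 * (p x * \<tau>' x))
       = p x * (f' x - f x * \<tau>' x / \<tau> x)\<^sup>2"
      using pos[OF x] by (simp add: field_simps power2_eq_square)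
    also have "\<dots> \<ge> 0" using p[OF x] by simp
    finally show "\<exists>y. (\<Phi> has_real_derivative y) (at x) \<and> y \<le> p x * (f' x)\<^sup>2 - q x * (f x)\<^sup>2"
      using d\<Phi>[OF x] by auto
  qed (use ab in auto)
  then show ?thesis by (simp add: \<Phi>_def zero)
qed

section \<open>Wirtinger's inequality for antiperiodic functions\<close>

lemma integral_periodic_shift:
  fixes f :: "real \<Rightarrow> real"
  assumes cont: "continuous_on UNIV f" and per: "\<And>x. f (x + L) = f x" and L: "0 < L"
  shows "integral {c..c + L} f = integral {0..L} f"
proof -
  have int: "f integrable_on {x..y}" for x y
    by (rule integrable_continuous_real) (use cont continuous_on_subset in blast)
  define k where "k = \<lfloor>c / L\<rfloor>"
  define c' where "c' = c - of_int k * L"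
  have "of_int k \<le> c / L" "c / L < of_int k + 1" unfolding k_def by linarith+
  then have "of_int k * L \<le> c" "c < (of_int k + 1) * L"
    using L by (simp_all add: le_divide_eq divide_less_eq)
  then have c': "0 \<le> c'" "c' < L" by (auto simp: c'_def algebra_simps)
  have per': "f (x + of_int j * L) = f x" for x and j :: int
  proof -
    have n: "f (x + of_nat m * L) = f x" for x and m :: nat
    proof (induction m)
      case (Suc m)
      then show ?case using per[of "x + of_nat m * L"] by (simp add: algebra_simps)
    qed simp
    show ?thesis
    proof (cases "0 \<le> j")
      case True
      then show ?thesis using n[of x "nat j"] by simp
    next
      case False
      then show ?thesis using n[of "x + of_int j * L" "nat (- j)"] by simp
    qed
  qed
  have "integral {c..c + L} f = integral {c - of_int k * L..c + L - of_int k * L} (\<lambda>x. f (x + of_int k * L))"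
    by (rule integral_shift_real_ivl[symmetric])
  also have "\<dots> = integral {c'..c' + L} f" by (simp only: per') (simp add: c'_def algebra_simps)
  also have "\<dots> = integral {c'..L} f + integral {L..c' + L} f"
    by (rule Henstock_Kurzweil_Integration.integral_combine[symmetric]) (use c' int in auto)
  also have "integral {L..c' + L} f = integral {L - L..c' + L - L} (\<lambda>x. f (x + L))"
    by (rule integral_shift_real_ivl[symmetric])
  also have "\<dots> = integral {0..c'} f" by (simp add: per)
  also have "integral {c'..L} f + integral {0..c'} f = integral {0..L} f"
    using Henstock_Kurzweil_Integration.integral_combine[of 0 c' L f] c' int by auto
  finally show ?thesis .
qed

text \<open>An antiperiodic function changes sign over a length \<open>L\<close>, so it has a zero
  \<open>c\<close> and vanishes at \<open>c + L\<close> too. On this interval it satisfies Dirichlet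
  conditions, and a sine shifted to \<open>c\<close> is the positive solution required by
  \<open>dirichlet_form_nonneg\<close>; its frequency gives the constant.\<close>

lemma wirtinger_antiperiodic:
  fixes k k' :: "real \<Rightarrow> real"
  assumes L: "0 < L" and anti: "\<And>x. k (x + L) = - k x"
    and dk: "\<And>x. (k has_real_derivative k' x) (at x)" and ck': "continuous_on UNIV k'"
  shows "integral {0..L} (\<lambda>x. (k x)\<^sup>2) \<le> (L / pi)\<^sup>2 * integral {0..L} (\<lambda>x. (k' x)\<^sup>2)"
proof -
  have ck: "continuous_on UNIV k"
    using dk by (meson DERIV_isCont continuous_at_imp_continuous_on)
  have anti': "k' (x + L) = - k' x" for x
  proof -
    have "((\<lambda>x. k (x + L)) has_real_derivative k' (x + L)) (at x)"
      using dk[of "x + L"] by (simp add: DERIV_shift)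
    moreover have "((\<lambda>x. k (x + L)) has_real_derivative - k' x) (at x)"
      using dk by (auto simp: anti intro!: derivative_eq_intros)
    ultimately show ?thesis using DERIV_unique by blast
  qed
  have "\<exists>c. k c = 0"
  proof -
    have "\<exists>x. 0 \<le> x \<and> x \<le> L \<and> (k 0 \<le> 0 \<longrightarrow> k x = 0) \<and> (0 \<le> k 0 \<longrightarrow> k x = 0)"
      using IVT'[of k 0 0 L] IVT2'[of k L 0 0] anti[of 0] L continuous_on_subset[OF ck, of "{0..L}"]
      by (cases "k 0 \<le> 0") auto
    then show ?thesis by (meson linorder_le_cases)
  qed
  then obtain c where c: "k c = 0" by blast
  have mul: "pi / L * (x - c) \<in> {0<..<pi}" if "c < x" "x < c + L" for x
  proof -
    have "pi / L * (x - c) < pi / L * L"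
      by (rule mult_strict_left_mono) (use that L in auto)
    then show ?thesis using that L by simp
  qed
  have "0 \<le> integral {c..c + L} (\<lambda>x. 1 * (k' x)\<^sup>2 - (pi / L)\<^sup>2 * (k x)\<^sup>2)"
  proof (rule dirichlet_form_nonneg[where \<tau> = "\<lambda>x. sin (pi / L * (x - c))" and
        \<tau>' = "\<lambda>x. pi / L * cos (pi / L * (x - c))"])
    show "continuous_on {c..c + L} k" "continuous_on {c..c + L} k'"
      using ck ck' continuous_on_subset by blast+
    show "k c = 0" "k (c + L) = 0" using c anti[of c] by auto
    show "sin (pi / L * (x - c)) > 0" if "c < x" "x < c + L" for x
      using mul[OF that] by (auto intro: sin_gt_zero)
  qed (use L in \<open>auto intro!: continuous_intros derivative_eq_intros dk simp: power2_eq_square\<close>)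
  also have "\<dots> = integral {c..c + L} (\<lambda>x. (k' x)\<^sup>2) - (pi / L)\<^sup>2 * integral {c..c + L} (\<lambda>x. (k x)\<^sup>2)"
    by (subst Henstock_Kurzweil_Integration.integral_diff)
       (auto intro!: integrable_continuous_real continuous_intros continuous_on_subset[OF ck]
          continuous_on_subset[OF ck'])
  also have "integral {c..c + L} (\<lambda>x. (k' x)\<^sup>2) = integral {0..L} (\<lambda>x. (k' x)\<^sup>2)"
    by (rule integral_periodic_shift) (use L ck' anti' in \<open>auto intro!: continuous_intros\<close>)
  also have "integral {c..c + L} (\<lambda>x. (k x)\<^sup>2) = integral {0..L} (\<lambda>x. (k x)\<^sup>2)"
    by (rule integral_periodic_shift) (use L ck anti in \<open>auto intro!: continuous_intros\<close>)
  finally show ?thesis using L by (simp add: field_simps power2_eq_square)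
qed

section \<open>Orthogonal invariance and polar coordinates\<close>

lemma nn_integral_lborel_translate:
  fixes c :: "'a::euclidean_space"
  assumes [measurable]: "f \<in> borel_measurable borel"
  shows "(\<integral>\<^sup>+x. f (c + x) \<partial>lborel) = (\<integral>\<^sup>+x. f x \<partial>lborel)"
proof -
  have "(\<integral>\<^sup>+x. f x \<partial>lborel) = (\<integral>\<^sup>+x. f x \<partial>distr lborel borel ((+) c))"
    by (simp add: lborel_distr_plus)
  also have "\<dots> = (\<integral>\<^sup>+x. f (c + x) \<partial>lborel)" by (subst nn_integral_distr) auto
  finally show ?thesis by simp
qed

lemma nn_integral_lborel_scaleR:
  fixes f :: "'a::euclidean_space \<Rightarrow> ennreal"
  assumes [measurable]: "f \<in> borel_measurable borel" and c: "c \<noteq> 0"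
  shows "(\<integral>\<^sup>+x. f x \<partial>lborel) = ennreal (\<bar>c\<bar> ^ DIM('a)) * (\<integral>\<^sup>+x. f (c *\<^sub>R x) \<partial>lborel)"
  by (subst lborel_affine[OF c, of 0])
     (simp add: nn_integral_density nn_integral_distr nn_integral_cmult)

text \<open>By uniqueness of translation invariant measures: Fubini's theorem for
  \<open>1\<^sub>A(f x) 1\<^sub>B(f x + y)\<close> shows that the push-forward of Lebesgue measure is proportional
  to it, and the unit ball fixes the factor.\<close>

lemma lborel_distr_orthogonal:
  fixes f :: "'a::euclidean_space \<Rightarrow> 'a"
  assumes f: "orthogonal_transformation f"
  shows "distr lborel borel f = lborel"
proof (rule measure_eqI)
  fix A assume "A \<in> sets (distr lborel borel f)"
  then have A[measurable]: "A \<in> sets borel" by simp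
  have lin: "linear f" and nf: "norm (f x) = norm x" for x
    using f by (auto simp: orthogonal_transformation)
  have [measurable]: "f \<in> borel \<rightarrow>\<^sub>M borel"
    by (intro borel_measurable_continuous_onI linear_continuous_on linear_conv_bounded_linear[THEN iffD1] lin)
  define B where "B = (ball 0 1 :: 'a set)"
  have [measurable]: "B \<in> sets borel" by (simp add: B_def)
  have surj: "surj f" by (rule orthogonal_transformation_surj[OF f])
  let ?A = "\<lambda>x. indicator A x :: ennreal" and ?B = "\<lambda>x. indicator B x :: ennreal"
  have "(\<integral>\<^sup>+x. ?A (f x) \<partial>lborel) * (\<integral>\<^sup>+y. ?B y \<partial>lborel) = (\<integral>\<^sup>+x. (\<integral>\<^sup>+y. ?A (f x) * ?B (f x + y) \<partial>lborel) \<partial>lborel)"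
    by (simp add: nn_integral_cmult nn_integral_multc nn_integral_lborel_translate[of ?B])
  also have "\<dots> = (\<integral>\<^sup>+y. (\<integral>\<^sup>+x. ?A (f x) * ?B (f x + y) \<partial>lborel) \<partial>lborel)"
    by (rule lborel_pair.Fubini') measurable
  also have "\<dots> = (\<integral>\<^sup>+y. (\<integral>\<^sup>+x. ?A (f x - y) * ?B (f x) \<partial>lborel) \<partial>lborel)"
  proof (rule nn_integral_cong)
    fix y :: 'a
    \<comment> \<open>Surjectivity enters here: translating \<open>x\<close> by a preimage of
      \<open>- y\<close> moves the shift from the argument of \<open>B\<close> to that of
      \<open>A\<close>.\<close>
    obtain c where c: "f c = - y" using surj by (metis surjD)
    have "(\<integral>\<^sup>+x. ?A (f x) * ?B (f x + y) \<partial>lborel) = (\<integral>\<^sup>+x. ?A (f (c + x)) * ?B (f (c + x) + y) \<partial>lborel)"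
      by (rule nn_integral_lborel_translate[symmetric, where f = "\<lambda>x. ?A (f x) * ?B (f x + y)"]) measurable
    then show "(\<integral>\<^sup>+x. ?A (f x) * ?B (f x + y) \<partial>lborel) = (\<integral>\<^sup>+x. ?A (f x - y) * ?B (f x) \<partial>lborel)"
      by (simp add: linear_add[OF lin] c)
  qed
  also have "\<dots> = (\<integral>\<^sup>+x. (\<integral>\<^sup>+y. ?A (f x - y) * ?B (f x) \<partial>lborel) \<partial>lborel)"
    by (rule lborel_pair.Fubini') measurable
  also have "\<dots> = (\<integral>\<^sup>+x. (\<integral>\<^sup>+y. ?A y \<partial>lborel) * ?B (f x) \<partial>lborel)"
  proof (rule nn_integral_cong)
    fix x :: 'a
    have "(\<integral>\<^sup>+y. ?A (f x - y) \<partial>lborel) = (\<integral>\<^sup>+y. ?A (f x + y) \<partial>lborel)"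
      using nn_integral_lborel_scaleR[of "\<lambda>y. ?A (f x - y)" "-1"] by simp
    also have "\<dots> = (\<integral>\<^sup>+y. ?A y \<partial>lborel)"
      by (rule nn_integral_lborel_translate) measurable
    finally show "(\<integral>\<^sup>+y. ?A (f x - y) * ?B (f x) \<partial>lborel) = (\<integral>\<^sup>+y. ?A y \<partial>lborel) * ?B (f x)"
      by (simp add: nn_integral_multc)
  qed
  also have "\<dots> = (\<integral>\<^sup>+y. ?A y \<partial>lborel) * (\<integral>\<^sup>+x. ?B (f x) \<partial>lborel)"
    by (simp add: nn_integral_cmult)
  also have "(\<lambda>x. ?B (f x)) = ?B" by (auto simp: B_def indicator_def nf)
  finally have eq: "(\<integral>\<^sup>+x. ?A (f x) \<partial>lborel) * emeasure lborel B = (\<integral>\<^sup>+y. ?A y \<partial>lborel) * emeasure lborel B"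
    by simp
  have B: "emeasure lborel B \<noteq> \<infinity>" "emeasure lborel B \<noteq> 0"
    using unit_ball_vol_pos[of "real DIM('a)"] by (auto simp: B_def emeasure_ball less_imp_neq[THEN not_sym])
  have "(\<integral>\<^sup>+x. ?A (f x) \<partial>lborel) = (\<integral>\<^sup>+y. ?A y \<partial>lborel)"
    using eq B by (auto simp: ennreal_mult_cancel_left mult.commute[of _ "emeasure lborel B"])
  moreover have "(\<integral>\<^sup>+x. ?A (f x) \<partial>lborel) = emeasure (distr lborel borel f) A"
    using nn_integral_distr[of f lborel borel ?A] by simp
  ultimately show "emeasure (distr lborel borel f) A = emeasure lborel A" by simp
qed auto

lemma integral_lborel_orthogonal:
  fixes f :: "'a::euclidean_space \<Rightarrow> 'a" and h :: "'a \<Rightarrow> real"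
  assumes f: "orthogonal_transformation f" and [measurable]: "h \<in> borel_measurable borel"
  shows "(\<integral>x. h (f x) \<partial>lborel) = (\<integral>x. h x \<partial>lborel)"
proof -
  have [measurable]: "f \<in> borel \<rightarrow>\<^sub>M borel"
    by (intro borel_measurable_continuous_onI linear_continuous_on linear_conv_bounded_linear[THEN iffD1]
        orthogonal_transformation_linear f)
  have "(\<integral>x. h x \<partial>lborel) = (\<integral>x. h x \<partial>distr lborel borel f)"
    by (simp add: lborel_distr_orthogonal f)
  then show ?thesis by (simp add: integral_distr)
qed

lemma integrable_on_ball:
  fixes h :: "'a::euclidean_space \<Rightarrow> real"
  assumes [measurable]: "h \<in> borel_measurable borel" and "\<And>x. x \<in> ball 0 1 \<Longrightarrow> \<bar>h x\<bar> \<le> C"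
  shows "integrable lborel (\<lambda>x. indicator (ball 0 1) x * h x)"
proof (rule Bochner_Integration.integrable_bound[where f = "\<lambda>x. indicator (ball 0 1) x * C"])
  show "integrable lborel (\<lambda>x. indicator (ball 0 1) x * C :: real)"
    by (intro integrable_mult_left integrable_real_indicator) (auto simp: emeasure_ball)
  show "AE x in lborel. norm (indicator (ball 0 1) x * h x) \<le> norm (indicator (ball 0 1) x * C)"
    using assms(2) by (intro AE_I2) (force simp: indicator_def)
  show "(\<lambda>x. indicator (ball 0 1) x * h x) \<in> borel_measurable lborel"
    using assms(1) by (intro borel_measurable_times borel_measurable_indicator) auto
qed

text \<open>A function of the direction alone is invariant under dilations, so only the Jacobian
  remains. Closed balls are taken because their complements give the tails \<open>{s<..}\<close> of
  the radial law.\<close>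

lemma nn_integral_cball_sgn:
  fixes g :: "'a::euclidean_space \<Rightarrow> ennreal"
  assumes [measurable]: "g \<in> borel_measurable borel" and r: "0 < r"
  shows "(\<integral>\<^sup>+x. indicator (cball 0 r) x * g (x /\<^sub>R norm x) \<partial>lborel) =
    ennreal (r ^ DIM('a)) * (\<integral>\<^sup>+x. indicator (cball 0 1) x * g (x /\<^sub>R norm x) \<partial>lborel)"
proof -
  have "(\<integral>\<^sup>+x. indicator (cball 0 r) x * g (x /\<^sub>R norm x) \<partial>lborel) = ennreal (\<bar>r\<bar> ^ DIM('a)) *
     (\<integral>\<^sup>+x. indicator (cball 0 r) (r *\<^sub>R x) * g ((r *\<^sub>R x) /\<^sub>R norm (r *\<^sub>R x)) \<partial>lborel)"
    by (rule nn_integral_lborel_scaleR) (measurable, use r in auto)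
  also have "(\<lambda>x::'a. indicator (cball 0 r) (r *\<^sub>R x) * g ((r *\<^sub>R x) /\<^sub>R norm (r *\<^sub>R x))) =
     (\<lambda>x. indicator (cball 0 1) x * g (x /\<^sub>R norm x))"
    using r by (auto simp: indicator_def fun_eq_iff field_simps)
  finally show ?thesis using r by simp
qed

lemma ball_in_sets_borel [measurable]: "ball c r \<in> sets borel" "cball c r \<in> sets borel"
  by simp_all

lemma AE_norm_neq: "AE x::'a::euclidean_space in lborel. norm x \<noteq> r"
proof -
  have "sphere 0 r \<in> null_sets (lborel :: 'a measure)"
    using negligible_sphere[of "0::'a" r] by (simp add: negligible_iff_null_sets null_sets_def)
  then show ?thesis using AE_not_in by force
qed

text \<open>Direction and norm are independent. Weight the ball by a function of the direction and
  push forward under the norm: by the scaling of balls, for \<open>s\<close> between 0 and 1 the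
  tail beyond \<open>s\<close> is \<open>1 - s ^ DIM('a)\<close> times the total mass, whatever the
  weight. Finite measures on the line that agree on all half-lines \<open>{s<..}\<close> coincide.
  Both sides are multiplied out so that no division in \<open>ennreal\<close> occurs.\<close>

lemma nn_integral_polar:
  fixes g :: "'a::euclidean_space \<Rightarrow> ennreal" and f :: "real \<Rightarrow> ennreal"
  assumes [measurable]: "g \<in> borel_measurable borel" "f \<in> borel_measurable borel"
    and fin: "(\<integral>\<^sup>+x. indicator (ball 0 1) x * g (x /\<^sub>R norm x) \<partial>lborel) < \<infinity>"
  shows "emeasure lborel (ball 0 1 :: 'a set) * (\<integral>\<^sup>+x. indicator (ball 0 1) x * g (x /\<^sub>R norm x) * f (norm x) \<partial>lborel)
    = (\<integral>\<^sup>+x. indicator (ball 0 1) x * g (x /\<^sub>R norm x) \<partial>lborel) *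
      (\<integral>\<^sup>+(x::'a). indicator (ball 0 1) x * f (norm x) \<partial>lborel)"
proof -
  define N where "N h = distr (density lborel (\<lambda>x::'a. indicator (ball 0 1) x * h (x /\<^sub>R norm x))) borel norm"
    for h :: "'a \<Rightarrow> ennreal"
  define I where "I h = (\<integral>\<^sup>+(x::'a). indicator (ball 0 1) x * h (x /\<^sub>R norm x) \<partial>lborel)" for h :: "'a \<Rightarrow> ennreal"
  define c where "c s = (if s \<le> 0 then 1 else if s < 1 then 1 - s ^ DIM('a) else (0::real))" for s
  have ball_cball: "(\<integral>\<^sup>+(x::'a). indicator (cball 0 1) x * h (x /\<^sub>R norm x) \<partial>lborel) = I h" for h :: "'a \<Rightarrow> ennreal"
    unfolding I_def by (rule nn_integral_cong_AE, use AE_norm_neq[of 1] in eventually_elim)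
      (auto simp: indicator_def)
  have tail: "emeasure (N h) {s<..} = ennreal (c s) * I h"
    if [measurable]: "h \<in> borel_measurable borel" and hfin: "I h < \<infinity>" for s h
  proof -
    have eq: "emeasure (N h) {s<..} =
        (\<integral>\<^sup>+x. indicator (ball 0 1) x * h (x /\<^sub>R norm x) * indicator {x. s < norm x} x \<partial>lborel)"
    proof -
      have "{x::'a. s < norm x} \<in> sets borel" by measurable
      moreover have "(\<lambda>x::'a. indicator (ball 0 1) x * h (x /\<^sub>R norm x)) \<in> borel_measurable lborel"
        by measurable
      ultimately show ?thesis unfolding N_def
        by (subst emeasure_distr) (auto simp: vimage_def intro!: emeasure_density)
    qed
    consider "s \<le> 0" | "0 < s" "s < 1" | "1 \<le> s" by linarith
    then show ?thesis
    proof cases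
      case 1
      have "s < norm x" if "norm x \<noteq> 0" for x :: 'a
        using that 1 by (simp add: le_less_trans[of s 0])
      then have "emeasure (N h) {s<..} = I h" unfolding eq I_def
        by (intro nn_integral_cong_AE, use AE_norm_neq[of 0] in eventually_elim)
           (auto simp: indicator_def)
      then show ?thesis using 1 by (simp add: c_def)
    next
      case 2
      have "(\<integral>\<^sup>+x. indicator (cball 0 s) x * h (x /\<^sub>R norm x) \<partial>lborel) + emeasure (N h) {s<..} =
          (\<integral>\<^sup>+x. indicator (cball 0 s) x * h (x /\<^sub>R norm x)
            + indicator (ball 0 1) x * h (x /\<^sub>R norm x) * indicator {x. s < norm x} x \<partial>lborel)"
        unfolding eq by (rule nn_integral_add[symmetric]) measurable
      also have "\<dots> = I h"
        unfolding I_def by (rule nn_integral_cong) (use 2 in \<open>auto simp: indicator_def\<close>)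
      finally have a: "ennreal (s ^ DIM('a)) * I h + emeasure (N h) {s<..} = I h"
        using nn_integral_cball_sgn[of h s] 2 ball_cball by simp
      have "ennreal (s ^ DIM('a)) * I h + ennreal (1 - s ^ DIM('a)) * I h =
          (ennreal (s ^ DIM('a)) + ennreal (1 - s ^ DIM('a))) * I h" by (simp add: distrib_right)
      also have "\<dots> = I h"
        using 2 by (subst ennreal_plus[symmetric]) (auto simp: power_le_one)
      finally have "ennreal (s ^ DIM('a)) * I h + emeasure (N h) {s<..}
          = ennreal (s ^ DIM('a)) * I h + ennreal (1 - s ^ DIM('a)) * I h" using a by simp
      then show ?thesis using hfin 2
        by (auto simp: ennreal_add_left_cancel c_def ennreal_mult_eq_top_iff)
    next
      case 3
      have "emeasure (N h) {s<..} = 0" unfolding eq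
        by (subst nn_integral_0_iff_AE) (use 3 in \<open>auto simp: indicator_def\<close>)
      then show ?thesis using 3 by (simp add: c_def)
    qed
  qed
  have I1: "I (\<lambda>_. 1) = emeasure lborel (ball 0 1 :: 'a set)" by (simp add: I_def)
  have I1fin: "I (\<lambda>_. 1) < \<infinity>" by (simp add: I1 emeasure_ball)
  have "scale_measure (I (\<lambda>_. 1)) (N g) = scale_measure (I g) (N (\<lambda>_. 1))"
  proof (rule measure_eqI_lessThan)
    have sN: "sets (N h) = sets borel" for h by (simp add: N_def)
    show "sets (scale_measure (I (\<lambda>_. 1)) (N g)) = sets borel"
      "sets (scale_measure (I g) (N (\<lambda>_. 1))) = sets borel" by (simp_all add: sN)
    have gfin: "I g < \<infinity>" using fin by (simp add: I_def)
    have t: "emeasure (N g) {x<..} = ennreal (c x) * I g"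
      "emeasure (N (\<lambda>_. 1)) {x<..} = ennreal (c x) * I (\<lambda>_. 1)" for x
      by (rule tail; use gfin I1fin in simp)+
    show "emeasure (scale_measure (I (\<lambda>_. 1)) (N g)) {x<..} < \<infinity>" for x
      using gfin I1fin by (simp add: t ennreal_mult_less_top)
    show "emeasure (scale_measure (I (\<lambda>_. 1)) (N g)) {x<..} = emeasure (scale_measure (I g) (N (\<lambda>_. 1))) {x<..}" for x
      by (simp add: t mult_ac)
  qed
  then have "(\<integral>\<^sup>+r. f r \<partial>scale_measure (I (\<lambda>_. 1)) (N g)) = (\<integral>\<^sup>+r. f r \<partial>scale_measure (I g) (N (\<lambda>_. 1)))"
    by simp
  then have "I (\<lambda>_. 1) * (\<integral>\<^sup>+r. f r \<partial>N g) = I g * (\<integral>\<^sup>+r. f r \<partial>N (\<lambda>_. 1))"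
    by (simp add: nn_integral_scale_measure N_def)
  then show ?thesis
    unfolding I1 by (simp add: N_def I_def nn_integral_distr nn_integral_density)
qed

text \<open>The signed case follows from the nonnegative one by adding the bound \<open>C\<close> to
  \<open>g\<close> and subtracting the identity for the constant.\<close>

lemma integral_polar:
  fixes g :: "'a::euclidean_space \<Rightarrow> real" and f :: "real \<Rightarrow> real"
  assumes [measurable]: "g \<in> borel_measurable borel" "f \<in> borel_measurable borel"
    and g: "\<And>x. norm x \<le> 1 \<Longrightarrow> \<bar>g x\<bar> \<le> C" and f: "\<And>r. 0 \<le> r \<Longrightarrow> r < 1 \<Longrightarrow> 0 \<le> f r \<and> f r \<le> K"
  shows "measure lborel (ball 0 1 :: 'a set) * (\<integral>x. indicator (ball 0 1) x * (g (x /\<^sub>R norm x) * f (norm x)) \<partial>lborel)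
    = (\<integral>x. indicator (ball 0 1) x * g (x /\<^sub>R norm x) \<partial>lborel) *
      (\<integral>(x::'a). indicator (ball 0 1) x * f (norm x) \<partial>lborel)"
proof -
  have C0: "0 \<le> C" using g[of 0] by simp
  have ng: "norm (x /\<^sub>R norm x) \<le> 1" for x :: 'a by (cases "x = 0") auto
  have if1: "integrable lborel (\<lambda>x::'a. indicator (ball 0 1) x * f (norm x))"
    by (rule integrable_on_ball[where C = K]) (use f in auto)
  have ih: "integrable lborel (\<lambda>x::'a. indicator (ball 0 1) x * h (x /\<^sub>R norm x))"
   and ihf: "integrable lborel (\<lambda>x::'a. indicator (ball 0 1) x * (h (x /\<^sub>R norm x) * f (norm x)))"
    if [measurable]: "h \<in> borel_measurable borel" and h: "\<And>x. norm x \<le> 1 \<Longrightarrow> \<bar>h x\<bar> \<le> B" for h :: "'a \<Rightarrow> real" and B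
  proof -
    show "integrable lborel (\<lambda>x::'a. indicator (ball 0 1) x * h (x /\<^sub>R norm x))"
      by (rule integrable_on_ball[where C = B]) (use h ng in auto)
    show "integrable lborel (\<lambda>x::'a. indicator (ball 0 1) x * (h (x /\<^sub>R norm x) * f (norm x)))"
      by (rule integrable_on_ball[where C = "B * K"])
         (use h ng f in \<open>auto simp: abs_mult intro!: mult_mono order_trans[OF abs_ge_zero h[OF ng]]\<close>)
  qed
  have nonneg: "measure lborel (ball 0 1 :: 'a set) * (\<integral>x. indicator (ball 0 1) x * (h (x /\<^sub>R norm x) * f (norm x)) \<partial>lborel)
    = (\<integral>x. indicator (ball 0 1) x * h (x /\<^sub>R norm x) \<partial>lborel) *
      (\<integral>(x::'a). indicator (ball 0 1) x * f (norm x) \<partial>lborel)"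
    if hm[measurable]: "h \<in> borel_measurable borel" and hb: "\<And>x. norm x \<le> 1 \<Longrightarrow> \<bar>h x\<bar> \<le> B"
      and h0: "\<And>x. norm x \<le> 1 \<Longrightarrow> 0 \<le> h x"
    for h :: "'a \<Rightarrow> real" and B
  proof -
    have e1: "(\<integral>\<^sup>+x. indicator (ball 0 1) x * ennreal (h (x /\<^sub>R norm x)) \<partial>lborel) =
        ennreal (\<integral>x. indicator (ball 0 1) x * h (x /\<^sub>R norm x) \<partial>lborel)"
      by (subst nn_integral_eq_integral[symmetric])
         (use ih[OF hm hb] h0 ng in \<open>auto intro!: nn_integral_cong simp: indicator_def\<close>)
    have e2: "(\<integral>\<^sup>+(x::'a). indicator (ball 0 1) x * ennreal (f (norm x)) \<partial>lborel) =
        ennreal (\<integral>(x::'a). indicator (ball 0 1) x * f (norm x) \<partial>lborel)"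
      by (subst nn_integral_eq_integral[symmetric])
         (use if1 f in \<open>auto intro!: nn_integral_cong simp: indicator_def\<close>)
    have e3: "(\<integral>\<^sup>+x. indicator (ball 0 1) x * ennreal (h (x /\<^sub>R norm x)) * ennreal (f (norm x)) \<partial>lborel) =
        ennreal (\<integral>x. indicator (ball 0 1) x * (h (x /\<^sub>R norm x) * f (norm x)) \<partial>lborel)"
      by (subst nn_integral_eq_integral[symmetric])
         (use ihf[OF hm hb] h0 ng f in \<open>auto intro!: nn_integral_cong simp: indicator_def ennreal_mult\<close>)
    have m: "emeasure lborel (ball 0 1 :: 'a set) = ennreal (measure lborel (ball 0 1 :: 'a set))"
      by (rule emeasure_eq_ennreal_measure) (simp add: emeasure_ball)
    have n1: "0 \<le> (\<integral>x. indicator (ball 0 1) x * h (x /\<^sub>R norm x) \<partial>lborel)"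
      and n2: "0 \<le> (\<integral>(x::'a). indicator (ball 0 1) x * f (norm x) \<partial>lborel)"
      and n3: "0 \<le> (\<integral>x. indicator (ball 0 1) x * (h (x /\<^sub>R norm x) * f (norm x)) \<partial>lborel)"
      using h0 ng f by (auto intro!: integral_nonneg_AE simp: indicator_def)
    show ?thesis
      using nn_integral_polar[of "\<lambda>x. ennreal (h x)" "\<lambda>r. ennreal (f r)"] n1 n2 n3
      unfolding e1 e2 e3 m by (simp flip: ennreal_mult)
  qed
  have a: "(\<integral>x. indicator (ball 0 1) x * (g (x /\<^sub>R norm x) + C) \<partial>lborel) =
    (\<integral>x. indicator (ball 0 1) x * g (x /\<^sub>R norm x) \<partial>lborel) + (\<integral>(x::'a). indicator (ball 0 1) x * C \<partial>lborel)"
    unfolding distrib_left using ih[of g C] ih[of "\<lambda>_. C" C] g C0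
    by (intro Bochner_Integration.integral_add) auto
  have b: "(\<integral>x. indicator (ball 0 1) x * ((g (x /\<^sub>R norm x) + C) * f (norm x)) \<partial>lborel) =
    (\<integral>x. indicator (ball 0 1) x * (g (x /\<^sub>R norm x) * f (norm x)) \<partial>lborel) + (\<integral>(x::'a). indicator (ball 0 1) x * (C * f (norm x)) \<partial>lborel)"
    unfolding distrib_left distrib_right using ihf[of g C] ihf[of "\<lambda>_. C" C] g C0
    by (intro Bochner_Integration.integral_add) auto
  have g2: "\<bar>g x + C\<bar> \<le> 2 * C" "0 \<le> g x + C" if "norm x \<le> 1" for x using g[OF that] by auto
  show ?thesis
    using nonneg[of "\<lambda>x. g x + C" "2 * C"] nonneg[of "\<lambda>_. C" C] g2 C0
    unfolding a b by (simp add: algebra_simps)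
qed

section \<open>The Poincare inequality on the sphere\<close>

lemma integral_double_interval:
  fixes F :: "real \<Rightarrow> real"
  assumes "continuous_on UNIV F" "0 \<le> L"
  shows "integral {0..2 * L} F = integral {0..L} (\<lambda>x. F x + F (x + L))"
proof -
  have int: "F integrable_on {x..y}" for x y
    by (rule integrable_continuous_real) (use assms continuous_on_subset in blast)
  have int2: "(\<lambda>x. F (x + L)) integrable_on {0..L}"
    by (intro integrable_continuous_real continuous_on_compose2[OF assms(1)] continuous_intros) auto
  have "integral {0..2 * L} F = integral {0..L} F + integral {L..2 * L} F"
    by (rule Henstock_Kurzweil_Integration.integral_combine[symmetric]) (use assms int in auto)
  also have "integral {L..2 * L} F = integral {0..L} (\<lambda>x. F (x + L))"
    using integral_shift_real_ivl[of L L "2 * L" F] by simp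
  finally show ?thesis
    using Henstock_Kurzweil_Integration.integral_add[OF int int2] by simp
qed

text \<open>On the frequency m the difference with the quarter shift acts as multiplication by
  \<open>1 - i^m\<close>, of squared modulus 2 for odd m, 4 for m = 2 mod 4 and 0 otherwise. This is
  at most \<open>2 m^2\<close>, with equality at m = 1, which the sharp sphere inequality needs.
  Instead of Fourier series, \<open>h\<close> is split by its parity under shifts by
  \<open>pi\<close> and \<open>pi / 2\<close>, and Wirtinger's inequality is applied to the
  antiperiodic pieces.\<close>

lemma wirtinger_quarter_shift:
  fixes h h' :: "real \<Rightarrow> real"
  assumes per: "\<And>x. h (x + 2 * pi) = h x"
    and dh: "\<And>x. (h has_real_derivative h' x) (at x)" and ch': "continuous_on UNIV h'"
  shows "integral {0..2 * pi} (\<lambda>x. (h x - h (x + pi / 2))\<^sup>2) \<le> 2 * integral {0..2 * pi} (\<lambda>x. (h' x)\<^sup>2)"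
proof -
  have ch: "continuous_on UNIV h"
    using dh by (meson DERIV_isCont continuous_at_imp_continuous_on)
  have cs: "continuous_on S (\<lambda>x. f (g x))" if "continuous_on UNIV f" "continuous_on S g" for f g :: "real \<Rightarrow> real" and S
    using continuous_on_compose2[OF that] by auto
  have dsh: "((\<lambda>x. h (x + c)) has_real_derivative h' (x + c)) (at x)" for x c
    using dh[of "x + c"] by (simp add: DERIV_shift)
  have per': "h' (x + 2 * pi) = h' x" for x
    using dsh[of "2 * pi" x] dh[of x] DERIV_unique by (auto simp: per)
  \<comment> \<open>\<open>o1\<close> and \<open>e1\<close> carry the odd and the even frequencies;
    \<open>k\<close> is the part of the difference due to the even ones and retains only the
    frequencies 2 mod 4.\<close>
  define o1 where "o1 x = (h x - h (x + pi)) / 2" for x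
  define e1 where "e1 x = (h x + h (x + pi)) / 2" for x
  define o2 where "o2 x = (h' x - h' (x + pi)) / 2" for x
  define e2 where "e2 x = (h' x + h' (x + pi)) / 2" for x
  define k where "k x = e1 x - e1 (x + pi / 2)" for x
  define k' where "k' x = e2 x - e2 (x + pi / 2)" for x
  have co: "continuous_on UNIV o1" "continuous_on UNIV e1" "continuous_on UNIV o2" "continuous_on UNIV e2"
    unfolding o1_def e1_def o2_def e2_def by (intro continuous_intros ch ch' cs[OF ch] cs[OF ch']; simp)+
  have ck: "continuous_on UNIV k" "continuous_on UNIV k'"
    unfolding k_def k'_def by (intro continuous_intros co cs[OF co(2)] cs[OF co(4)])+
  have pp: "h (x + pi + pi) = h x" "h' (x + pi + pi) = h' x" for x
    using per[of x] per'[of x] by (simp_all add: algebra_simps)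
  have o_anti: "o1 (x + pi) = - o1 x" and e_per: "e1 (x + pi) = e1 x" "e2 (x + pi) = e2 x" for x
    using pp[of x] by (simp_all add: o1_def e1_def e2_def field_simps)
  have k_anti: "k (x + pi / 2) = - k x" "k' (x + pi / 2) = - k' x" for x
    using e_per[of x] by (simp_all add: k_def k'_def algebra_simps)
  have I: "f integrable_on {a..b}" if "continuous_on UNIV f" for f :: "real \<Rightarrow> real" and a b
    by (rule integrable_continuous_real) (use that continuous_on_subset in blast)
  have do1: "(o1 has_real_derivative o2 x) (at x)" for x
    unfolding o1_def o2_def by (auto intro!: derivative_eq_intros dh dsh)
  have de: "(e1 has_real_derivative e2 x) (at x)" for x
    unfolding e1_def e2_def by (auto intro!: derivative_eq_intros dh dsh)
  have "((\<lambda>x. e1 (x + pi / 2)) has_real_derivative e2 (x + pi / 2)) (at x)" for x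
    using de[of "x + pi / 2"] by (simp add: DERIV_shift)
  then have dk: "(k has_real_derivative k' x) (at x)" for x
    unfolding k_def k'_def by (auto intro!: derivative_eq_intros de)
  have w1: "integral {0..pi} (\<lambda>x. (o1 x)\<^sup>2) \<le> integral {0..pi} (\<lambda>x. (o2 x)\<^sup>2)"
    using wirtinger_antiperiodic[of pi o1 o2] o_anti do1 co by simp
  have w2: "integral {0..pi/2} (\<lambda>x. (k x)\<^sup>2) \<le> (1 / 4) * integral {0..pi/2} (\<lambda>x. (k' x)\<^sup>2)"
    using wirtinger_antiperiodic[of "pi/2" k k'] k_anti dk ck by (simp add: power_divide)
  have kk: "integral {0..pi} (\<lambda>x. (k x)\<^sup>2) = 2 * integral {0..pi/2} (\<lambda>x. (k x)\<^sup>2)"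
      "integral {0..pi} (\<lambda>x. (k' x)\<^sup>2) = 2 * integral {0..pi/2} (\<lambda>x. (k' x)\<^sup>2)"
    using integral_double_interval[of "\<lambda>x. (k x)\<^sup>2" "pi/2"] integral_double_interval[of "\<lambda>x. (k' x)\<^sup>2" "pi/2"]
    by (auto simp: k_anti intro!: continuous_intros ck)
  have "integral {0..pi} (\<lambda>x. (k' x)\<^sup>2) \<le> integral {0..pi} (\<lambda>x. 2 * (e2 x)\<^sup>2 + 2 * (e2 (x + pi/2))\<^sup>2)"
  proof (rule integral_le)
    show "(k' x)\<^sup>2 \<le> 2 * (e2 x)\<^sup>2 + 2 * (e2 (x + pi/2))\<^sup>2" for x
      using zero_le_power2[of "e2 x + e2 (x + pi/2)"] by (simp add: k'_def power2_eq_square algebra_simps)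
  qed (intro I continuous_intros ck co cs[OF co(4)])+
  also have "\<dots> = 2 * integral {0..pi} (\<lambda>x. (e2 x)\<^sup>2) + 2 * integral {0..pi} (\<lambda>x. (e2 (x + pi/2))\<^sup>2)"
    by (subst Henstock_Kurzweil_Integration.integral_add) (auto intro!: I continuous_intros co cs[OF co(4)])
  also have "integral {0..pi} (\<lambda>x. (e2 (x + pi/2))\<^sup>2) = integral {pi/2..pi/2 + pi} (\<lambda>x. (e2 x)\<^sup>2)"
    using integral_shift_real_ivl[of "pi/2" "pi/2" "pi/2 + pi" "\<lambda>x. (e2 x)\<^sup>2"] by simp
  also have "\<dots> = integral {0..pi} (\<lambda>x. (e2 x)\<^sup>2)"
    by (rule integral_periodic_shift) (auto intro!: continuous_intros co simp: e_per)
  finally have w3: "integral {0..pi} (\<lambda>x. (k' x)\<^sup>2) \<le> 4 * integral {0..pi} (\<lambda>x. (e2 x)\<^sup>2)" by simp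
  have w4: "integral {0..pi} (\<lambda>x. (k x)\<^sup>2) \<le> integral {0..pi} (\<lambda>x. (e2 x)\<^sup>2)"
    using w2 w3 kk by simp
  define D where "D x = o1 x - o1 (x + pi/2)" for x
  have cD: "continuous_on UNIV D" unfolding D_def by (intro continuous_intros co cs[OF co(1)])
  have D1: "D (x + pi) = - D x" "D (x + pi/2) = o1 (x + pi/2) + o1 x" for x
    using o_anti[of x] o_anti[of "x + pi/2"] by (simp_all add: D_def add_ac)
  \<comment> \<open>The cross terms at \<open>x\<close> and \<open>x + pi / 2\<close> cancel, as in
    the parallelogram law, so the factor 2 on odd frequencies is an equality; a mere estimate would
    lose the sharp constant.\<close>
  have "integral {0..pi} (\<lambda>x. (D x)\<^sup>2) = integral {0..pi/2} (\<lambda>x. (D x)\<^sup>2 + (D (x + pi/2))\<^sup>2)"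
    using integral_double_interval[of "\<lambda>x. (D x)\<^sup>2" "pi/2"] by (auto intro!: continuous_intros cD)
  also have "\<dots> = integral {0..pi/2} (\<lambda>x. 2 * ((o1 x)\<^sup>2 + (o1 (x + pi/2))\<^sup>2))"
    by (rule integral_cong) (simp only: D1(2), simp add: D_def power2_eq_square algebra_simps)
  also have "\<dots> = 2 * integral {0..pi/2} (\<lambda>x. (o1 x)\<^sup>2 + (o1 (x + pi/2))\<^sup>2)"
    by (rule integral_mult_right)
  also have "integral {0..pi/2} (\<lambda>x. (o1 x)\<^sup>2 + (o1 (x + pi/2))\<^sup>2) = integral {0..pi} (\<lambda>x. (o1 x)\<^sup>2)"
    by (subst integral_double_interval[of "\<lambda>x. (o1 x)\<^sup>2" "pi/2", simplified, symmetric])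
       (auto intro!: continuous_intros co)
  finally have D2: "integral {0..pi} (\<lambda>x. (D x)\<^sup>2) = 2 * integral {0..pi} (\<lambda>x. (o1 x)\<^sup>2)" .
  have hDk: "h x - h (x + pi/2) = D x + k x" for x
    by (simp add: D_def k_def o1_def e1_def field_simps)
  have kpi: "k (x + pi) = k x" for x using k_anti(1)[of x] k_anti(1)[of "x + pi/2"] by (simp add: add.commute)
  have "integral {0..2 * pi} (\<lambda>x. (h x - h (x + pi / 2))\<^sup>2) = integral {0..2 * pi} (\<lambda>x. (D x + k x)\<^sup>2)"
    by (simp add: hDk)
  also have "\<dots> = integral {0..pi} (\<lambda>x. (D x + k x)\<^sup>2 + (D (x + pi) + k (x + pi))\<^sup>2)"
    by (rule integral_double_interval) (auto intro!: continuous_intros cD ck)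
  also have "\<dots> = integral {0..pi} (\<lambda>x. 2 * (D x)\<^sup>2 + 2 * (k x)\<^sup>2)"
    by (rule integral_cong) (simp add: D1 kpi power2_eq_square algebra_simps)
  also have "\<dots> = 2 * integral {0..pi} (\<lambda>x. (D x)\<^sup>2) + 2 * integral {0..pi} (\<lambda>x. (k x)\<^sup>2)"
    by (subst Henstock_Kurzweil_Integration.integral_add) (auto intro!: I continuous_intros cD ck)
  finally have L: "integral {0..2 * pi} (\<lambda>x. (h x - h (x + pi / 2))\<^sup>2) =
      4 * integral {0..pi} (\<lambda>x. (o1 x)\<^sup>2) + 2 * integral {0..pi} (\<lambda>x. (k x)\<^sup>2)" using D2 by simp
  have "integral {0..2 * pi} (\<lambda>x. (h' x)\<^sup>2) = integral {0..pi} (\<lambda>x. (h' x)\<^sup>2 + (h' (x + pi))\<^sup>2)"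
    by (rule integral_double_interval) (auto intro!: continuous_intros ch')
  also have "\<dots> = integral {0..pi} (\<lambda>x. 2 * (o2 x)\<^sup>2 + 2 * (e2 x)\<^sup>2)"
    by (rule integral_cong) (simp add: o2_def e2_def power2_eq_square field_simps)
  also have "\<dots> = 2 * integral {0..pi} (\<lambda>x. (o2 x)\<^sup>2) + 2 * integral {0..pi} (\<lambda>x. (e2 x)\<^sup>2)"
    by (subst Henstock_Kurzweil_Integration.integral_add) (auto intro!: I continuous_intros co)
  finally have R: "integral {0..2 * pi} (\<lambda>x. (h' x)\<^sup>2) =
      2 * integral {0..pi} (\<lambda>x. (o2 x)\<^sup>2) + 2 * integral {0..pi} (\<lambda>x. (e2 x)\<^sup>2)" .
  have "0 \<le> integral {0..pi} (\<lambda>x. (e2 x)\<^sup>2)"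
    by (rule Henstock_Kurzweil_Integration.integral_nonneg) (auto intro!: I continuous_intros co)
  then show ?thesis using L R w1 w4 by simp
qed

text \<open>The first component traces the ellipse \<open>cos \<theta> x + sin \<theta> y\<close>.
  The second is at once the velocity of that curve and its position a quarter turn later, which is
  why the quarter shift inequality fits.\<close>

definition rot_pair :: "real \<Rightarrow> 'a::real_vector \<times> 'a \<Rightarrow> 'a \<times> 'a" where
  "rot_pair \<theta> z = (cos \<theta> *\<^sub>R fst z + sin \<theta> *\<^sub>R snd z, cos \<theta> *\<^sub>R snd z - sin \<theta> *\<^sub>R fst z)"

lemma orthogonal_rot_pair: "orthogonal_transformation (rot_pair \<theta> :: 'a::euclidean_space \<times> 'a \<Rightarrow> _)"
proof -
  have "linear (rot_pair \<theta> :: 'a \<times> 'a \<Rightarrow> _)"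
    by (rule linearI) (simp_all add: rot_pair_def algebra_simps)
  moreover have "rot_pair \<theta> v \<bullet> rot_pair \<theta> w = v \<bullet> w" for v w :: "'a \<times> 'a"
  proof -
    define c s where "c = cos \<theta>" and "s = sin \<theta>"
    have "rot_pair \<theta> v \<bullet> rot_pair \<theta> w = (c\<^sup>2 + s\<^sup>2) * (fst v \<bullet> fst w + snd v \<bullet> snd w)"
      unfolding rot_pair_def c_def[symmetric] s_def[symmetric]
      by (simp add: inner_prod_def inner_add_left inner_add_right inner_diff_left inner_diff_right
          power2_eq_square algebra_simps)
    then show ?thesis by (simp add: inner_prod_def c_def s_def)
  qed
  ultimately show ?thesis by (simp add: orthogonal_transformation_def)
qed

lemma rot_pair_in_ball: "rot_pair \<theta> z \<in> ball 0 1 \<longleftrightarrow> (z::'a::euclidean_space \<times> 'a) \<in> ball 0 1"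
  using orthogonal_transformation_norm[OF orthogonal_rot_pair[of \<theta>, where 'a = 'a]] by simp

lemma continuous_rot_pair: "continuous_on UNIV (\<lambda>p::real \<times> ('a::euclidean_space \<times> 'a). rot_pair (fst p) (snd p))"
  unfolding rot_pair_def by (intro continuous_intros)

text \<open>Orthogonal invariance turns an inequality along almost every orbit of
  \<open>rot_pair\<close> into one between integrals over the ball of pairs.\<close>

lemma integral_rot_average:
  fixes K :: "'a::euclidean_space \<times> 'a \<Rightarrow> real"
  assumes K[measurable]: "K \<in> borel_measurable borel" and b: "\<And>z. z \<in> ball 0 1 \<Longrightarrow> \<bar>K z\<bar> \<le> C"
  shows "integrable lborel (\<lambda>z. indicator (ball 0 1) z * (\<integral>\<theta>. indicator {0..2*pi} \<theta> * K (rot_pair \<theta> z) \<partial>lborel))"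
    and "(\<integral>z. indicator (ball 0 1) z * (\<integral>\<theta>. indicator {0..2*pi} \<theta> * K (rot_pair \<theta> z) \<partial>lborel) \<partial>lborel)
       = 2 * pi * (\<integral>z. indicator (ball 0 1) z * K z \<partial>lborel)"
proof -
  have rm[measurable]: "(\<lambda>p::real \<times> ('a \<times> 'a). rot_pair (fst p) (snd p)) \<in> borel \<rightarrow>\<^sub>M borel"
    by (rule borel_measurable_continuous_onI[OF continuous_rot_pair])
  have C0: "0 \<le> C" using b[of 0] by simp
  define f where "f = (\<lambda>(\<theta>::real) (z::'a \<times> 'a). indicator {0..2*pi} \<theta> * (indicator (ball 0 1) z * K (rot_pair \<theta> z)))"
  have S: "({0..2*pi} \<times> ball 0 1 :: (real \<times> ('a \<times> 'a)) set) \<in> sets (lborel \<Otimes>\<^sub>M lborel)"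
    by (intro pair_measureI) auto
  have int: "integrable (lborel \<Otimes>\<^sub>M lborel) (case_prod f)"
  proof (rule Bochner_Integration.integrable_bound[where f = "\<lambda>p. indicator ({0..2*pi} \<times> ball 0 1) p * C"])
    have "emeasure (lborel \<Otimes>\<^sub>M lborel) ({0..2*pi} \<times> ball 0 1 :: (real \<times> ('a \<times> 'a)) set) < \<infinity>"
      by (subst lborel.emeasure_pair_measure_Times) (auto simp: emeasure_ball ennreal_mult_less_top)
    then show "integrable (lborel \<Otimes>\<^sub>M lborel) (\<lambda>p. indicator ({0..2*pi} \<times> ball 0 1 :: (real \<times> ('a \<times> 'a)) set) p * C)"
      by (intro integrable_mult_left integrable_real_indicator S)
    have "(\<lambda>p::real \<times> ('a \<times> 'a). indicator {0..2*pi} (fst p) * (indicator (ball 0 1) (snd p) * K (rot_pair (fst p) (snd p))))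
       \<in> borel_measurable borel"
    proof (intro borel_measurable_times)
      show "(\<lambda>p::real \<times> ('a \<times> 'a). indicator {0..2*pi} (fst p) :: real) \<in> borel_measurable borel"
        by (rule measurable_compose[OF borel_measurable_continuous_onI[OF continuous_on_fst[OF continuous_on_id]]]) simp
      show "(\<lambda>p::real \<times> ('a \<times> 'a). indicator (ball 0 1) (snd p) :: real) \<in> borel_measurable borel"
        by (rule measurable_compose[OF borel_measurable_continuous_onI[OF continuous_on_snd[OF continuous_on_id]]]) simp
      show "(\<lambda>p::real \<times> ('a \<times> 'a). K (rot_pair (fst p) (snd p))) \<in> borel_measurable borel"
        by (rule measurable_compose[OF rm K])
    qed
    then show "case_prod f \<in> borel_measurable (lborel \<Otimes>\<^sub>M lborel)"
      by (simp add: f_def lborel_prod split_beta')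
    show "AE p in lborel \<Otimes>\<^sub>M lborel. norm (case_prod f p) \<le> norm (indicator ({0..2*pi} \<times> ball 0 1 :: (real \<times> ('a \<times> 'a)) set) p * C)"
      using b[OF iffD2[OF rot_pair_in_ball]] C0
      by (intro AE_I2) (auto simp: f_def indicator_def simp del: mem_ball_0)
  qed
  have f1: "f \<theta> z = indicator (ball 0 1) z * (indicator {0..2*pi} \<theta> * K (rot_pair \<theta> z))" for \<theta> z
    by (simp add: f_def)
  have e1: "(\<lambda>z. indicator (ball 0 1) z * (\<integral>\<theta>. indicator {0..2*pi} \<theta> * K (rot_pair \<theta> z) \<partial>lborel)) =
      (\<lambda>z. \<integral>\<theta>. f \<theta> z \<partial>lborel)" by (simp add: f1)
  show "integrable lborel (\<lambda>z. indicator (ball 0 1) z * (\<integral>\<theta>. indicator {0..2*pi} \<theta> * K (rot_pair \<theta> z) \<partial>lborel))"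
    unfolding e1 by (rule lborel_pair.integrable_snd[OF int])
  have inner: "(\<integral>z. f \<theta> z \<partial>lborel) = indicator {0..2*pi} \<theta> * (\<integral>z. indicator (ball 0 1) z * K z \<partial>lborel)" for \<theta>
  proof -
    have "(\<integral>z. indicator (ball 0 1) z * K (rot_pair \<theta> z) \<partial>lborel) =
        (\<integral>z. indicator (ball 0 1) (rot_pair \<theta> z) * K (rot_pair \<theta> z) \<partial>lborel)"
      by (simp only: indicator_def rot_pair_in_ball)
    also have "\<dots> = (\<integral>z. indicator (ball 0 1) z * K z \<partial>lborel)"
      by (rule integral_lborel_orthogonal[OF orthogonal_rot_pair, where h = "\<lambda>z. indicator (ball 0 1) z * K z"]) measurable
    finally show ?thesis by (simp add: f_def)
  qed
  show "(\<integral>z. indicator (ball 0 1) z * (\<integral>\<theta>. indicator {0..2*pi} \<theta> * K (rot_pair \<theta> z) \<partial>lborel) \<partial>lborel)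
       = 2 * pi * (\<integral>z. indicator (ball 0 1) z * K z \<partial>lborel)"
    unfolding e1 lborel_pair.Fubini_integral[OF int] inner by simp
qed

lemma integral_lborel_pair:
  fixes f :: "'a::euclidean_space \<times> 'b::euclidean_space \<Rightarrow> real"
  assumes "integrable lborel f"
  shows "(\<integral>z. f z \<partial>lborel) = (\<integral>x. (\<integral>y. f (x, y) \<partial>lborel) \<partial>lborel)"
  using lborel_pair.integral_fst'[of f] assms by (simp add: lborel_prod)

lemma Pair_in_ball_iff: "(x, y) \<in> ball 0 1 \<longleftrightarrow> (norm x)\<^sup>2 + (norm y)\<^sup>2 < 1"
  for x :: "'a::euclidean_space" and y :: "'b::euclidean_space"
  by (simp add: norm_Pair real_sqrt_lt_1_iff)

text \<open>By orthogonal invariance the integral depends on \<open>a\<close> only through its norm,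
  and summing over an orthonormal basis restores the squared norm of \<open>y\<close>; hence the
  factor 1/n. The domain is given by a bound on the squared norm since it will be a slice of the
  ball of pairs, with bound \<open>1 - (norm x)^2\<close>, possibly negative and the slice then
  empty.\<close>

lemma integral_ball_inner_sq:
  fixes a :: "real^'n"
  shows "(\<integral>y. indicator {y. (norm y)\<^sup>2 < r} y * (a \<bullet> y)\<^sup>2 \<partial>lborel) =
    (norm a)\<^sup>2 / CARD('n) * (\<integral>(y::real^'n). indicator {y. (norm y)\<^sup>2 < r} y * (norm y)\<^sup>2 \<partial>lborel)"
proof -
  define J where "J a = (\<integral>y. indicator {y. (norm y)\<^sup>2 < r} y * (a \<bullet> y)\<^sup>2 \<partial>lborel)" for a :: "real^'n"
  have sc: "J (c *\<^sub>R a) = c\<^sup>2 * J a" for c a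
    by (simp add: J_def power_mult_distrib flip: Bochner_Integration.integral_mult_right_zero)
       (simp add: mult_ac)
  have S: "{y::real^'n. (norm y)\<^sup>2 < r} \<in> sets borel"
    by measurable
  have unit: "J a = J b" if ab: "norm a = 1" "norm b = 1" for a b
  proof -
    obtain f where f: "orthogonal_transformation f" "f a = b"
      by (rule orthogonal_transformation_exists_1[OF ab])
    have "J b = (\<integral>y. indicator {y. (norm y)\<^sup>2 < r} (f y) * (f a \<bullet> f y)\<^sup>2 \<partial>lborel)"
      unfolding J_def f(2)
      by (rule integral_lborel_orthogonal[OF f(1), symmetric]) (use S in measurable)
    also have "\<dots> = J a"
      using f(1) by (simp add: J_def orthogonal_transformation_def orthogonal_transformation_norm[OF f(1)] indicator_def)
    finally show ?thesis by simp
  qed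
  have intb: "integrable lborel (\<lambda>y. indicator {y. (norm y)\<^sup>2 < r} y * (a \<bullet> y)\<^sup>2)" for a :: "real^'n"
  proof (rule Bochner_Integration.integrable_bound)
    have b: "{y::real^'n. (norm y)\<^sup>2 < r} \<subseteq> ball 0 (r + 1)"
    proof
      fix y :: "real^'n" assume y: "y \<in> {y. (norm y)\<^sup>2 < r}"
      have "norm y < r + 1"
        using y zero_le_power2[of "norm y - 1/2"] by (simp add: power2_diff power_divide)
      then show "y \<in> ball 0 (r + 1)" by simp
    qed
    have "emeasure lborel {y::real^'n. (norm y)\<^sup>2 < r} < \<infinity>"
      by (rule emeasure_bounded_finite) (rule bounded_subset[OF bounded_ball b])
    then show "integrable lborel (\<lambda>y::real^'n. indicator {y. (norm y)\<^sup>2 < r} y * ((norm a)\<^sup>2 * r))"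
      using S by (intro integrable_mult_left integrable_real_indicator) auto
    show "AE y in lborel. norm (indicator {y. (norm y)\<^sup>2 < r} y * (a \<bullet> y)\<^sup>2) \<le>
        norm (indicator {y. (norm y)\<^sup>2 < r} y * ((norm a)\<^sup>2 * r))"
    proof (rule AE_I2)
      fix y
      have "(a \<bullet> y)\<^sup>2 \<le> (norm a)\<^sup>2 * (norm y)\<^sup>2"
        using Cauchy_Schwarz_ineq2[of a y] by (metis abs_ge_zero power2_abs power_mono power_mult_distrib)
      moreover have "(norm a)\<^sup>2 * (norm y)\<^sup>2 \<le> (norm a)\<^sup>2 * r" if "(norm y)\<^sup>2 < r"
        using that by (intro mult_left_mono) auto
      ultimately show "norm (indicator {y. (norm y)\<^sup>2 < r} y * (a \<bullet> y)\<^sup>2) \<le>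
        norm (indicator {y. (norm y)\<^sup>2 < r} y * ((norm a)\<^sup>2 * r))"
        by (auto simp: indicator_def)
    qed
    show "(\<lambda>y. indicator {y. (norm y)\<^sup>2 < r} y * (a \<bullet> y)\<^sup>2) \<in> borel_measurable lborel"
      using S by measurable
  qed
  have sum: "(\<integral>(y::real^'n). indicator {y. (norm y)\<^sup>2 < r} y * (norm y)\<^sup>2 \<partial>lborel) = (\<Sum>b\<in>Basis. J b)"
  proof -
    have n2: "(norm y)\<^sup>2 = (\<Sum>b\<in>Basis. (b \<bullet> y)\<^sup>2)" for y :: "real^'n"
      unfolding power2_norm_eq_inner euclidean_inner[of y y] by (simp add: power2_eq_square inner_commute)
    have "(\<Sum>b\<in>Basis. J b) = (\<integral>(y::real^'n). (\<Sum>b\<in>Basis. indicator {y. (norm y)\<^sup>2 < r} y * (b \<bullet> y)\<^sup>2) \<partial>lborel)"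
      unfolding J_def by (rule Bochner_Integration.integral_sum[symmetric]) (rule intb)
    also have "\<dots> = (\<integral>(y::real^'n). indicator {y. (norm y)\<^sup>2 < r} y * (norm y)\<^sup>2 \<partial>lborel)"
      by (rule Bochner_Integration.integral_cong[OF refl]) (subst (2) n2, simp only: sum_distrib_left)
    finally show ?thesis by simp
  qed
  obtain e :: "real^'n" where e: "norm e = 1" using vector_choose_size[of 1] by auto
  have "(\<Sum>b\<in>(Basis::(real^'n) set). J b) = CARD('n) * J e"
    using unit[OF _ e] by (simp add: norm_Basis)
  moreover have "J a = (norm a)\<^sup>2 * J e"
  proof (cases "a = 0")
    case False
    then have "J (sgn a) = J e" by (intro unit e) (simp add: norm_sgn)
    moreover have "a = norm a *\<^sub>R sgn a" using False by (simp add: sgn_div_norm)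
    ultimately show ?thesis using sc[of "norm a" "sgn a"] by simp
  qed (simp add: J_def)
  ultimately show ?thesis using sum by (simp add: J_def field_simps)
qed

text \<open>The slice of the ball over \<open>x\<close> depends on \<open>x\<close> only through its
  norm, so integrating out the second component leaves a radial factor, and
  \<open>integral_polar\<close> applies to the first.\<close>

lemma integral_polar_pair:
  fixes k :: "'a::euclidean_space \<Rightarrow> real" and c :: "real \<Rightarrow> real \<Rightarrow> real"
  assumes k[measurable]: "k \<in> borel_measurable borel" and kb: "\<And>x. norm x \<le> 1 \<Longrightarrow> \<bar>k x\<bar> \<le> C"
    and c[measurable]: "case_prod c \<in> borel_measurable borel"
    and cb: "\<And>r s. 0 \<le> r \<Longrightarrow> r < 1 \<Longrightarrow> 0 \<le> s \<Longrightarrow> s < 1 \<Longrightarrow> 0 \<le> c r s \<and> c r s \<le> K"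
  shows "measure lborel (ball 0 1 :: 'a set) *
     (\<integral>(z::'a \<times> 'a). indicator (ball 0 1) z * (k (fst z /\<^sub>R norm (fst z)) * c (norm (fst z)) (norm (snd z))) \<partial>lborel)
   = (\<integral>x. indicator (ball 0 1) x * k (x /\<^sub>R norm x) \<partial>lborel) *
     (\<integral>(z::'a \<times> 'a). indicator (ball 0 1) z * c (norm (fst z)) (norm (snd z)) \<partial>lborel)"
proof -
  define f where "f r = (\<integral>(y::'a). indicator {p. (fst p)\<^sup>2 + (snd p)\<^sup>2 < 1} (r, norm y) * c r (norm y) \<partial>lborel)" for r
  have ng: "norm (x /\<^sub>R norm x) \<le> 1" for x :: 'a by (cases "x = 0") auto
  have K0: "0 \<le> K" using cb[of 0 0] by simp
  have S[measurable]: "{p::real \<times> real. (fst p)\<^sup>2 + (snd p)\<^sup>2 < 1} \<in> sets borel"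
    by (intro borel_open open_Collect_less continuous_intros)
  have cm: "(\<lambda>z::real \<times> 'a. c (fst z) (norm (snd z))) \<in> borel_measurable borel"
    using measurable_compose[OF borel_measurable_continuous_onI c, of "\<lambda>z::real \<times> 'a. (fst z, norm (snd z))"]
    by (simp add: continuous_intros)
  have cm2: "(\<lambda>z::'a \<times> 'a. c (norm (fst z)) (norm (snd z))) \<in> borel_measurable borel"
    using measurable_compose[OF borel_measurable_continuous_onI c, of "\<lambda>z::'a \<times> 'a. (norm (fst z), norm (snd z))"]
    by (simp add: continuous_intros)
  have fm: "f \<in> borel_measurable borel"
  proof -
    have "(\<lambda>z::real \<times> 'a. indicator {p. (fst p)\<^sup>2 + (snd p)\<^sup>2 < 1} (fst z, norm (snd z)) * c (fst z) (norm (snd z)))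
      \<in> borel_measurable borel"
      by (intro borel_measurable_times cm
            measurable_compose[OF borel_measurable_continuous_onI borel_measurable_indicator[OF S]] continuous_intros)
    then show ?thesis unfolding f_def[abs_def]
      by (intro lborel.borel_measurable_lebesgue_integral)
         (simp add: split_beta' measurable_cong_sets[OF sets_pair_measure_cong[OF refl sets_lborel]] borel_prod)
  qed
  have lt1: "norm x < 1" "norm y < 1" if "(norm x)\<^sup>2 + (norm y)\<^sup>2 < 1" for x y :: 'a
    using that zero_le_power2[of "norm x"] zero_le_power2[of "norm y"]
    by (smt (verit) norm_ge_zero power2_less_imp_less one_power2)+
  have fb: "0 \<le> f r \<and> f r \<le> K * measure lborel (ball 0 1 :: 'a set)" if r: "0 \<le> r" "r < 1" for r
  proof -
    have ys: "norm y < 1" if "r\<^sup>2 + (norm y)\<^sup>2 < 1" for y :: 'a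
      using that zero_le_power2[of r] by (smt (verit) norm_ge_zero power2_less_imp_less one_power2)
    have "0 \<le> f r" unfolding f_def
      by (rule Bochner_Integration.integral_nonneg) (use cb r ys in \<open>auto simp: indicator_def\<close>)
    moreover have "f r \<le> (\<integral>(y::'a). indicator (ball 0 1) y * K \<partial>lborel)" unfolding f_def
    proof (rule integral_mono')
      show "integrable lborel (\<lambda>y::'a. indicator (ball 0 1) y * K)"
        by (intro integrable_mult_left integrable_real_indicator) (auto simp: emeasure_ball)
    qed (use cb r ys K0 in \<open>auto simp: indicator_def\<close>)
    ultimately show ?thesis by (simp add: mult_ac)
  qed
  have split: "(\<integral>(z::'a \<times> 'a). indicator (ball 0 1) z * (h (fst z /\<^sub>R norm (fst z)) * c (norm (fst z)) (norm (snd z))) \<partial>lborel)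
      = (\<integral>x. indicator (ball 0 1) x * (h (x /\<^sub>R norm x) * f (norm x)) \<partial>lborel)"
    if hm: "h \<in> borel_measurable borel" and hb: "\<And>x. norm x \<le> 1 \<Longrightarrow> \<bar>h x\<bar> \<le> B" for h :: "'a \<Rightarrow> real" and B
  proof -
    have "(\<lambda>z::'a \<times> 'a. fst z /\<^sub>R norm (fst z)) \<in> borel \<rightarrow>\<^sub>M borel"
      by (intro borel_measurable_scaleR borel_measurable_inverse borel_measurable_norm)
         (auto intro!: borel_measurable_continuous_onI continuous_intros)
    then have m: "(\<lambda>z::'a \<times> 'a. h (fst z /\<^sub>R norm (fst z)) * c (norm (fst z)) (norm (snd z))) \<in> borel_measurable borel"
      using hm cm2 by (intro borel_measurable_times) (auto intro: measurable_compose)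
    have B0: "0 \<le> B" using hb[of 0] by simp
    have "integrable lborel (\<lambda>z::'a \<times> 'a. indicator (ball 0 1) z * (h (fst z /\<^sub>R norm (fst z)) * c (norm (fst z)) (norm (snd z))))"
    proof (rule integrable_on_ball[OF m])
      fix z :: "'a \<times> 'a" assume "z \<in> ball 0 1"
      then have "(norm (fst z))\<^sup>2 + (norm (snd z))\<^sup>2 < 1" using Pair_in_ball_iff[of "fst z" "snd z"] by simp
      then show "\<bar>h (fst z /\<^sub>R norm (fst z)) * c (norm (fst z)) (norm (snd z))\<bar> \<le> B * K"
        unfolding abs_mult using hb[OF ng] cb[of "norm (fst z)" "norm (snd z)"] lt1 B0 by (intro mult_mono) auto
    qed
    from integral_lborel_pair[OF this]
    have "(\<integral>(z::'a \<times> 'a). indicator (ball 0 1) z * (h (fst z /\<^sub>R norm (fst z)) * c (norm (fst z)) (norm (snd z))) \<partial>lborel)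
      = (\<integral>x. (\<integral>(y::'a). indicator (ball 0 1) (x, y) * (h (x /\<^sub>R norm x) * c (norm x) (norm y)) \<partial>lborel) \<partial>lborel)" by simp
    also have "\<dots> = (\<integral>x. indicator (ball 0 1) x * (h (x /\<^sub>R norm x) * f (norm x)) \<partial>lborel)"
    proof (rule Bochner_Integration.integral_cong[OF refl])
      fix x :: 'a
      have "(\<integral>(y::'a). indicator (ball 0 1) (x, y) * (h (x /\<^sub>R norm x) * c (norm x) (norm y)) \<partial>lborel) =
        (\<integral>(y::'a). indicator (ball 0 1) x * h (x /\<^sub>R norm x) *
          (indicator {p. (fst p)\<^sup>2 + (snd p)\<^sup>2 < 1} (norm x, norm y) * c (norm x) (norm y)) \<partial>lborel)"
      proof (rule Bochner_Integration.integral_cong[OF refl])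
        fix y :: 'a
        have "indicator (ball 0 1) (x, y) = (indicator (ball 0 1) x * indicator {p. (fst p)\<^sup>2 + (snd p)\<^sup>2 < 1} (norm x, norm y) :: real)"
          using lt1[of x y] by (simp only: indicator_def Pair_in_ball_iff) auto
        then show "indicator (ball 0 1) (x, y) * (h (x /\<^sub>R norm x) * c (norm x) (norm y)) =
          indicator (ball 0 1) x * h (x /\<^sub>R norm x) *
          (indicator {p. (fst p)\<^sup>2 + (snd p)\<^sup>2 < 1} (norm x, norm y) * c (norm x) (norm y))" by simp
      qed
      then show "(\<integral>(y::'a). indicator (ball 0 1) (x, y) * (h (x /\<^sub>R norm x) * c (norm x) (norm y)) \<partial>lborel) =
        indicator (ball 0 1) x * (h (x /\<^sub>R norm x) * f (norm x))" by (simp add: f_def)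
    qed
    finally show ?thesis .
  qed
  show ?thesis
    using split[OF k kb] split[of "\<lambda>_. 1" 1] integral_polar[OF k fm kb fb] by simp
qed

lemma borel_measurable_sgn_compose:
  fixes h :: "'a::euclidean_space \<Rightarrow> 'b::topological_space"
  assumes "continuous_on (sphere 0 1) h"
  shows "(\<lambda>x. h (x /\<^sub>R norm x)) \<in> borel_measurable borel"
proof (rule borel_measurable_continuous_countable_exceptions[where X = "{0}"])
  show "continuous_on (- {0}) (\<lambda>x. h (x /\<^sub>R norm x))"
    by (rule continuous_on_compose2[OF assms]) (auto intro!: continuous_intros simp: field_simps split: if_splits)
qed simp

lemma sphere_int_lborel:
  fixes h :: "real^'n \<Rightarrow> real"
  assumes h: "continuous_on (sphere 0 1) h"
  shows "integrable lborel (\<lambda>x. indicator (ball 0 1) x * h (x /\<^sub>R norm x))"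
    and "sphere_int h = CARD('n) * (\<integral>x. indicator (ball 0 1) x * h (x /\<^sub>R norm x) \<partial>lborel)"
proof -
  have "bounded (h ` sphere 0 1)"
    by (intro compact_imp_bounded compact_continuous_image h compact_sphere)
  then obtain C where C: "\<And>x. norm x = 1 \<Longrightarrow> \<bar>h x\<bar> \<le> C" unfolding bounded_iff by force
  show "integrable lborel (\<lambda>x. indicator (ball 0 1) x * h (x /\<^sub>R norm x))"
  proof (rule integrable_on_ball)
    show "(\<lambda>x. h (x /\<^sub>R norm x)) \<in> borel_measurable borel" by (rule borel_measurable_sgn_compose[OF h])
    \<comment> \<open>At the origin the normalised vector is 0, which is not on the sphere; hence
      the second term of the bound.\<close>
    show "\<bar>h (x /\<^sub>R norm x)\<bar> \<le> max C \<bar>h 0\<bar>" for x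
      using C[of "x /\<^sub>R norm x"] by (cases "x = 0") auto
  qed
  then have "set_integrable lborel (ball 0 1) (\<lambda>x. h (x /\<^sub>R norm x))"
    by (simp add: set_integrable_def)
  from set_borel_integral_eq_integral(2)[OF this]
  show "sphere_int h = CARD('n) * (\<integral>x. indicator (ball 0 1) x * h (x /\<^sub>R norm x) \<partial>lborel)"
    by (simp add: sphere_int_def set_lebesgue_integral_def)
qed

lemma integral_indicator_Icc:
  fixes f :: "real \<Rightarrow> real"
  assumes "continuous_on {a..b} f"
  shows "(\<integral>x. indicator {a..b} x * f x \<partial>lborel) = integral {a..b} f"
  using set_borel_integral_eq_integral(2)[OF borel_integrable_atLeastAtMost'[OF assms]]
  by (simp add: set_lebesgue_integral_def)

text \<open>For fixed nonzero \<open>x\<close>, equality in Cauchy-Schwarz confines \<open>y\<close>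
  to the line spanned by \<open>x\<close>, a null set in dimension at least 2. Almost every ellipse
  of \<open>rot_pair\<close> therefore avoids the origin, where the degree one extension used below
  need not be differentiable.\<close>

lemma AE_independent_pair:
  assumes "2 \<le> CARD('n)"
  shows "AE z in lborel. \<bar>fst z \<bullet> snd z\<bar> < norm (fst z) * norm (snd (z :: (real^'n) \<times> (real^'n)))"
proof -
  let ?P = "\<lambda>z :: (real^'n) \<times> (real^'n). \<bar>fst z \<bullet> snd z\<bar> < norm (fst z) * norm (snd z)"
  have "AE z in lborel \<Otimes>\<^sub>M lborel. ?P z"
  proof (rule lborel_pair.AE_pair_measure)
    have "open {z. ?P z}" by (intro open_Collect_less continuous_intros)
    then show "{z \<in> space (lborel \<Otimes>\<^sub>M lborel). ?P z} \<in> sets (lborel \<Otimes>\<^sub>M lborel)"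
      unfolding lborel_prod by simp
    show "AE x in lborel. AE y in lborel. ?P (x, y)"
      using AE_norm_neq[of 0]
    proof eventually_elim
      case (elim x)
      have "dim (span {x}) \<le> 1" using dim_le_card[of "span {x}" "{x}"] by auto
      then have "negligible (span {x})" using assms by (intro negligible_lowdim) simp
      then have "span {x} \<in> null_sets lborel"
        by (simp add: negligible_iff_null_sets null_sets_def closed_span borel_closed)
      from AE_not_in[OF this] show ?case
      proof eventually_elim
        case (elim y)
        show ?case
        proof (rule ccontr)
          assume "\<not> ?P (x, y)"
          then have "\<bar>x \<bullet> y\<bar> = norm x * norm y" using Cauchy_Schwarz_ineq2[of x y] by simp
          then have "norm x *\<^sub>R y = norm y *\<^sub>R x \<or> norm x *\<^sub>R y = - norm y *\<^sub>R x"
            by (simp add: norm_cauchy_schwarz_abs_eq)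
          then have "y = (norm y / norm x) *\<^sub>R x \<or> y = (- norm y / norm x) *\<^sub>R x"
            using \<open>norm x \<noteq> 0\<close>
            by (metis (no_types, opaque_lifting) divide_inverse_commute scaleR_left_imp_eq scaleR_scaleR
                nonzero_mult_div_cancel_left times_divide_eq_right)
          then have "y \<in> span {x}" by (metis span_base span_scale singletonI)
          with elim show False by simp
        qed
      qed
    qed
  qed
  then show ?thesis unfolding lborel_prod .
qed

lemma has_derivative_normalize:
  fixes x :: "'a::euclidean_space"
  assumes x: "x \<noteq> 0"
  shows "((\<lambda>x. x /\<^sub>R norm x) has_derivative
    (\<lambda>h. h /\<^sub>R norm x - (((x /\<^sub>R norm x) \<bullet> h) / norm x) *\<^sub>R (x /\<^sub>R norm x))) (at x)"
proof -
  have dn: "(norm has_derivative (\<lambda>h. (x /\<^sub>R norm x) \<bullet> h)) (at x)"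
    using has_derivative_norm[OF x] by (simp add: sgn_div_norm inner_commute)
  have "((\<lambda>x. inverse (norm x)) has_derivative (\<lambda>h. - (inverse (norm x) * ((x /\<^sub>R norm x) \<bullet> h) * inverse (norm x)))) (at x)"
    by (rule Deriv.has_derivative_inverse[OF _ dn]) (use x in simp)
  from has_derivative_scaleR[OF this has_derivative_ident]
  show ?thesis
    by (rule has_derivative_eq_rhs) (simp add: fun_eq_iff divide_inverse mult_ac)
qed

text \<open>Apply the one-dimensional inequality to the restrictions of \<open>F(x) = |x| G(x/|x|)\<close> to the
  circles \<open>x cos \<theta> + y sin \<theta>\<close>, with \<open>(x, y)\<close> uniformly distributed in the unit ball of
  \<open>\<real>\<^sup>n \<times> \<real>\<^sup>n\<close>. Linear functions are extremal, which makes the constant \<open>n - 1\<close> sharp.\<close>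

lemma sphere_poincare:
  fixes G :: "real^'n \<Rightarrow> real" and g :: "real^'n \<Rightarrow> real^'n"
  assumes card: "2 \<le> CARD('n)"
    and dG: "\<And>x. (G has_derivative (\<lambda>h. g x \<bullet> h)) (at x)"
    and cg: "continuous_on UNIV g"
    and mean: "sphere_int G = 0"
  shows "(real CARD('n) - 1) * sphere_int (\<lambda>x. (G x)\<^sup>2) \<le> sphere_int (\<lambda>x. (norm (g x))\<^sup>2 - (g x \<bullet> x)\<^sup>2)"
proof -
  have cG: "continuous_on UNIV G"
    by (meson dG has_derivative_continuous continuous_at_imp_continuous_on)
  note cS = continuous_on_subset[OF cG subset_UNIV] continuous_on_subset[OF cg subset_UNIV]
  define s where "s x = x /\<^sub>R norm x" for x :: "real^'n"
  have s_le: "norm (s x) \<le> 1" for x by (cases "x = 0") (auto simp: s_def)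
  have [measurable]: "s \<in> borel \<rightarrow>\<^sub>M borel" unfolding s_def[abs_def] by measurable
  \<comment> \<open>On the unit sphere \<open>T\<close> is the gradient of the degree one extension
    \<open>F\<close> below: \<open>G\<close> is its radial part and the tangential part of
    \<open>g\<close> the rest. Off the origin the gradient is \<open>T\<close> of the
    direction.\<close>
  define T where "T \<theta> = G \<theta> *\<^sub>R \<theta> + (g \<theta> - (g \<theta> \<bullet> \<theta>) *\<^sub>R \<theta>)" for \<theta>
  have cT: "continuous_on UNIV T" unfolding T_def by (intro continuous_intros cG cg)
  have [measurable]: "G \<in> borel_measurable borel" "T \<in> borel \<rightarrow>\<^sub>M borel"
    by (auto intro: borel_measurable_continuous_onI cG cT)
  define F where "F x = norm x * G (s x)" for x
  have Fm: "F \<in> borel_measurable borel" unfolding F_def[abs_def] by measurable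
  have bounded: "\<exists>C\<ge>0. \<forall>x. norm x \<le> 1 \<longrightarrow> norm (f x) \<le> C" if "continuous_on UNIV f" for f :: "real^'n \<Rightarrow> 'b::real_normed_vector"
  proof -
    have "bounded (f ` cball 0 1)"
      by (intro compact_imp_bounded compact_continuous_image continuous_on_subset[OF that]) auto
    then obtain C where "\<forall>x\<in>cball 0 1. norm (f x) \<le> C" unfolding bounded_iff by auto
    then show ?thesis by (intro exI[of _ "max C 0"]) (auto simp: le_max_iff_disj)
  qed
  obtain C where C: "C \<ge> 0" "\<And>x. norm x \<le> 1 \<Longrightarrow> \<bar>G x\<bar> \<le> C" using bounded[OF cG] by auto
  obtain C' where C': "C' \<ge> 0" "\<And>x. norm x \<le> 1 \<Longrightarrow> norm (T x) \<le> C'" using bounded[OF cT] by auto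
  have Fb: "\<bar>F x\<bar> \<le> C" if "norm x \<le> 1" for x
    unfolding F_def abs_mult using C(2)[OF s_le[of x]] that C(1) mult_mono[of "norm x" 1 "\<bar>G (s x)\<bar>" C] by simp
  have dF: "(F has_derivative (\<lambda>h. T (s x) \<bullet> h)) (at x)" if x: "x \<noteq> 0" for x
  proof -
    have dn: "(norm has_derivative (\<lambda>h. s x \<bullet> h)) (at x)"
      using has_derivative_norm[OF x] by (simp add: s_def sgn_div_norm inner_commute)
    have ds: "(s has_derivative (\<lambda>h. h /\<^sub>R norm x - ((s x \<bullet> h) / norm x) *\<^sub>R s x)) (at x)"
      using has_derivative_normalize[OF x] by (simp only: s_def[abs_def])
    have "((\<lambda>x. G (s x)) has_derivative (\<lambda>h. g (s x) \<bullet> (h /\<^sub>R norm x - ((s x \<bullet> h) / norm x) *\<^sub>R s x))) (at x)"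
      by (rule has_derivative_compose[OF ds dG])
    from has_derivative_mult[OF dn this] show ?thesis
      unfolding F_def[abs_def]
      by (rule has_derivative_eq_rhs)
         (use x in \<open>auto simp: T_def fun_eq_iff inner_diff_right inner_diff_left inner_add_left inner_commute algebra_simps\<close>)
  qed
  have cTs: "continuous_on (- {0}) (\<lambda>x. T (s x))"
    unfolding s_def by (intro continuous_on_compose2[OF cT] continuous_intros) auto
  define Kd where "Kd z = (F (fst z) - F (snd z))\<^sup>2" for z
  define Kp where "Kp z = (T (s (fst z)) \<bullet> snd z)\<^sup>2" for z
  have fsm: "fst \<in> borel \<rightarrow>\<^sub>M (borel :: (real^'n) measure)" "snd \<in> borel \<rightarrow>\<^sub>M (borel :: (real^'n) measure)"
    by (auto intro!: borel_measurable_continuous_onI continuous_intros)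
  note fm = measurable_compose[OF fsm(1)] measurable_compose[OF fsm(2)]
  have Kdm: "Kd \<in> borel_measurable borel" unfolding Kd_def[abs_def]
    by (intro borel_measurable_power borel_measurable_diff fm Fm)
  have Kpm: "Kp \<in> borel_measurable borel" unfolding Kp_def[abs_def]
    by (intro borel_measurable_power borel_measurable_inner fsm fm) measurable
  have zb: "norm (fst z) \<le> 1" "norm (snd z) \<le> 1" if "z \<in> ball 0 1" for z :: "(real^'n) \<times> (real^'n)"
    using that norm_fst_le[of "fst z" "snd z"] norm_snd_le[of "snd z" "fst z"] by auto
  have Kdb: "\<bar>Kd z\<bar> \<le> (2 * C)\<^sup>2" if "z \<in> ball 0 1" for z
    using Fb[OF zb(1)[OF that]] Fb[OF zb(2)[OF that]] C(1) unfolding Kd_def abs_power2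
    by (intro power2_le_iff_abs_le[THEN iffD2]) auto
  have Kpb: "\<bar>Kp z\<bar> \<le> C'\<^sup>2" if "z \<in> ball 0 1" for z
  proof -
    have "\<bar>T (s (fst z)) \<bullet> snd z\<bar> \<le> norm (T (s (fst z))) * norm (snd z)" by (rule Cauchy_Schwarz_ineq2)
    also have "\<dots> \<le> C' * 1" using C'(2)[OF s_le] zb[OF that] C'(1) by (intro mult_mono) auto
    finally show ?thesis using C'(1) unfolding Kp_def abs_power2
      by (intro power2_le_iff_abs_le[THEN iffD2]) auto
  qed
  let ?b = "\<lambda>z :: (real^'n) \<times> (real^'n). indicator (ball 0 1) z :: real"
  have circle: "(\<integral>\<theta>. indicator {0..2*pi} \<theta> * Kd (rot_pair \<theta> z) \<partial>lborel) \<le>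
      2 * (\<integral>\<theta>. indicator {0..2*pi} \<theta> * Kp (rot_pair \<theta> z) \<partial>lborel)"
    if z: "\<bar>fst z \<bullet> snd z\<bar> < norm (fst z) * norm (snd z)" for z
  proof -
    define x y where "x = fst z" and "y = snd z"
    define c where "c \<theta> = cos \<theta> *\<^sub>R x + sin \<theta> *\<^sub>R y" for \<theta>
    have c0: "c \<theta> \<noteq> 0" for \<theta>
    proof
      assume "c \<theta> = 0"
      then have e: "cos \<theta> *\<^sub>R x = - (sin \<theta> *\<^sub>R y)" by (simp add: c_def eq_neg_iff_add_eq_0)
      have a: "\<bar>sin \<theta>\<bar> * \<bar>x \<bullet> y\<bar> = \<bar>cos \<theta>\<bar> * (norm x)\<^sup>2"
        using arg_cong[OF e, of "\<lambda>v. \<bar>x \<bullet> v\<bar>"] by (simp add: abs_mult power2_norm_eq_inner)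
      have b: "\<bar>cos \<theta>\<bar> * norm x = \<bar>sin \<theta>\<bar> * norm y"
        using arg_cong[OF e, of norm] by simp
      have "\<bar>sin \<theta>\<bar> * \<bar>x \<bullet> y\<bar> = \<bar>sin \<theta>\<bar> * (norm x * norm y)"
        using a b by (simp add: power2_eq_square mult_ac)
      then have "sin \<theta> = 0" using z by (simp add: x_def y_def)
      with b have "x = 0" by auto (metis sin_zero_abs_cos_one abs_eq_0 zero_neq_one \<open>sin \<theta> = 0\<close>)
      with z show False by (simp add: x_def)
    qed
    have rp: "rot_pair \<theta> z = (c \<theta>, c (\<theta> + pi/2))" for \<theta>
      by (simp add: rot_pair_def c_def x_def y_def cos_add sin_add)
    have dc: "(c has_vector_derivative c (\<theta> + pi/2)) (at \<theta>)" for \<theta>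
      unfolding c_def[abs_def] by (auto intro!: derivative_eq_intros simp: cos_add sin_add)
    have cc: "continuous_on UNIV c" unfolding c_def by (intro continuous_intros)
    define h where "h \<theta> = F (c \<theta>)" for \<theta>
    define h' where "h' \<theta> = T (s (c \<theta>)) \<bullet> c (\<theta> + pi/2)" for \<theta>
    have dh: "(h has_real_derivative h' \<theta>) (at \<theta>)" for \<theta>
      unfolding h_def[abs_def] h'_def has_field_derivative_def
      by (rule has_derivative_eq_rhs[OF has_derivative_compose[OF dc[unfolded has_vector_derivative_def] dF[OF c0]]])
         (simp add: fun_eq_iff mult.commute)
    have ch': "continuous_on UNIV h'" unfolding h'_def
      by (intro continuous_intros continuous_on_compose2[OF cTs cc] continuous_on_compose2[OF cc]) (use c0 in auto)
    have ch: "continuous_on UNIV h"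
      using dh by (meson DERIV_isCont continuous_at_imp_continuous_on)
    have per: "h (\<theta> + 2 * pi) = h \<theta>" for \<theta> by (simp add: h_def c_def)
    have "(\<integral>\<theta>. indicator {0..2*pi} \<theta> * Kd (rot_pair \<theta> z) \<partial>lborel) = integral {0..2*pi} (\<lambda>\<theta>. (h \<theta> - h (\<theta> + pi/2))\<^sup>2)"
      unfolding rp Kd_def fst_conv snd_conv h_def[symmetric]
      by (rule integral_indicator_Icc)
         (intro continuous_intros continuous_on_subset[OF ch] continuous_on_compose2[OF ch], auto)
    also have "\<dots> \<le> 2 * integral {0..2*pi} (\<lambda>\<theta>. (h' \<theta>)\<^sup>2)"
      by (rule wirtinger_quarter_shift[OF per dh ch'])
    also have "integral {0..2*pi} (\<lambda>\<theta>. (h' \<theta>)\<^sup>2) = (\<integral>\<theta>. indicator {0..2*pi} \<theta> * Kp (rot_pair \<theta> z) \<partial>lborel)"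
      unfolding rp Kp_def fst_conv snd_conv h'_def[symmetric]
      by (rule integral_indicator_Icc[symmetric]) (intro continuous_intros continuous_on_subset[OF ch'], auto)
    finally show ?thesis .
  qed
  have ineq: "(\<integral>z. ?b z * Kd z \<partial>lborel) \<le> 2 * (\<integral>z. ?b z * Kp z \<partial>lborel)"
  proof -
    have "(\<integral>z. ?b z * (\<integral>\<theta>. indicator {0..2*pi} \<theta> * Kd (rot_pair \<theta> z) \<partial>lborel) \<partial>lborel) \<le>
       (\<integral>z. 2 * (?b z * (\<integral>\<theta>. indicator {0..2*pi} \<theta> * Kp (rot_pair \<theta> z) \<partial>lborel)) \<partial>lborel)"
    proof (rule integral_mono_AE)
      show "AE z in lborel. ?b z * (\<integral>\<theta>. indicator {0..2*pi} \<theta> * Kd (rot_pair \<theta> z) \<partial>lborel) \<le>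
         2 * (?b z * (\<integral>\<theta>. indicator {0..2*pi} \<theta> * Kp (rot_pair \<theta> z) \<partial>lborel))"
        using AE_independent_pair[OF card] by eventually_elim (use circle in \<open>auto simp: indicator_def\<close>)
    qed (use integral_rot_average(1)[OF Kdm Kdb] integral_rot_average(1)[OF Kpm Kpb] in auto)
    then show ?thesis
      using integral_rot_average(2)[OF Kdm Kdb] integral_rot_average(2)[OF Kpm Kpb] by simp
  qed
  define vol where "vol = measure lborel (ball 0 1 :: (real^'n) set)"
  have vol: "vol > 0" by (simp add: vol_def content_ball_pos)
  define A where "A h = (\<integral>x. indicator (ball 0 1) x * h (x /\<^sub>R norm x) \<partial>lborel)" for h :: "real^'n \<Rightarrow> real"
  have AG: "A G = 0" using sphere_int_lborel(2)[OF cS(1)] mean by (simp add: A_def)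
  define X where "X = (\<integral>z. ?b z * (norm (fst z))\<^sup>2 \<partial>lborel)"
  have nm1: "(\<lambda>z :: (real^'n) \<times> (real^'n). (norm (fst z))\<^sup>2) \<in> borel_measurable borel"
    and nm2: "(\<lambda>z :: (real^'n) \<times> (real^'n). (norm (snd z))\<^sup>2) \<in> borel_measurable borel"
    by (intro borel_measurable_continuous_onI continuous_intros)+
  have swap: "(\<integral>z. ?b z * k (snd z) \<partial>lborel) = (\<integral>z. ?b z * k (fst z) \<partial>lborel)"
    if km: "k \<in> borel_measurable borel" for k :: "real^'n \<Rightarrow> real"
  proof -
    have "(\<integral>z. ?b (rot_pair (pi/2) z) * k (fst (rot_pair (pi/2) z)) \<partial>lborel) = (\<integral>z. ?b z * k (fst z) \<partial>lborel)"
      by (rule integral_lborel_orthogonal[OF orthogonal_rot_pair, where h = "\<lambda>z. ?b z * k (fst z)"])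
         (intro borel_measurable_times fm km borel_measurable_indicator ball_in_sets_borel)
    moreover have "?b (rot_pair (pi/2) z) = ?b z" for z by (simp only: indicator_def rot_pair_in_ball)
    ultimately show ?thesis by (simp add: rot_pair_def)
  qed
  have X2: "X = (\<integral>z. ?b z * (norm (snd z))\<^sup>2 \<partial>lborel)"
    unfolding X_def by (rule swap[symmetric]) simp
  have Xpos: "X > 0"
  proof -
    have "integrable lborel (\<lambda>z. ?b z * (norm (fst z))\<^sup>2)"
      by (rule integrable_on_ball[OF nm1, where C = 1]) (use zb in \<open>auto simp: power_le_one\<close>)
    moreover have "\<not> (AE z in lborel. ?b z * (norm (fst z))\<^sup>2 = 0)"
    proof
      assume "AE z in lborel. ?b z * (norm (fst z))\<^sup>2 = 0"
      then have "AE z in lborel. z \<notin> (ball 0 1 :: ((real^'n) \<times> (real^'n)) set)"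
        using AE_independent_pair[OF card] by eventually_elim (auto simp: indicator_def split: if_splits)
      then have "(ball 0 1 :: ((real^'n) \<times> (real^'n)) set) \<in> null_sets lborel"
        by (subst AE_iff_null_sets) auto
      then show False using unit_ball_vol_pos[of "real DIM((real^'n) \<times> (real^'n))"]
        by (simp add: null_sets_def emeasure_ball del: unit_ball_vol_pos)
    qed
    ultimately have "X \<noteq> 0" unfolding X_def
      by (subst integral_nonneg_eq_0_iff_AE) auto
    moreover have "0 \<le> X" unfolding X_def by (rule Bochner_Integration.integral_nonneg) auto
    ultimately show ?thesis by simp
  qed
  have intF: "integrable lborel (\<lambda>z. ?b z * (F (fst z) * F (snd z)))"
      "integrable lborel (\<lambda>z. ?b z * (F (fst z))\<^sup>2)" "integrable lborel (\<lambda>z. ?b z * (F (snd z))\<^sup>2)"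
  proof -
    have "\<bar>F (fst z) * F (snd z)\<bar> \<le> C * C" "\<bar>(F (fst z))\<^sup>2\<bar> \<le> C * C" "\<bar>(F (snd z))\<^sup>2\<bar> \<le> C * C"
      if "z \<in> ball 0 1" for z
      unfolding power2_eq_square abs_mult
      by (intro mult_mono Fb zb that C(1) abs_ge_zero)+
    then show "integrable lborel (\<lambda>z. ?b z * (F (fst z) * F (snd z)))"
      "integrable lborel (\<lambda>z. ?b z * (F (fst z))\<^sup>2)" "integrable lborel (\<lambda>z. ?b z * (F (snd z))\<^sup>2)"
      by (auto intro!: integrable_on_ball[where C = "C * C"] borel_measurable_times borel_measurable_power fm Fm)
  qed
  \<comment> \<open>The mean zero condition acts here: for fixed \<open>x\<close> the integral over
    \<open>y\<close> factors through polar coordinates into a multiple of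
    \<open>A G\<close>.\<close>
  have cross: "(\<integral>z. ?b z * (F (fst z) * F (snd z)) \<partial>lborel) = 0"
  proof -
    have inner: "(\<integral>y. ?b (x, y) * (F x * F y) \<partial>lborel) = 0" for x :: "real^'n"
    proof -
      define f where "f r = (if (norm x)\<^sup>2 + r\<^sup>2 < 1 then r else 0)" for r :: real
      have fmx: "f \<in> borel_measurable borel" unfolding f_def by measurable
      have fb: "0 \<le> f r \<and> f r \<le> 1" if "0 \<le> r" "r < 1" for r using that by (simp add: f_def)
      have "vol * (\<integral>y. indicator (ball 0 1) y * (G (y /\<^sub>R norm y) * f (norm y)) \<partial>lborel) = A G * (\<integral>(y::real^'n). indicator (ball 0 1) y * f (norm y) \<partial>lborel)"
        unfolding vol_def A_def by (rule integral_polar[OF _ fmx C(2) fb]) auto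
      then have z: "(\<integral>y. indicator (ball 0 1) y * (G (y /\<^sub>R norm y) * f (norm y)) \<partial>lborel) = 0"
        using AG vol by simp
      have eq: "?b (x, y) * (F x * F y) = F x * (indicator (ball 0 1) y * (G (y /\<^sub>R norm y) * f (norm y)))" for y
      proof (cases "(norm x)\<^sup>2 + (norm y)\<^sup>2 < 1")
        case True
        then have "(x, y) \<in> ball 0 1" by (simp only: Pair_in_ball_iff)
        moreover have "norm y < 1" using True zero_le_power2[of "norm x"]
          by (smt (verit) norm_ge_zero power2_less_imp_less one_power2)
        ultimately show ?thesis using True by (simp add: indicator_def f_def F_def s_def)
      next
        case False
        then have "(x, y) \<notin> ball 0 1" by (simp only: Pair_in_ball_iff) auto
        then show ?thesis using False by (simp only: indicator_def f_def) simp
      qed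
      show ?thesis unfolding eq Bochner_Integration.integral_mult_right_zero z by simp
    qed
    show ?thesis using integral_lborel_pair[OF intF(1)] by (simp add: inner)
  qed
  have "(\<integral>z. ?b z * Kd z \<partial>lborel) =
      (\<integral>z. (?b z * (F (fst z))\<^sup>2 + ?b z * (F (snd z))\<^sup>2) - 2 * (?b z * (F (fst z) * F (snd z))) \<partial>lborel)"
    by (rule Bochner_Integration.integral_cong) (auto simp: Kd_def power2_eq_square algebra_simps)
  also have "\<dots> = (\<integral>z. ?b z * (F (fst z))\<^sup>2 \<partial>lborel) + (\<integral>z. ?b z * (F (snd z))\<^sup>2 \<partial>lborel)"
    using intF cross by simp
  also have "(\<integral>z. ?b z * (F (snd z))\<^sup>2 \<partial>lborel) = (\<integral>z. ?b z * (F (fst z))\<^sup>2 \<partial>lborel)"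
    by (rule swap) (use Fm in measurable)
  finally have Kd2: "(\<integral>z. ?b z * Kd z \<partial>lborel) = 2 * (\<integral>z. ?b z * (F (fst z))\<^sup>2 \<partial>lborel)" by simp
  have F2: "vol * (\<integral>z. ?b z * (F (fst z))\<^sup>2 \<partial>lborel) = A (\<lambda>x. (G x)\<^sup>2) * X"
  proof -
    have "vol * (\<integral>z. ?b z * ((G (fst z /\<^sub>R norm (fst z)))\<^sup>2 * (norm (fst z))\<^sup>2) \<partial>lborel) = A (\<lambda>x. (G x)\<^sup>2) * X"
      unfolding vol_def A_def X_def
    proof (rule integral_polar_pair[where c = "\<lambda>r s. r\<^sup>2" and K = 1 and C = "C\<^sup>2" and k = "\<lambda>x. (G x)\<^sup>2"])
      show "(\<lambda>(r::real, s::real). r\<^sup>2) \<in> borel_measurable borel"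
        unfolding split_beta' by (intro borel_measurable_continuous_onI continuous_intros)
      show "\<bar>(G x)\<^sup>2\<bar> \<le> C\<^sup>2" if "norm x \<le> 1" for x
        using C(2)[OF that] C(1) unfolding abs_power2 by (intro power2_le_iff_abs_le[THEN iffD2])
    qed (auto simp: power_le_one)
    then show ?thesis by (simp add: F_def s_def power_mult_distrib mult_ac)
  qed
  have intT: "integrable lborel (\<lambda>z. ?b z * Kp z)" by (rule integrable_on_ball[OF Kpm Kpb])
  have T2m: "(\<lambda>z :: (real^'n) \<times> (real^'n). (norm (T (s (fst z))))\<^sup>2 * (norm (snd z))\<^sup>2) \<in> borel_measurable borel"
  proof -
    have hm: "(\<lambda>x. (norm (T (s x)))\<^sup>2) \<in> borel_measurable borel" by measurable
    show ?thesis by (rule borel_measurable_times[OF fm(1)[OF hm] nm2])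
  qed
  have intT2: "integrable lborel (\<lambda>z. ?b z * ((norm (T (s (fst z))))\<^sup>2 * (norm (snd z))\<^sup>2))"
  proof (rule integrable_on_ball[OF T2m])
    fix z :: "(real^'n) \<times> (real^'n)" assume z: "z \<in> ball 0 1"
    show "\<bar>(norm (T (s (fst z))))\<^sup>2 * (norm (snd z))\<^sup>2\<bar> \<le> C'\<^sup>2 * 1"
      unfolding abs_mult using C'(2)[OF s_le] zb[OF z] by (intro mult_mono) (auto simp: power_le_one power_mono)
  qed
  have "(\<integral>z. ?b z * Kp z \<partial>lborel) = (\<integral>x. (\<integral>y. ?b (x, y) * Kp (x, y) \<partial>lborel) \<partial>lborel)"
    using integral_lborel_pair[OF intT] by simp
  also have "\<dots> = (\<integral>x. (\<integral>y. ?b (x, y) * ((norm (T (s x)))\<^sup>2 * (norm y)\<^sup>2) \<partial>lborel) / CARD('n) \<partial>lborel)"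
  proof (rule Bochner_Integration.integral_cong[OF refl])
    fix x :: "real^'n"
    have b: "?b (x, y) = indicator {y. (norm y)\<^sup>2 < 1 - (norm x)\<^sup>2} y" for y
      by (simp only: indicator_def Pair_in_ball_iff) auto
    show "(\<integral>y. ?b (x, y) * Kp (x, y) \<partial>lborel) = (\<integral>y. ?b (x, y) * ((norm (T (s x)))\<^sup>2 * (norm y)\<^sup>2) \<partial>lborel) / CARD('n)"
      unfolding b Kp_def fst_conv snd_conv integral_ball_inner_sq
      by (simp add: mult.left_commute[of _ "(norm (T (s x)))\<^sup>2"])
  qed
  also have "\<dots> = (\<integral>z. ?b z * ((norm (T (s (fst z))))\<^sup>2 * (norm (snd z))\<^sup>2) \<partial>lborel) / CARD('n)"
    using integral_lborel_pair[OF intT2] by simp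
  finally have Kp2: "CARD('n) * (\<integral>z. ?b z * Kp z \<partial>lborel) = (\<integral>z. ?b z * ((norm (T (s (fst z))))\<^sup>2 * (norm (snd z))\<^sup>2) \<partial>lborel)"
    by simp
  have T2: "vol * (\<integral>z. ?b z * ((norm (T (s (fst z))))\<^sup>2 * (norm (snd z))\<^sup>2) \<partial>lborel) = A (\<lambda>x. (norm (T x))\<^sup>2) * X"
    unfolding vol_def A_def X2 s_def
  proof (rule integral_polar_pair[where c = "\<lambda>r s. s\<^sup>2" and K = 1 and C = "C'\<^sup>2" and k = "\<lambda>x. (norm (T x))\<^sup>2"])
    show "(\<lambda>(r::real, s::real). s\<^sup>2) \<in> borel_measurable borel"
      unfolding split_beta' by (intro borel_measurable_continuous_onI continuous_intros)
    show "\<bar>(norm (T x))\<^sup>2\<bar> \<le> C'\<^sup>2" if "norm x \<le> 1" for x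
      using C'(2)[OF that] by (simp add: power_mono)
  qed (auto simp: power_le_one)
  have "A (\<lambda>x. (G x)\<^sup>2) * X * CARD('n) \<le> A (\<lambda>x. (norm (T x))\<^sup>2) * X"
    unfolding F2[symmetric] T2[symmetric] Kp2[symmetric] using ineq vol Kd2 by simp
  then have main: "CARD('n) * A (\<lambda>x. (G x)\<^sup>2) \<le> A (\<lambda>x. (norm (T x))\<^sup>2)"
    using Xpos by (simp add: mult_ac)
  \<comment> \<open>\<open>W\<close> is the squared tangential gradient. On the sphere the squared
    norm of \<open>T\<close> is \<open>G^2 + W\<close>, which lowers the constant from n in
    \<open>main\<close> to n - 1.\<close>
  define W where "W x = (norm (g x))\<^sup>2 - (g x \<bullet> x)\<^sup>2" for x
  have cW: "continuous_on (sphere 0 1) W" "continuous_on (sphere 0 1) (\<lambda>x. (G x)\<^sup>2)"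
    unfolding W_def by (intro continuous_intros cS)+
  have TW: "(norm (T x))\<^sup>2 = (G x)\<^sup>2 + W x" if "norm x = 1" for x
  proof -
    have "x \<bullet> x = 1" using that by (simp add: norm_eq_1)
    then show ?thesis unfolding W_def T_def power2_norm_eq_inner
      by (simp add: inner_add_left inner_add_right inner_diff_left inner_diff_right inner_commute power2_eq_square algebra_simps)
  qed
  have "A (\<lambda>x. (norm (T x))\<^sup>2) = (\<integral>x. indicator (ball 0 1) x * (G (x /\<^sub>R norm x))\<^sup>2 + indicator (ball 0 1) x * W (x /\<^sub>R norm x) \<partial>lborel)"
    unfolding A_def
  proof (rule integral_cong_AE)
    show "AE x in lborel. indicator (ball 0 1) x * (norm (T (x /\<^sub>R norm x)))\<^sup>2 =
       indicator (ball 0 1) x * (G (x /\<^sub>R norm x))\<^sup>2 + indicator (ball 0 1) x * W (x /\<^sub>R norm x)"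
      using AE_norm_neq[of 0] by eventually_elim (use TW in \<open>auto simp: indicator_def\<close>)
    show "(\<lambda>x. indicator (ball 0 1) x * (G (x /\<^sub>R norm x))\<^sup>2 + indicator (ball 0 1) x * W (x /\<^sub>R norm x)) \<in> borel_measurable lborel"
      using sphere_int_lborel(1)[OF cW(1)] sphere_int_lborel(1)[OF cW(2)] by (intro borel_measurable_add) auto
    show "(\<lambda>x. indicator (ball 0 1) x * (norm (T (x /\<^sub>R norm x)))\<^sup>2) \<in> borel_measurable lborel"
      by measurable
  qed
  also have "\<dots> = A (\<lambda>x. (G x)\<^sup>2) + A W"
    unfolding A_def by (rule Bochner_Integration.integral_add) (rule sphere_int_lborel(1)[OF cW(2)], rule sphere_int_lborel(1)[OF cW(1)])
  finally have "(CARD('n) - 1) * A (\<lambda>x. (G x)\<^sup>2) \<le> A W" using main card by (simp add: of_nat_diff algebra_simps)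
  then show ?thesis
    using sphere_int_lborel(2)[OF cW(1)] sphere_int_lborel(2)[OF cW(2)] card
    unfolding W_def[symmetric] by (simp add: A_def of_nat_diff mult.left_commute)
qed

section \<open>Jacobi fields along the profile curve\<close>

text \<open>Everything is scaled so that the maximal radius is 1. The profile \<open>w\<close> makes the angle
  \<open>\<alpha>\<close> with the axis, \<open>\<phi> = cos \<alpha>\<close> and \<open>\<tau> = sin \<alpha>\<close>; the principal curvatures are
  \<open>k1\<close> along the profile and \<open>k2\<close> along the parallels. With \<open>z\<close> as parameter, \<open>m dz\<close> is the
  area element and \<open>jac c e\<close> says that \<open>- c\<close> is the Jacobi operator applied to \<open>e\<close>. The Jacobi
  fields \<open>\<tau>\<close> and \<open>us\<close> come from translation along the axis and from dilation.\<close>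

lemma jacobi_scaling_identity:
  fixes N A W f s K z :: real
  assumes W: "W \<noteq> 0" "f \<noteq> 0" and s2: "s * s = 1 - f * f"
  shows "(N * (A / W) * (s / f) * K + - N * (K - f / W) * (s / f) / W * A) * (W * s + z * f) +
      (s / f * s + - K * W + (1 * f + K * s / f * z)) * (A * K) =
      - (A / f * (K\<^sup>2 + N * (f / W)\<^sup>2)) * (W * f - z * s) - - (K + N * (f / W)) * (A / f)"
proof -
  \<comment> \<open>In the application \<open>N\<close> is n - 1, \<open>A\<close> is
    \<open>w^(n-1)\<close>, and \<open>W\<close>, \<open>f\<close>, \<open>s\<close>,
    \<open>K\<close> are the radius, cosine, sine and profile curvature; with free letters the power
    of the radius is a single atom.\<close>
  have "(N * (A / W) * (s / f) * K + - N * (K - f / W) * (s / f) / W * A) * (W * s + z * f) =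
      N * A / W * (s * s) + N * A / (W * W) * z * s * f"
    using W by (simp add: field_simps)
  moreover have "(s / f * s + - K * W + (1 * f + K * s / f * z)) * (A * K) =
      (1 / f - K * W + K * s / f * z) * (A * K)"
  proof -
    have "s / f * s + f = 1 / f" using W s2 by (simp add: field_simps)
    then have "s / f * s + - K * W + (1 * f + K * s / f * z) = 1 / f - K * W + K * s / f * z"
      by (simp add: algebra_simps)
    then show ?thesis by simp
  qed
  moreover have "N * A / W * (1 - f * f) + N * A / (W * W) * z * s * f + (1 / f - K * W + K * s / f * z) * (A * K) =
      - (A / f * (K\<^sup>2 + N * (f / W)\<^sup>2)) * (W * f - z * s) - - (K + N * (f / W)) * (A / f)"
    using W by (simp add: field_simps power2_eq_square)
  ultimately show ?thesis by (simp only: s2)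
qed

text \<open>The equations for \<phi> and \<tau> say that the two kinds of principal curvature add up
  to the constant \<open>n Q\<close>; \<open>first\<close> is the conserved flux of that equation.
  \<open>Q_ends\<close> fixes the sign of the profile curvature at neck and bulge. Derivatives are
  required only in the interior, everything else up to the ends.\<close>

locale profile =
  fixes n :: nat and Q t P :: real and w \<phi> \<tau> :: "real \<Rightarrow> real"
  assumes n2: "2 \<le> n" and P0: "0 < P" and Q0: "0 < Q" and Q1: "Q < 1" and t0: "0 < t" and t1: "t < 1"
    and cw: "continuous_on {0..P} w" and c\<phi>: "continuous_on {0..P} \<phi>" and c\<tau>: "continuous_on {0..P} \<tau>"
    and w0: "\<And>z. z \<in> {0..P} \<Longrightarrow> 0 < w z" and \<phi>0: "\<And>z. z \<in> {0..P} \<Longrightarrow> 0 < \<phi> z"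
    and dw: "\<And>z. 0 < z \<Longrightarrow> z < P \<Longrightarrow> (w has_real_derivative \<tau> z / \<phi> z) (at z)"
    and d\<phi>: "\<And>z. 0 < z \<Longrightarrow> z < P \<Longrightarrow>
      (\<phi> has_real_derivative (n * Q - (real n - 1) * (\<phi> z / w z)) * \<tau> z / \<phi> z) (at z)"
    and d\<tau>: "\<And>z. 0 < z \<Longrightarrow> z < P \<Longrightarrow>
      (\<tau> has_real_derivative - (n * Q - (real n - 1) * (\<phi> z / w z))) (at z)"
    and \<tau>pos: "\<And>z. 0 < z \<Longrightarrow> z < P \<Longrightarrow> 0 < \<tau> z" and \<tau>z: "\<tau> 0 = 0" "\<tau> P = 0"
    and pyth: "\<And>z. z \<in> {0..P} \<Longrightarrow> (\<phi> z)\<^sup>2 + (\<tau> z)\<^sup>2 = 1"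
    and first: "\<And>z. z \<in> {0..P} \<Longrightarrow> w z ^ (n - 1) * \<phi> z = 1 - Q + Q * w z ^ n"
    and w_ends: "w 0 = t" "w P = 1"
    and Q_ends: "real n - 1 < n * Q" "n * Q * t < real n - 1"
begin

definition "k2 z = \<phi> z / w z"
definition "k1 z = n * Q - (real n - 1) * k2 z"
text \<open>With arc length element \<open>dz / \<phi>\<close>, up to the measure of the sphere, the
  Dirichlet integrand of a rotationally symmetric u becomes \<open>p u'^2 dz\<close>, the area
  element \<open>m dz\<close>, and the squared second fundamental form times area
  \<open>q dz\<close>.\<close>

definition "p z = w z ^ (n - 1) * \<phi> z"
definition "m z = w z ^ (n - 1) / \<phi> z"
definition "q z = m z * ((k1 z)\<^sup>2 + (real n - 1) * (k2 z)\<^sup>2)"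
definition "kap = n * Q - (real n - 1)"

definition C1 :: "(real \<Rightarrow> real) \<Rightarrow> (real \<Rightarrow> real) \<Rightarrow> bool" where
  "C1 u u' \<longleftrightarrow> continuous_on {0..P} u \<and> continuous_on {0..P} u' \<and>
    (\<forall>z. 0 < z \<longrightarrow> z < P \<longrightarrow> (u has_real_derivative u' z) (at z))"

definition jac :: "real \<Rightarrow> (real \<Rightarrow> real) \<Rightarrow> (real \<Rightarrow> real) \<Rightarrow> bool" where
  "jac c e e' \<longleftrightarrow> C1 e e' \<and>
    (\<forall>z. 0 < z \<longrightarrow> z < P \<longrightarrow> ((\<lambda>z. p z * e' z) has_real_derivative - q z * e z - c * m z) (at z))"

definition bil :: "(real \<Rightarrow> real) \<Rightarrow> (real \<Rightarrow> real) \<Rightarrow> (real \<Rightarrow> real) \<Rightarrow> (real \<Rightarrow> real) \<Rightarrow> real" where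
  "bil e e' f f' = integral {0..P} (\<lambda>z. p z * e' z * f' z - q z * e z * f z)"

lemma nz: "z \<in> {0..P} \<Longrightarrow> w z \<noteq> 0" "z \<in> {0..P} \<Longrightarrow> \<phi> z \<noteq> 0"
  using w0 \<phi>0 by force+

lemma cont_coeffs: "continuous_on {0..P} k2" "continuous_on {0..P} k1" "continuous_on {0..P} p"
    "continuous_on {0..P} m" "continuous_on {0..P} q"
proof -
  show k2: "continuous_on {0..P} k2" unfolding k2_def by (intro continuous_intros cw c\<phi> ballI nz)
  show k1: "continuous_on {0..P} k1" unfolding k1_def by (intro continuous_intros k2)
  show "continuous_on {0..P} p" unfolding p_def by (intro continuous_intros cw c\<phi>)
  show m: "continuous_on {0..P} m" unfolding m_def by (intro continuous_intros cw c\<phi> ballI nz)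
  show "continuous_on {0..P} q" unfolding q_def by (intro continuous_intros k1 k2 m)
qed

lemma pos_coeffs: "z \<in> {0..P} \<Longrightarrow> 0 < p z" "z \<in> {0..P} \<Longrightarrow> 0 < m z" "z \<in> {0..P} \<Longrightarrow> 0 < q z"
proof -
  assume z: "z \<in> {0..P}"
  show "0 < p z" using w0[OF z] \<phi>0[OF z] by (simp add: p_def)
  show m: "0 < m z" using w0[OF z] \<phi>0[OF z] by (simp add: m_def)
  have "0 < k2 z" using w0[OF z] \<phi>0[OF z] by (simp add: k2_def)
  then have "0 < (real n - 1) * (k2 z)\<^sup>2" using n2 by simp
  then have "0 < (k1 z)\<^sup>2 + (real n - 1) * (k2 z)\<^sup>2" using zero_le_power2[of "k1 z"] by linarith
  then show "0 < q z" using m unfolding q_def by (rule mult_pos_pos[rotated])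
qed

lemma ends: "\<phi> 0 = 1" "\<phi> P = 1" "p P = 1" "k1 P = kap" "0 < kap" "k1 0 < 0"
proof -
  have "(\<phi> 0)\<^sup>2 = 1" "(\<phi> P)\<^sup>2 = 1" using pyth[of 0] pyth[of P] \<tau>z P0 by auto
  then show e: "\<phi> 0 = 1" "\<phi> P = 1" using \<phi>0[of 0] \<phi>0[of P] P0 by (auto simp: power2_eq_1_iff)
  show "p P = 1" "k1 P = kap" "0 < kap" using e w_ends Q_ends by (simp_all add: p_def k1_def k2_def kap_def)
  show "k1 0 < 0" using e w_ends Q_ends t0 by (simp add: k1_def k2_def field_simps)
qed

lemma dpow:
  assumes "0 < z" "z < P"
  shows "((\<lambda>z. w z ^ (n - 1)) has_real_derivative (real n - 1) * (w z ^ (n - 1) / w z) * (\<tau> z / \<phi> z)) (at z)"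
    and "((\<lambda>z. w z ^ n) has_real_derivative n * w z ^ (n - 1) * (\<tau> z / \<phi> z)) (at z)"
proof -
  obtain k where k: "n = Suc (Suc k)" using n2 by (metis Suc_1 add_2_eq_Suc le_Suc_ex)
  show "((\<lambda>z. w z ^ (n - 1)) has_real_derivative (real n - 1) * (w z ^ (n - 1) / w z) * (\<tau> z / \<phi> z)) (at z)"
    using DERIV_power[OF dw[OF assms], of "n - 1"] nz(1)[of z] assms by (simp add: k mult_ac)
  show "((\<lambda>z. w z ^ n) has_real_derivative n * w z ^ (n - 1) * (\<tau> z / \<phi> z)) (at z)"
    using DERIV_power[OF dw[OF assms], of n] by (simp add: k mult_ac)
qed

lemma dk1:
  assumes "0 < z" "z < P"
  shows "(k1 has_real_derivative - (real n - 1) * (k1 z - k2 z) * (\<tau> z / \<phi> z) / w z) (at z)"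
    and "(\<phi> has_real_derivative k1 z * \<tau> z / \<phi> z) (at z)" and "(\<tau> has_real_derivative - k1 z) (at z)"
proof -
  have z: "z \<in> {0..P}" using assms by simp
  show d\<phi>': "(\<phi> has_real_derivative k1 z * \<tau> z / \<phi> z) (at z)" and "(\<tau> has_real_derivative - k1 z) (at z)"
    using d\<phi>[OF assms] d\<tau>[OF assms] by (simp_all add: k1_def k2_def)
  have "((\<lambda>z. n * Q - (real n - 1) * (\<phi> z / w z)) has_real_derivative
      - ((real n - 1) * ((k1 z * \<tau> z / \<phi> z * w z - \<phi> z * (\<tau> z / \<phi> z)) / (w z * w z)))) (at z)"
    using DERIV_diff[OF DERIV_const DERIV_cmult[OF DERIV_divide[OF d\<phi>' dw[OF assms] nz(1)[OF z]]],
        of "n * Q" "real n - 1"] by simp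
  moreover have "- ((real n - 1) * ((k1 z * \<tau> z / \<phi> z * w z - \<phi> z * (\<tau> z / \<phi> z)) / (w z * w z))) =
      - (real n - 1) * (k1 z - k2 z) * (\<tau> z / \<phi> z) / w z"
  proof -
    have "- (N * ((K * s / f * W - f * (s / f)) / (W * W))) = - N * (K - f / W) * (s / f) / W"
      if "W \<noteq> 0" "f \<noteq> 0" for N K s f W :: real
      using that by (simp add: field_simps)
    from this[OF nz[OF z]] show ?thesis unfolding k2_def .
  qed
  moreover have "k1 = (\<lambda>z. n * Q - (real n - 1) * (\<phi> z / w z))" by (simp add: fun_eq_iff k1_def k2_def)
  ultimately show "(k1 has_real_derivative - (real n - 1) * (k1 z - k2 z) * (\<tau> z / \<phi> z) / w z) (at z)"
    by metis
qed

text \<open>Integration by parts against a Jacobi-type field. The boundary terms stay, because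
  admissible variations need not vanish at the ends and the fields move the faces of the
  slab.\<close>

lemma weak_form:
  assumes e: "jac c e e'" and f: "C1 f f'"
  shows "bil e e' f f' = c * integral {0..P} (\<lambda>z. m z * f z) + p P * e' P * f P - p 0 * e' 0 * f 0"
proof -
  have ce: "continuous_on {0..P} e" "continuous_on {0..P} e'" "continuous_on {0..P} f" "continuous_on {0..P} f'"
    using e f by (auto simp: jac_def C1_def)
  have "integral {0..P} (\<lambda>z. (p z * e' z * f' z - q z * e z * f z) - c * (m z * f z)) = p P * e' P * f P - p 0 * e' 0 * f 0"
  proof (rule integral_eq_boundary_diff)
    show "continuous_on {0..P} (\<lambda>z. p z * e' z * f z)" by (intro continuous_intros ce cont_coeffs)
    fix z assume z: "0 < z" "z < P"
    have "((\<lambda>z. (p z * e' z) * f z) has_real_derivative (- q z * e z - c * m z) * f z + f' z * (p z * e' z)) (at z)"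
      using e f z unfolding jac_def C1_def by (intro DERIV_mult) auto
    then show "((\<lambda>z. p z * e' z * f z) has_real_derivative (p z * e' z * f' z - q z * e z * f z) - c * (m z * f z)) (at z)"
      by (simp add: algebra_simps)
  qed (use P0 in auto)
  moreover have "integral {0..P} (\<lambda>z. (p z * e' z * f' z - q z * e z * f z) - c * (m z * f z)) =
      bil e e' f f' - c * integral {0..P} (\<lambda>z. m z * f z)"
    unfolding bil_def
    by (subst Henstock_Kurzweil_Integration.integral_diff)
       (auto intro!: integrable_continuous_real continuous_intros ce cont_coeffs)
  ultimately show ?thesis by simp
qed

lemma C1_lin: "C1 e e' \<Longrightarrow> C1 f f' \<Longrightarrow> C1 (\<lambda>z. a * e z + b * f z) (\<lambda>z. a * e' z + b * f' z)"
  unfolding C1_def by (auto intro!: continuous_intros derivative_eq_intros)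

lemma jac_lin:
  assumes "jac c e e'" "jac d f f'"
  shows "jac (a * c + b * d) (\<lambda>z. a * e z + b * f z) (\<lambda>z. a * e' z + b * f' z)"
  unfolding jac_def
proof (intro conjI allI impI)
  show "C1 (\<lambda>z. a * e z + b * f z) (\<lambda>z. a * e' z + b * f' z)"
    using assms C1_lin by (simp add: jac_def)
  fix z assume z: "0 < z" "z < P"
  have "((\<lambda>z. a * (p z * e' z) + b * (p z * f' z)) has_real_derivative
     a * (- q z * e z - c * m z) + b * (- q z * f z - d * m z)) (at z)"
    using assms z unfolding jac_def by (intro DERIV_add DERIV_cmult) auto
  then show "((\<lambda>z. p z * (a * e' z + b * f' z)) has_real_derivative
     - q z * (a * e z + b * f z) - (a * c + b * d) * m z) (at z)"
    by (simp add: algebra_simps)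
qed

lemma bil_add:
  assumes "C1 e e'" "C1 f f'"
  shows "bil (\<lambda>z. e z + f z) (\<lambda>z. e' z + f' z) (\<lambda>z. e z + f z) (\<lambda>z. e' z + f' z) =
    bil e e' e e' + 2 * bil e e' f f' + bil f f' f f'"
proof -
  have ce: "continuous_on {0..P} e" "continuous_on {0..P} e'" "continuous_on {0..P} f" "continuous_on {0..P} f'"
    using assms by (auto simp: C1_def)
  have "((\<lambda>z. (p z * e' z * e' z - q z * e z * e z) + 2 * (p z * e' z * f' z - q z * e z * f z)
        + (p z * f' z * f' z - q z * f z * f z)) has_integral
      bil e e' e e' + 2 * bil e e' f f' + bil f f' f f') {0..P}"
    unfolding bil_def
    by (intro has_integral_add has_integral_mult_right integrable_integral integrable_continuous_real
        continuous_intros ce cont_coeffs)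
  then show ?thesis unfolding bil_def[of "\<lambda>z. e z + f z"] 
    by (intro integral_unique) (simp add: algebra_simps)
qed

lemma bil_sym: "bil e e' f f' = bil f f' e e'"
  by (simp add: bil_def mult_ac)

lemma mean_add:
  assumes "C1 e e'" "C1 f f'"
  shows "integral {0..P} (\<lambda>z. m z * (a * e z + b * f z)) =
     a * integral {0..P} (\<lambda>z. m z * e z) + b * integral {0..P} (\<lambda>z. m z * f z)"
proof -
  have ce: "continuous_on {0..P} e" "continuous_on {0..P} f"
    using assms by (auto simp: C1_def)
  have "integral {0..P} (\<lambda>z. a * (m z * e z) + b * (m z * f z)) =
     a * integral {0..P} (\<lambda>z. m z * e z) + b * integral {0..P} (\<lambda>z. m z * f z)"
    by (subst Henstock_Kurzweil_Integration.integral_add)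
       (auto intro!: integrable_continuous_real continuous_intros ce cont_coeffs)
  then show ?thesis by (simp add: algebra_simps)
qed

lemma jac_\<tau>: "jac 0 \<tau> (\<lambda>z. - k1 z)"
  unfolding jac_def C1_def
proof (intro conjI allI impI)
  fix z assume z: "0 < z" "z < P"
  then have z': "z \<in> {0..P}" by simp
  show "(\<tau> has_real_derivative - k1 z) (at z)" using dk1[OF z] by simp
  have "((\<lambda>z. p z * - k1 z) has_real_derivative
     ((real n - 1) * (w z ^ (n - 1) / w z) * (\<tau> z / \<phi> z) * \<phi> z + k1 z * \<tau> z / \<phi> z * w z ^ (n - 1)) * - k1 z +
      - (- (real n - 1) * (k1 z - k2 z) * (\<tau> z / \<phi> z) / w z) * p z) (at z)"
    unfolding p_def by (intro DERIV_mult DERIV_minus dpow(1)[OF z] dk1[OF z])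
  moreover have "(N * (A / W) * (s / f) * f + K * s / f * A) * - K + - (- N * (K - f / W) * (s / f) / W) * (A * f) =
      - (A / f * (K\<^sup>2 + N * (f / W)\<^sup>2)) * s - 0 * (A / f)" if "W \<noteq> 0" "f \<noteq> 0" for N A W s f K :: real
    using that by (simp add: field_simps power2_eq_square)
  note this[OF nz[OF z'], of "real n - 1" "w z ^ (n - 1)" "\<tau> z" "k1 z"]
  ultimately show "((\<lambda>z. p z * - k1 z) has_real_derivative - q z * \<tau> z - 0 * m z) (at z)"
    unfolding q_def m_def k2_def p_def by simp
qed (auto intro!: continuous_intros c\<tau> cont_coeffs)

text \<open>The position vector \<open>(z, w \<theta>)\<close> paired with the unit normal
  \<open>(- \<tau>, \<phi> \<theta>)\<close>, that is, the normal velocity of dilation about a point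
  of the left face. This face is preserved, so the derivative vanishes at 0 but not at
  \<open>P\<close>. The constant \<open>- n Q\<close> in \<open>jac_us\<close> is the rate at which
  dilation changes the mean curvature.\<close>

definition "us z = w z * \<phi> z - z * \<tau> z"
definition "us' z = k1 z * (w z * \<tau> z / \<phi> z + z)"

lemma jac_us: "jac (- (n * Q)) us us'"
  unfolding jac_def C1_def
proof (intro conjI allI impI)
  show "continuous_on {0..P} us" "continuous_on {0..P} us'"
    unfolding us_def us'_def by (intro continuous_intros cw c\<phi> c\<tau> cont_coeffs ballI nz)+
  fix z assume z: "0 < z" "z < P"
  then have z': "z \<in> {0..P}" by simp
  have "(us has_real_derivative (\<tau> z / \<phi> z) * \<phi> z + k1 z * \<tau> z / \<phi> z * w z - (1 * \<tau> z + - k1 z * z)) (at z)"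
    unfolding us_def[abs_def] by (intro DERIV_mult DERIV_diff DERIV_ident dk1[OF z] dw[OF z])
  then show "(us has_real_derivative us' z) (at z)"
    using nz[OF z'] by (simp add: us'_def field_simps)
  have pu: "p z * us' z = w z ^ (n - 1) * k1 z * (w z * \<tau> z + z * \<phi> z)" if "z \<in> {0..P}" for z
    using nz[OF that] by (simp add: p_def us'_def field_simps)
  have d: "((\<lambda>z. w z ^ (n - 1) * k1 z * (w z * \<tau> z + z * \<phi> z)) has_real_derivative
      ((real n - 1) * (w z ^ (n - 1) / w z) * (\<tau> z / \<phi> z) * k1 z +
        - (real n - 1) * (k1 z - k2 z) * (\<tau> z / \<phi> z) / w z * w z ^ (n - 1)) * (w z * \<tau> z + z * \<phi> z) +
      ((\<tau> z / \<phi> z) * \<tau> z + - k1 z * w z + (1 * \<phi> z + k1 z * \<tau> z / \<phi> z * z)) * (w z ^ (n - 1) * k1 z)) (at z)"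
    by (intro DERIV_mult DERIV_add DERIV_ident dk1[OF z] dw[OF z] dpow(1)[OF z])
  have k: "k1 z = n * Q - (real n - 1) * (\<phi> z / w z)" by (simp add: k1_def k2_def)
  have nQ: "n * Q = k1 z + (real n - 1) * (\<phi> z / w z)" by (simp add: k)
  have \<tau>2: "\<tau> z * \<tau> z = 1 - \<phi> z * \<phi> z" using pyth[OF z'] by (simp add: power2_eq_square)
  have eq: "((real n - 1) * (w z ^ (n - 1) / w z) * (\<tau> z / \<phi> z) * k1 z +
        - (real n - 1) * (k1 z - k2 z) * (\<tau> z / \<phi> z) / w z * w z ^ (n - 1)) * (w z * \<tau> z + z * \<phi> z) +
      ((\<tau> z / \<phi> z) * \<tau> z + - k1 z * w z + (1 * \<phi> z + k1 z * \<tau> z / \<phi> z * z)) * (w z ^ (n - 1) * k1 z) =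
      - q z * us z - - (n * Q) * m z"
    unfolding q_def us_def m_def k2_def nQ
    by (rule jacobi_scaling_identity[OF nz[OF z'] \<tau>2])
  show "((\<lambda>z. p z * us' z) has_real_derivative - q z * us z - - (n * Q) * m z) (at z)"
    unfolding eq[symmetric]
    by (rule has_field_derivative_transform_within_open[OF d, of "{0<..<P}"]) (use z pu in auto)
qed

section \<open>Volume integrals of the profile\<close>

definition "M = integral {0..P} (\<lambda>z. m z * us z)"
definition "I = integral {0..P} (\<lambda>z. w z ^ n)"

lemma integrable_wn: "(\<lambda>z. w z ^ n) integrable_on {0..P}"
  by (intro integrable_continuous_real continuous_intros cw)

lemma w_pow: "w z ^ n = w z * w z ^ (n - 1)"
  using n2 by (cases n) auto

text \<open>Dilation multiplies the volume of the body at rate n + 1, but the part pushed beyond the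
  right face, of cross section \<open>w P ^ n = 1\<close> and thickness rate \<open>P\<close>, is
  not swept out by the normal velocity. Formally this is the derivative of \<open>z w^n\<close>,
  integrated.\<close>

lemma M_eq: "n * M = (real n + 1) * I - P"
proof -
  have "integral {0..P} (\<lambda>z. (real n + 1) * w z ^ n - n * (m z * us z)) = P * w P ^ n - 0 * w 0 ^ n"
  proof (rule integral_eq_boundary_diff)
    show "continuous_on {0..P} (\<lambda>z. z * w z ^ n)" by (intro continuous_intros cw)
    fix z assume z: "0 < z" "z < P"
    have "((\<lambda>z. z * w z ^ n) has_real_derivative 1 * w z ^ n + n * w z ^ (n - 1) * (\<tau> z / \<phi> z) * z) (at z)"
      by (intro DERIV_mult DERIV_ident dpow(2)[OF z])
    moreover have "1 * w z ^ n + n * w z ^ (n - 1) * (\<tau> z / \<phi> z) * z = (real n + 1) * w z ^ n - n * (m z * us z)"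
      using nz[of z] z by (simp add: m_def us_def w_pow field_simps)
    ultimately show "((\<lambda>z. z * w z ^ n) has_real_derivative (real n + 1) * w z ^ n - n * (m z * us z)) (at z)"
      by simp
  qed (use P0 in auto)
  moreover have "integral {0..P} (\<lambda>z. (real n + 1) * w z ^ n - n * (m z * us z)) = (real n + 1) * I - n * M"
    unfolding I_def M_def using jac_us
    by (subst Henstock_Kurzweil_Integration.integral_diff)
       (auto intro!: integrable_continuous_real continuous_intros cw cont_coeffs simp: jac_def C1_def)
  ultimately show ?thesis by (simp add: w_ends)
qed

text \<open>The function \<open>w^n \<tau>\<close> vanishes at both ends. By the first integral its
  derivative is \<open>(n - 1) (1 - Q) - Q w^n\<close> plus a nonnegative term. The bound supplies
  the sign needed in \<open>N1_neg_of_V1_pos\<close>.\<close>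

lemma I_ge: "(real n - 1) * (1 - Q) * P \<le> Q * I"
proof -
  have "- (w P ^ n * \<tau> P) - - (w 0 ^ n * \<tau> 0) \<le> integral {0..P} (\<lambda>z. Q * w z ^ n - (real n - 1) * (1 - Q))"
  proof (rule integral_ge_boundary_diff)
    show "continuous_on {0..P} (\<lambda>z. Q * w z ^ n - (real n - 1) * (1 - Q))"
      "continuous_on {0..P} (\<lambda>z. - (w z ^ n * \<tau> z))" by (intro continuous_intros cw c\<tau>)+
    fix z assume z: "0 < z" "z < P"
    then have z': "z \<in> {0..P}" by simp
    have d: "((\<lambda>z. - (w z ^ n * \<tau> z)) has_real_derivative - (n * w z ^ (n - 1) * (\<tau> z / \<phi> z) * \<tau> z + - k1 z * w z ^ n)) (at z)"
      by (intro DERIV_mult DERIV_minus dk1[OF z] dpow[OF z])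
    have "k1 z * w z ^ n = n * Q * w z ^ n - (real n - 1) * (w z ^ (n - 1) * \<phi> z)"
      using nz[OF z'] by (simp add: k1_def k2_def w_pow field_simps)
    also have "\<dots> = Q * w z ^ n - (real n - 1) * (1 - Q)" unfolding first[OF z'] by (simp add: algebra_simps)
    finally have "k1 z * w z ^ n = Q * w z ^ n - (real n - 1) * (1 - Q)" .
    moreover have "0 \<le> n * w z ^ (n - 1) * (\<tau> z / \<phi> z) * \<tau> z"
      using w0[OF z'] \<phi>0[OF z'] \<tau>pos[OF z] by simp
    ultimately show "\<exists>y. ((\<lambda>z. - (w z ^ n * \<tau> z)) has_real_derivative y) (at z) \<and> y \<le> Q * w z ^ n - (real n - 1) * (1 - Q)"
      by - (rule exI, rule conjI[OF d], simp)
  qed (use P0 in auto)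
  moreover have "integral {0..P} (\<lambda>z. Q * w z ^ n - (real n - 1) * (1 - Q)) = Q * I - (real n - 1) * (1 - Q) * P"
    unfolding I_def using P0 integrable_wn
    by (subst Henstock_Kurzweil_Integration.integral_diff) (auto intro!: integrable_continuous_real continuous_intros cw)
  ultimately show ?thesis by (simp add: \<tau>z)
qed

lemma mean_\<tau>_pos: "0 < integral {0..P} (\<lambda>z. m z * \<tau> z)"
proof -
  have "integral {0..P} (\<lambda>z. m z * \<tau> z) = w P ^ n / n - w 0 ^ n / n"
  proof (rule integral_eq_boundary_diff)
    fix z assume z: "0 < z" "z < P"
    show "((\<lambda>z. w z ^ n / n) has_real_derivative m z * \<tau> z) (at z)"
      using DERIV_cdivide[OF dpow(2)[OF z], of "real n"] n2 by (simp add: m_def)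
  qed (use P0 n2 in \<open>auto intro!: continuous_intros cw\<close>)
  then show ?thesis using t0 t1 n2 by (simp add: w_ends power_less_one_iff diff_divide_distrib[symmetric])
qed

end

text \<open>The field \<open>u1\<close> is the normal velocity of the family of profiles normalised to maximal
  radius 1; \<open>Q'\<close> and \<open>P'\<close> are the derivatives of \<open>Q\<close> and of the half period \<open>P\<close> in the family
  parameter.\<close>

locale profile_variation = profile +
  fixes u1 u1' :: "real \<Rightarrow> real" and Q' P' :: real
  assumes jac_u1: "jac (n * Q') u1 u1'"
    and u1_ends: "u1 0 = 1" "u1 P = 0" "u1' 0 = 0" "u1' P = P' * kap"
    and Q'neg: "Q' < 0"
begin

definition "M1 = integral {0..P} (\<lambda>z. m z * u1 z)"
text \<open>Up to positive factors these are V' and \<eta>': \<open>V1\<close> is the mean of the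
  velocity \<open>P u1 - P' us\<close> at fixed height, and \<open>N1\<close> is the derivative of
  \<open>P Q\<close>, to which \<open>eta\<close> is proportional.\<close>

definition "V1 = P * M1 - P' * M"
definition "N1 = P' * Q + P * Q'"

lemma us_ends: "us 0 = t" "us P = 1" "us' 0 = 0" "us' P = kap * P"
  using ends \<tau>z w_ends by (simp_all add: us_def us'_def)

lemma C1s: "C1 u1 u1'" "C1 us us'" "C1 \<tau> (\<lambda>z. - k1 z)"
  using jac_u1 jac_us jac_\<tau> by (auto simp: jac_def)

text \<open>The same bilinear value is computed by integrating by parts with either field. At 0 both
  derivatives vanish, and at \<open>P\<close> only one boundary term survives because
  \<open>u1 P = 0\<close>.\<close>

lemma reciprocity: "kap * P' + n * (Q * M1 + Q' * M) = 0"
proof -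
  have "bil u1 u1' us us' = n * Q' * M + P' * kap"
    using weak_form[OF jac_u1 C1s(2)] us_ends u1_ends ends by (simp add: M_def)
  moreover have "bil us us' u1 u1' = - (n * Q) * M1"
    using weak_form[OF jac_us C1s(1)] us_ends u1_ends ends by (simp add: M1_def)
  ultimately show ?thesis using bil_sym[of u1 u1' us us'] by (simp add: algebra_simps)
qed

text \<open>Eliminating \<open>M1\<close> by reciprocity gives
  \<open>n Q^2 V1 = - N1 E + kap P^2 Q'\<close>. The last term is negative since Q' < 0, so for
  \<open>V1 > 0\<close> the claim reduces to \<open>E > 0\<close>; with \<open>M_eq\<close>,
  \<open>E\<close> is \<open>(n + 1) Q I - (n - 1) (1 - Q) P\<close>, and \<open>I_ge\<close> gives
  its sign.\<close>

lemma N1_neg_of_V1_pos: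
  assumes "0 < V1"
  shows "N1 < 0"
proof -
  define E where "E = n * Q * M + kap * P"
  have "E = Q * ((real n + 1) * I - P) + kap * P" unfolding E_def M_eq[symmetric] by simp
  then have "E = (real n + 1) * (Q * I) - (real n - 1) * (1 - Q) * P"
    by (simp add: kap_def algebra_simps)
  moreover have "0 < (real n - 1) * (1 - Q) * P" using n2 Q1 P0 by simp
  moreover have "(real n + 1) * ((real n - 1) * (1 - Q) * P) \<le> (real n + 1) * (Q * I)"
    by (rule mult_left_mono[OF I_ge]) simp
  moreover have "1 * ((real n - 1) * (1 - Q) * P) < (real n + 1) * ((real n - 1) * (1 - Q) * P)"
    by (rule mult_strict_right_mono) (use calculation n2 in auto)
  ultimately have E: "0 < E" by linarith
  have "n * Q * Q * V1 = Q * P * (n * (Q * M1)) - n * Q * Q * P' * M" by (simp add: V1_def algebra_simps)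
  also have "n * (Q * M1) = - kap * P' - n * Q' * M" using reciprocity by (simp add: algebra_simps)
  finally have "n * Q * Q * V1 = - N1 * E + kap * P * P * Q'"
    by (simp add: N1_def E_def algebra_simps)
  moreover have "0 < n * Q * Q * V1" using n2 Q0 assms by simp
  moreover have "kap * P * P * Q' < 0" using ends(5) P0 Q'neg by (simp add: mult_pos_neg)
  ultimately have "N1 * E < 0" by simp
  then show ?thesis using E by (simp add: mult_less_0_iff)
qed

lemma stable_form:
  assumes u: "C1 u u'" and mean: "integral {0..P} (\<lambda>z. m z * u z) = 0" and V: "0 < V1"
  shows "0 \<le> bil u u' u u'"
proof -
  have N: "N1 < 0" by (rule N1_neg_of_V1_pos[OF V])
  define \<beta> where "\<beta> = u P"
  define \<alpha> where "\<alpha> = u 0 - t * \<beta>"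
  \<comment> \<open>Cramer's rule, with determinant \<open>N1\<close>, for writing
    \<open>\<alpha> u1 + \<beta> us\<close> as
    \<open>\<gamma> (P u1 - P' us) + \<delta> (Q u1 + Q' us)\<close>.\<close>
  define \<gamma> where "\<gamma> = (\<alpha> * Q' - \<beta> * Q) / N1"
  define \<delta> where "\<delta> = (\<beta> * P + \<alpha> * P') / N1"
  have g: "\<gamma> * N1 = \<alpha> * Q' - \<beta> * Q" and d: "\<delta> * N1 = \<beta> * P + \<alpha> * P'" using N by (simp_all add: \<gamma>_def \<delta>_def)
  have "(\<gamma> * P + \<delta> * Q) * N1 = (\<gamma> * N1) * P + (\<delta> * N1) * Q"
    "(- \<gamma> * P' + \<delta> * Q') * N1 = - (\<gamma> * N1) * P' + (\<delta> * N1) * Q'" by (simp_all add: algebra_simps)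
  then have "(\<gamma> * P + \<delta> * Q) * N1 = \<alpha> * N1" "(- \<gamma> * P' + \<delta> * Q') * N1 = \<beta> * N1"
    unfolding g d by (simp_all add: N1_def algebra_simps)
  then have \<alpha>: "\<alpha> = \<gamma> * P + \<delta> * Q" and \<beta>: "\<beta> = - \<gamma> * P' + \<delta> * Q'" using N by auto
  define e where "e z = \<alpha> * u1 z + \<beta> * us z" for z
  define e' where "e' z = \<alpha> * u1' z + \<beta> * us' z" for z
  have je: "jac (\<alpha> * (n * Q') + \<beta> * - (n * Q)) e e'"
    unfolding e_def e'_def by (rule jac_lin[OF jac_u1 jac_us])
  have c: "\<alpha> * (n * Q') + \<beta> * - (n * Q) = n * (\<gamma> * N1)" by (simp add: g algebra_simps)
  define f where "f z = 1 * u z + (-1) * e z" for z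
  define f' where "f' z = 1 * u' z + (-1) * e' z" for z
  have Ce: "C1 e e'" using je by (simp add: jac_def)
  have Cf: "C1 f f'" unfolding f_def f'_def by (rule C1_lin[OF u Ce])
  have f0: "f 0 = 0" "f P = 0"
    by (simp_all add: f_def e_def u1_ends us_ends \<alpha>_def \<beta>_def)
  have me: "integral {0..P} (\<lambda>z. m z * e z) = \<alpha> * M1 + \<beta> * M"
    unfolding e_def M1_def M_def by (rule mean_add[OF C1s(1,2)])
  have mf: "integral {0..P} (\<lambda>z. m z * f z) = - (\<alpha> * M1 + \<beta> * M)"
    unfolding f_def mean_add[OF u Ce] me mean by simp
  have e'P: "e' P = kap * \<delta> * N1" "e' 0 = 0" "e P = \<beta>"
    unfolding mult.assoc d by (simp_all add: e'_def e_def u1_ends us_ends algebra_simps)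
  have ff: "0 \<le> bil f f' f f'"
  proof -
    have "0 \<le> integral {0..P} (\<lambda>z. p z * (f' z)\<^sup>2 - q z * (f z)\<^sup>2)"
    proof (rule dirichlet_form_nonneg[where \<tau> = \<tau> and \<tau>' = "\<lambda>z. - k1 z"])
      show "((\<lambda>z. p z * - k1 z) has_real_derivative - q z * \<tau> z) (at z)" if "0 < z" "z < P" for z
        using jac_\<tau> that by (simp add: jac_def)
    qed (use P0 Cf f0 \<tau>z \<tau>pos ends jac_\<tau> pos_coeffs in \<open>auto intro!: cont_coeffs c\<tau> continuous_intros
          less_imp_le simp: C1_def jac_def\<close>)
    then show ?thesis by (simp add: bil_def power2_eq_square mult.assoc)
  qed
  have ef: "bil e e' f f' = n * (\<gamma> * N1) * - (\<alpha> * M1 + \<beta> * M)"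
    using weak_form[OF je Cf] unfolding c mf f0 by simp
  have ee: "bil e e' e e' = n * (\<gamma> * N1) * (\<alpha> * M1 + \<beta> * M) + kap * \<delta> * N1 * \<beta>"
    using weak_form[OF je Ce] unfolding c me e'P ends by simp
  have "u = (\<lambda>z. e z + f z)" "u' = (\<lambda>z. e' z + f' z)" by (auto simp: f_def f'_def)
  then have "bil u u' u u' = bil e e' e e' + 2 * bil e e' f f' + bil f f' f f'"
    using bil_add[OF Ce Cf] by simp
  also have "\<dots> = bil f f' f f' - \<gamma> * N1 * (n * (\<alpha> * M1 + \<beta> * M)) + kap * \<delta> * N1 * \<beta>"
    unfolding ef ee by (simp add: algebra_simps)
  \<comment> \<open>By reciprocity the mixed part of the mean is \<open>- \<delta> kap P'\<close>;
    it cancels the mixed part of the boundary term \<open>kap \<delta> N1 \<beta>\<close>, which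
    leaves a diagonal form.\<close>
  also have "n * (\<alpha> * M1 + \<beta> * M) = n * \<gamma> * V1 - \<delta> * kap * P'"
  proof -
    have "n * (\<alpha> * M1 + \<beta> * M) = n * \<gamma> * V1 + \<delta> * (n * (Q * M1 + Q' * M))"
      by (simp add: \<alpha> \<beta> V1_def algebra_simps)
    also have "n * (Q * M1 + Q' * M) = - kap * P'" using reciprocity by simp
    finally show ?thesis by simp
  qed
  finally have "bil u u' u u' = bil f f' f f' + n * \<gamma>\<^sup>2 * (- N1 * V1) + kap * \<delta>\<^sup>2 * (N1 * Q')"
    by (simp add: \<beta> algebra_simps power2_eq_square)
  moreover have "0 \<le> - N1 * V1" "0 \<le> N1 * Q'"
    using N V Q'neg by (simp_all add: mult_nonpos_nonneg mult_nonpos_nonpos)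
  note mult_nonneg_nonneg[OF _ this(1), of "n * \<gamma>\<^sup>2"] mult_nonneg_nonneg[OF _ this(2), of "kap * \<delta>\<^sup>2"]
  moreover have "0 \<le> n * \<gamma>\<^sup>2" "0 \<le> kap * \<delta>\<^sup>2" using ends(5) by simp_all
  ultimately show ?thesis using ff by linarith
qed

text \<open>The test direction depends on the sign of \<open>N1\<close>: the velocity at fixed
  height if \<open>N1 < 0\<close>, constants corrected by that velocity if \<open>N1 = 0\<close>,
  the velocity at fixed mean curvature if \<open>N1 > 0\<close>.\<close>

lemma unstable_form:
  assumes V: "V1 < 0"
  shows "\<exists>u u'. C1 u u' \<and> integral {0..P} (\<lambda>z. m z * u z) = 0 \<and> bil u u' u u' < 0"
proof -
  define T1 where "T1 = integral {0..P} (\<lambda>z. m z * \<tau> z)"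
  have T1: "0 < T1" unfolding T1_def by (rule mean_\<tau>_pos)
  \<comment> \<open>A multiple of \<tau> restores mean zero. The form vanishes on \<tau> itself, and
    its pairing with \<open>e\<close> is \<open>c\<close> times the mean of the correction, entering
    twice; this reverses the sign of the mean term and leaves the boundary term alone.\<close>
  have corrected: "\<exists>u u'. C1 u u' \<and> integral {0..P} (\<lambda>z. m z * u z) = 0 \<and>
      bil u u' u u' = - c * integral {0..P} (\<lambda>z. m z * e z) + e' P * e P"
    if je: "jac c e e'" and e0: "e' 0 = 0" for c e e'
  proof -
    have Ce: "C1 e e'" using je by (simp add: jac_def)
    define r where "r = - integral {0..P} (\<lambda>z. m z * e z) / T1"
    define f where "f z = r * \<tau> z" for z
    define f' where "f' z = r * - k1 z" for z
    have jf: "jac 0 f f'" using jac_lin[OF jac_\<tau> jac_\<tau>, of r 0] by (simp add: f_def[abs_def] f'_def[abs_def])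
    then have Cf: "C1 f f'" by (simp add: jac_def)
    have f0: "f 0 = 0" "f P = 0" by (simp_all add: f_def \<tau>z)
    have mf: "integral {0..P} (\<lambda>z. m z * f z) = - integral {0..P} (\<lambda>z. m z * e z)"
      using mean_add[OF C1s(3) C1s(3), of r 0] T1 by (simp add: f_def r_def T1_def)
    have "bil (\<lambda>z. e z + f z) (\<lambda>z. e' z + f' z) (\<lambda>z. e z + f z) (\<lambda>z. e' z + f' z)
        = - c * integral {0..P} (\<lambda>z. m z * e z) + e' P * e P"
      unfolding bil_add[OF Ce Cf] weak_form[OF je Ce] weak_form[OF je Cf] weak_form[OF jf Cf] mf f0 e0 ends by simp
    moreover have "C1 (\<lambda>z. e z + f z) (\<lambda>z. e' z + f' z)" using C1_lin[OF Ce Cf, of 1 1] by simp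
    moreover have "integral {0..P} (\<lambda>z. m z * (e z + f z)) = 0"
      using mean_add[OF Ce Cf, of 1 1] mf by simp
    ultimately show ?thesis by blast
  qed
  define e where "e z = P * u1 z + (- P') * us z" for z
  define e' where "e' z = P * u1' z + (- P') * us' z" for z
  have je: "jac (n * N1) e e'"
    using jac_lin[OF jac_u1 jac_us, of P "- P'"] unfolding e_def[abs_def] e'_def[abs_def]
    by (simp add: N1_def algebra_simps)
  have Ce: "C1 e e'" using je by (simp add: jac_def)
  have me: "integral {0..P} (\<lambda>z. m z * e z) = V1"
    unfolding e_def mean_add[OF C1s(1,2)] V1_def M1_def M_def by simp
  have e'z: "e' 0 = 0" "e' P = 0" by (simp_all add: e'_def u1_ends us_ends)
  consider "N1 < 0" | "N1 = 0" | "N1 > 0" by linarith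
  then show ?thesis
  proof cases
    case 1
    have "- (n * N1) * V1 < 0"
      using 1 V n2 by (simp add: zero_less_mult_iff mult_less_0_iff)
    moreover obtain u u' where "C1 u u'" "integral {0..P} (\<lambda>z. m z * u z) = 0" "bil u u' u u' = - (n * N1) * V1"
      using corrected[OF je e'z(1)] me e'z by auto
    ultimately show ?thesis by (metis (no_types, lifting))
  next
    case 2
    \<comment> \<open>Now \<open>e\<close> solves the homogeneous equation with vanishing conormal
      derivative, so it is orthogonal to everything in the form while its mean \<open>V1\<close> is
      nonzero. Adding a multiple of it to the constant 1 cancels the mean without changing the form,
      which is minus the integral of \<open>q\<close>.\<close>
    define mu where "mu = integral {0..P} (\<lambda>z. m z * 1)"
    define r where "r = - mu / V1"
    have C1c: "C1 (\<lambda>z. 1) (\<lambda>z. 0)" by (auto simp: C1_def)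
    have jf: "jac (n * N1) (\<lambda>z. r * e z) (\<lambda>z. r * e' z)"
      using jac_lin[OF je je, of r 0] 2 by simp
    then have Cf: "C1 (\<lambda>z. r * e z) (\<lambda>z. r * e' z)" by (simp add: jac_def)
    have "bil (\<lambda>z. 1) (\<lambda>z. 0) (\<lambda>z. 1) (\<lambda>z. 0) < 0"
    proof -
      obtain z0 where z0: "z0 \<in> {0..P}" "\<And>z. z \<in> {0..P} \<Longrightarrow> q z0 \<le> q z"
        using continuous_attains_inf[OF compact_Icc _ cont_coeffs(5)] P0 by auto
      have "integral {0..P} (\<lambda>z. q z0) \<le> integral {0..P} q"
        by (rule integral_le) (use z0 in \<open>auto intro!: integrable_continuous_real cont_coeffs\<close>)
      moreover have "0 < P * q z0" using pos_coeffs(3)[OF z0(1)] P0 by simp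
      ultimately show ?thesis using P0 by (simp add: bil_def)
    qed
    moreover have "bil (\<lambda>z. r * e z + 1) (\<lambda>z. r * e' z + 0) (\<lambda>z. r * e z + 1) (\<lambda>z. r * e' z + 0)
       = bil (\<lambda>z. 1) (\<lambda>z. 0) (\<lambda>z. 1) (\<lambda>z. 0)"
      unfolding bil_add[OF Cf C1c] weak_form[OF jf Cf] weak_form[OF jf C1c] e'z 2 by simp
    moreover have "C1 (\<lambda>z. r * e z + 1) (\<lambda>z. r * e' z + 0)" using C1_lin[OF Ce C1c, of r 1] by simp
    moreover have "integral {0..P} (\<lambda>z. m z * (r * e z + 1)) = 0"
      using mean_add[OF Ce C1c, of r 1] me V by (simp add: r_def mu_def)
    ultimately show ?thesis by fastforce
  next
    case 3
    \<comment> \<open>For the velocity at fixed mean curvature only the boundary term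
      \<open>kap N1 Q'\<close> is left.\<close>
    define k where "k z = Q * u1 z + Q' * us z" for z
    define k' where "k' z = Q * u1' z + Q' * us' z" for z
    have jk: "jac 0 k k'"
      using jac_lin[OF jac_u1 jac_us, of Q Q'] unfolding k_def[abs_def] k'_def[abs_def] by (simp add: algebra_simps)
    have "k' P = kap * N1" "k' 0 = 0" "k P = Q'"
      by (simp_all add: k'_def k_def u1_ends us_ends N1_def algebra_simps)
    moreover have "kap * N1 * Q' < 0" using ends(5) 3 Q'neg by (simp add: mult_pos_neg)
    moreover obtain u u' where "C1 u u'" "integral {0..P} (\<lambda>z. m z * u z) = 0" "bil u u' u u' = k' P * k P"
      using corrected[OF jk] calculation by auto
    ultimately show ?thesis by (metis (no_types, lifting))
  qed
qed

text \<open>Translations orthogonal to the axis are Jacobi fields with radial part \<open>\<phi>\<close>, which is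
  positive: this controls all modes orthogonal to the rotationally symmetric one.\<close>

lemma nonradial_form:
  assumes g: "C1 g g'"
  shows "0 \<le> integral {0..P} (\<lambda>z. p z * (g' z)\<^sup>2 + ((real n - 1) * m z / (w z)\<^sup>2 - q z) * (g z)\<^sup>2)"
proof -
  have cg: "continuous_on {0..P} g" "continuous_on {0..P} g'" using g by (auto simp: C1_def)
  \<comment> \<open>This is \<open>p \<phi>' g^2 / \<phi>\<close>, the boundary term of Jacobi's
    substitution with \<phi> in place of \<tau>. It carries the factor \<tau> and so vanishes at
    both ends for arbitrary boundary values of \<open>g\<close>. The n - 1 in the potential is the
    sphere constant of \<open>sphere_poincare\<close>.\<close>
  define \<Phi> where "\<Phi> z = (w z ^ (n - 1) * k1 z * \<tau> z) * ((g z)\<^sup>2 / \<phi> z)" for z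
  have "\<Phi> P - \<Phi> 0 \<le> integral {0..P} (\<lambda>z. p z * (g' z)\<^sup>2 + ((real n - 1) * m z / (w z)\<^sup>2 - q z) * (g z)\<^sup>2)"
  proof (rule integral_ge_boundary_diff)
    show "continuous_on {0..P} \<Phi>"
      unfolding \<Phi>_def by (intro continuous_intros cg cw c\<phi> c\<tau> cont_coeffs ballI nz)
    show "continuous_on {0..P} (\<lambda>z. p z * (g' z)\<^sup>2 + ((real n - 1) * m z / (w z)\<^sup>2 - q z) * (g z)\<^sup>2)"
      by (intro continuous_intros cg cw cont_coeffs ballI) (use nz in auto)
    fix z assume z: "0 < z" "z < P"
    then have z': "z \<in> {0..P}" by simp
    have dg: "(g has_real_derivative g' z) (at z)" using g z by (simp add: C1_def)
    have "((\<lambda>z. (g z)\<^sup>2) has_real_derivative 2 * g z * g' z) (at z)"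
      using DERIV_power[OF dg, of 2] by (simp add: mult_ac)
    then have d: "(\<Phi> has_real_derivative
      (((real n - 1) * (w z ^ (n - 1) / w z) * (\<tau> z / \<phi> z) * k1 z +
         - (real n - 1) * (k1 z - k2 z) * (\<tau> z / \<phi> z) / w z * w z ^ (n - 1)) * \<tau> z + - k1 z * (w z ^ (n - 1) * k1 z)) * ((g z)\<^sup>2 / \<phi> z)
      + (2 * g z * g' z * \<phi> z - (g z)\<^sup>2 * (k1 z * \<tau> z / \<phi> z)) / (\<phi> z * \<phi> z) * (w z ^ (n - 1) * k1 z * \<tau> z)) (at z)"
      unfolding \<Phi>_def[abs_def]
      by (intro DERIV_mult DERIV_divide dpow(1)[OF z] dk1[OF z] nz(2)[OF z'])
    have alg: "(A * f) * (g' - g * (K * s / f) / f)\<^sup>2 =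
       (A * f * g'\<^sup>2 + (N * (A / f) / W\<^sup>2 - A / f * (K\<^sup>2 + N * (f / W)\<^sup>2)) * g\<^sup>2) -
       (((N * (A / W) * (s / f) * K + - N * (K - f / W) * (s / f) / W * A) * s + - K * (A * K)) * (g\<^sup>2 / f)
      + (2 * g * g' * f - g\<^sup>2 * (K * s / f)) / (f * f) * (A * K * s))"
      if nz: "W \<noteq> 0" "f \<noteq> 0" and s2: "s * s = 1 - f * f" for A f g' g K s N W :: real
    proof -
      have 1: "(N * (A / W) * (s / f) * K + - N * (K - f / W) * (s / f) / W * A) * s = N * A / (W * W) * (s * s)"
        using nz by (simp add: field_simps)
      show ?thesis unfolding 1 s2 using nz by (simp add: field_simps power2_eq_square)
    qed
    have "0 \<le> p z * (g' z - g z * (k1 z * \<tau> z / \<phi> z) / \<phi> z)\<^sup>2"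
      using pos_coeffs(1)[OF z'] by simp
    also have "\<dots> = (p z * (g' z)\<^sup>2 + ((real n - 1) * m z / (w z)\<^sup>2 - q z) * (g z)\<^sup>2) -
       ((((real n - 1) * (w z ^ (n - 1) / w z) * (\<tau> z / \<phi> z) * k1 z +
         - (real n - 1) * (k1 z - k2 z) * (\<tau> z / \<phi> z) / w z * w z ^ (n - 1)) * \<tau> z + - k1 z * (w z ^ (n - 1) * k1 z)) * ((g z)\<^sup>2 / \<phi> z)
      + (2 * g z * g' z * \<phi> z - (g z)\<^sup>2 * (k1 z * \<tau> z / \<phi> z)) / (\<phi> z * \<phi> z) * (w z ^ (n - 1) * k1 z * \<tau> z))"
      unfolding p_def q_def m_def k2_def
      by (rule alg) (use nz[OF z'] pyth[OF z'] in \<open>auto simp: power2_eq_square\<close>)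
    finally show "\<exists>y. (\<Phi> has_real_derivative y) (at z) \<and>
        y \<le> p z * (g' z)\<^sup>2 + ((real n - 1) * m z / (w z)\<^sup>2 - q z) * (g z)\<^sup>2"
      using d by (metis (no_types, lifting) le_iff_diff_le_0 diff_ge_0_iff_ge)
  qed (use P0 in auto)
  then show ?thesis by (simp add: \<Phi>_def \<tau>z)
qed

end

section \<open>The profile curve in the angle parameter\<close>

text \<open>Writing \<open>x = (1 + cos \<psi>)/2\<close> removes the end point singularities of \<open>1/R\<close>:
  \<open>R\<^sup>2 = x (1 - x) S\<close> with \<open>S\<close> a positive rational function of \<open>c = cos \<psi>\<close> and \<open>t\<close>, regular
  also at \<open>t = 1\<close>. The radius is \<open>rad c t\<close>, and \<open>sg c t\<close> is the derivative of the height with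
  respect to \<open>\<psi>\<close>.\<close>

definition gsum :: "nat \<Rightarrow> real \<Rightarrow> real" where
  "gsum k t = (\<Sum>i<k. t ^ i)"

text \<open>Q with the common factor 1 - t cancelled, hence regular across t = 1.\<close>

definition QQ :: "nat \<Rightarrow> real \<Rightarrow> real" where
  "QQ n t = gsum (n - 1) t / gsum n t"

text \<open>The cofactor of \<open>(1 - a) (a - t)\<close> in \<open>first_integral_factor\<close>,
  up to \<open>gsum n t\<close>. As a double sum of monomials in \<open>t\<close> and
  \<open>a\<close> it is visibly positive.\<close>

definition TT :: "nat \<Rightarrow> real \<Rightarrow> real \<Rightarrow> real" where
  "TT n a t = (\<Sum>j<n - 1. t ^ j * a ^ j * (\<Sum>i<n - 1 - j. t ^ (n - 1 - j - Suc i) * a ^ i))"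

definition rad :: "real \<Rightarrow> real \<Rightarrow> real" where
  "rad c t = 1 - (1 - t) * ((1 + c) / 2)"

definition DD :: "nat \<Rightarrow> real \<Rightarrow> real \<Rightarrow> real" where
  "DD n q a = 1 - q + q * a ^ n"

definition SS :: "nat \<Rightarrow> real \<Rightarrow> real \<Rightarrow> real" where
  "SS n c t = TT n (rad c t) t * (rad c t ^ (n - 1) + DD n (QQ n t) (rad c t)) /
     (gsum n t * (DD n (QQ n t) (rad c t))\<^sup>2)"

definition sg :: "nat \<Rightarrow> real \<Rightarrow> real \<Rightarrow> real" where
  "sg n c t = 1 / sqrt (SS n c t)"

section \<open>Positivity, and the factorisation of the first integral\<close>

lemma gsum_pos: "0 < t \<Longrightarrow> 0 < k \<Longrightarrow> 0 < gsum k t"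
  unfolding gsum_def by (rule sum_pos) auto

lemma gsum_last: "0 < n \<Longrightarrow> gsum n t = gsum (n - 1) t + t ^ (n - 1)"
  by (cases n) (auto simp: gsum_def)

lemma QQ_bounds:
  assumes "2 \<le> n" "0 < t"
  shows "0 < QQ n t" "QQ n t < 1"
  using gsum_pos[of t n] gsum_pos[of t "n - 1"] gsum_last[of n t] assms
  by (auto simp: QQ_def)

lemma QQ_eq: "2 \<le> n \<Longrightarrow> 0 < t \<Longrightarrow> Qf n t = QQ n t"
proof -
  assume n: "2 \<le> n" and t: "0 < t"
  show ?thesis
  proof (cases "t = 1")
    case True
    then show ?thesis using n by (simp add: Qf_def QQ_def gsum_def of_nat_diff)
  next
    case False
    have "Qf n t = ((1 - t) * gsum (n - 1) t) / ((1 - t) * gsum n t)"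
      using False by (simp add: Qf_def gsum_def one_diff_power_eq)
    then show ?thesis using False by (simp add: QQ_def)
  qed
qed

lemma QQ_ends:
  assumes n: "2 \<le> n" and t: "0 < t" "t < 1"
  shows "real n - 1 < n * QQ n t" "n * QQ n t * t < real n - 1"
proof -
  have g: "0 < gsum n t" using gsum_pos[of t n] n t by simp
  have gl: "gsum n t = gsum (n - 1) t + t ^ (n - 1)" using gsum_last[of n t] n by simp
  have "(real n - 1) * t ^ (n - 1) = (\<Sum>i<n - 1. t ^ (n - 1))" using n by (simp add: of_nat_diff)
  also have "\<dots> < gsum (n - 1) t" unfolding gsum_def
    by (rule sum_strict_mono) (use n t in \<open>auto intro!: power_strict_decreasing simp: lessThan_empty_iff\<close>)
  finally have "(real n - 1) * gsum n t < n * gsum (n - 1) t" by (simp add: gl algebra_simps)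
  then show "real n - 1 < n * QQ n t" using g by (simp add: QQ_def field_simps)
  have shift: "1 + t * gsum (n - 1) t = gsum n t"
    using n by (cases n) (auto simp: gsum_def sum.lessThan_Suc_shift sum_distrib_left simp del: sum.lessThan_Suc)
  have "t * gsum (n - 1) t = (\<Sum>i<n - 1. t ^ Suc i)" by (simp add: gsum_def sum_distrib_left)
  also have "\<dots> < (\<Sum>i<n - 1. 1)"
    by (rule sum_strict_mono) (use n t in \<open>auto simp: power_less_one_iff lessThan_empty_iff simp del: power_Suc\<close>)
  also have "\<dots> = real n - 1" using n by (simp add: of_nat_diff)
  finally have "n * (t * gsum (n - 1) t) < (real n - 1) * gsum n t"
    unfolding shift[symmetric] by (simp add: algebra_simps)
  then show "n * QQ n t * t < real n - 1" using g by (simp add: QQ_def field_simps)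
qed

lemma TT_pos:
  assumes "2 \<le> n" "0 < a" "0 < t"
  shows "0 < TT n a t"
  unfolding TT_def
  by (intro sum_pos mult_pos_pos) (use assms in \<open>auto simp: lessThan_empty_iff\<close>)

lemma rad_pos: "0 < t \<Longrightarrow> - 1 \<le> c \<Longrightarrow> c \<le> 1 \<Longrightarrow> 0 < rad c t"
proof -
  assume t: "0 < t" and c: "- 1 \<le> c" "c \<le> 1"
  have "rad c t = (1 - c) / 2 + t * ((1 + c) / 2)" by (simp add: rad_def field_simps)
  moreover have "0 < (1 - c) / 2 + t * ((1 + c) / 2)"
  proof (cases "c = 1")
    case False
    then have "0 < (1 - c) / 2" using c by simp
    moreover have "0 \<le> t * ((1 + c) / 2)" using t c by simp
    ultimately show ?thesis by (rule add_pos_nonneg)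
  qed (use t in simp)
  ultimately show ?thesis by simp
qed

lemma DD_pos:
  assumes "0 < q" "q < 1" "0 < a"
  shows "0 < DD n q a"
  using assms by (simp add: DD_def add_pos_pos)

lemma SS_pos:
  assumes n: "2 \<le> n" and t: "0 < t" and c: "- 1 \<le> c" "c \<le> 1"
  shows "0 < SS n c t"
proof -
  have "0 < rad c t" "0 < DD n (QQ n t) (rad c t)" "0 < gsum n t" "0 < TT n (rad c t) t"
    using rad_pos[OF t c] DD_pos QQ_bounds[OF n t] gsum_pos[OF t, of n] TT_pos[OF n _ t] n by auto
  then show ?thesis unfolding SS_def by (intro divide_pos_pos mult_pos_pos add_pos_pos) auto
qed

text \<open>The left side vanishes where the profile is parallel to the axis, which the value of Q
  arranges at the radii 1 and t; these two roots are split off. After the factor 1 - a, pairing the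
  monomials of the two geometric sums makes each difference divisible by a - t.\<close>

lemma first_integral_factor:
  assumes n: "2 \<le> n" and g: "gsum n t \<noteq> 0"
  shows "a ^ (n - 1) - DD n (QQ n t) a = (1 - a) * (a - t) * TT n a t / gsum n t"
proof -
  have sum_eq: "gsum (n - 1) t * a ^ (n - 1) - t ^ (n - 1) * gsum (n - 1) a = (a - t) * TT n a t"
  proof -
    have "gsum (n - 1) t * a ^ (n - 1) - t ^ (n - 1) * gsum (n - 1) a =
        (\<Sum>j<n - 1. t ^ j * a ^ (n - 1) - t ^ (n - 1) * a ^ j)"
      by (simp add: gsum_def sum_distrib_left sum_distrib_right sum_subtractf)
    also have "\<dots> = (\<Sum>j<n - 1. (a - t) * (t ^ j * a ^ j * (\<Sum>i<n - 1 - j. t ^ (n - 1 - j - Suc i) * a ^ i)))"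
    proof (rule sum.cong[OF refl])
      fix j assume "j \<in> {..<n - 1}"
      then have j: "n - 1 = j + (n - 1 - j)" by simp
      have "t ^ j * a ^ (n - 1) - t ^ (n - 1) * a ^ j = t ^ j * a ^ j * (a ^ (n - 1 - j) - t ^ (n - 1 - j))"
        by (subst (1 2) j) (simp only: power_add, simp add: algebra_simps)
      also have "a ^ (n - 1 - j) - t ^ (n - 1 - j) = (a - t) * (\<Sum>i<n - 1 - j. t ^ (n - 1 - j - Suc i) * a ^ i)"
        by (rule power_diff_sumr2)
      finally show "t ^ j * a ^ (n - 1) - t ^ (n - 1) * a ^ j =
        (a - t) * (t ^ j * a ^ j * (\<Sum>i<n - 1 - j. t ^ (n - 1 - j - Suc i) * a ^ i))" by (simp only: mult_ac)
    qed
    finally show ?thesis by (simp add: TT_def sum_distrib_left)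
  qed
  have a1: "1 - a ^ n = (1 - a) * gsum n a" "1 - a ^ (n - 1) = (1 - a) * gsum (n - 1) a"
    by (simp_all add: gsum_def one_diff_power_eq)
  have "gsum n t * (a ^ (n - 1) - DD n (QQ n t) a) = gsum (n - 1) t * (1 - a ^ n) - gsum n t * (1 - a ^ (n - 1))"
    using g by (simp add: DD_def QQ_def field_simps)
  also have "\<dots> = (1 - a) * (gsum (n - 1) t * gsum n a - gsum n t * gsum (n - 1) a)"
    unfolding a1 by (simp add: algebra_simps)
  also have "gsum (n - 1) t * gsum n a - gsum n t * gsum (n - 1) a = (a - t) * TT n a t"
    unfolding sum_eq[symmetric] using n by (simp add: gsum_last[of n] algebra_simps)
  finally show ?thesis using g by (simp add: field_simps)
qed

lemma TT_at_1: "2 \<le> n \<Longrightarrow> TT n 1 1 = n * (real n - 1) / 2"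
proof -
  assume n: "2 \<le> n"
  have g: "(\<Sum>i<m. real (Suc i)) = m * (real m + 1) / 2" for m
    by (induction m) (auto simp: field_simps)
  have "TT n 1 1 = (\<Sum>j<n - 1. real (Suc (n - 1 - Suc j)))"
    unfolding TT_def by (rule sum.cong) (auto simp: Suc_diff_Suc)
  also have "\<dots> = (\<Sum>j<n - 1. real (Suc j))"
    by (rule sum.nat_diff_reindex[where g = "\<lambda>j. real (Suc j)"])
  finally show ?thesis unfolding g using n by (simp add: of_nat_diff field_simps)
qed

lemma sq_minus_1_eq:
  assumes n: "2 \<le> n" and t: "0 < t" and c: "- 1 \<le> c" "c \<le> 1"
  shows "(rad c t ^ (n - 1) / DD n (QQ n t) (rad c t))\<^sup>2 - 1 = (1 - t)\<^sup>2 * (((1 + c) / 2) * ((1 - c) / 2) * SS n c t)"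
proof -
  define a where "a = rad c t"
  define D where "D = DD n (QQ n t) a"
  have D: "D \<noteq> 0" using DD_pos QQ_bounds[OF n t] rad_pos[OF t c] unfolding D_def a_def by (metis less_irrefl)
  have g: "gsum n t \<noteq> 0" using gsum_pos[OF t, of n] n by simp
  have "(a ^ (n - 1) / D)\<^sup>2 - 1 = (a ^ (n - 1) - D) * (a ^ (n - 1) + D) / D\<^sup>2"
    using D by (simp add: field_simps power2_eq_square)
  also have "a ^ (n - 1) - D = (1 - a) * (a - t) * TT n a t / gsum n t"
    unfolding D_def by (rule first_integral_factor[OF n g])
  also have "(1 - a) * (a - t) = (1 - t)\<^sup>2 * (((1 + c) / 2) * ((1 - c) / 2))"
    by (simp add: a_def rad_def field_simps power2_eq_square)
  finally show ?thesis unfolding SS_def a_def[symmetric] D_def[symmetric] by (simp add: field_simps)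
qed

lemma Rf_eq:
  assumes n: "2 \<le> n" and t: "0 < t" and x: "0 \<le> x" "x \<le> 1"
  shows "Rf n x t = sqrt (x * (1 - x) * SS n (2 * x - 1) t)"
proof (cases "t = 1")
  case True
  \<comment> \<open>At t = 1 the radius is constantly 1, so \<open>SS\<close> is constant, equal to
    \<open>2 * TT n 1 1 / n\<close>.\<close>
  have "SS n (2 * x - 1) 1 = real n - 1"
    using n by (simp add: SS_def rad_def DD_def TT_at_1 gsum_def)
  then show ?thesis using True by (simp add: Rf_def mult_ac)
next
  case False
  have r: "rad (2 * x - 1) t = 1 - (1 - t) * x" by (simp add: rad_def)
  have e: "(1 + (2 * x - 1)) / 2 = x" "(1 - (2 * x - 1)) / 2 = 1 - x" by (simp_all add: field_simps)
  have "((1 - (1 - t) * x) ^ (n - 1) / (1 - Qf n t + Qf n t * (1 - (1 - t) * x) ^ n)) ^ 2 - 1 =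
     (1 - t)\<^sup>2 * (x * (1 - x) * SS n (2 * x - 1) t)"
    using sq_minus_1_eq[OF n t, of "2 * x - 1"] x unfolding r e QQ_eq[OF n t] by (simp add: DD_def)
  then show ?thesis using False by (simp add: Rf_def real_sqrt_mult)
qed

lemma continuous_SS:
  assumes n: "2 \<le> n" and t: "0 < t" and c: "continuous_on A c" "\<And>x. x \<in> A \<Longrightarrow> - 1 \<le> c x \<and> c x \<le> 1"
  shows "continuous_on A (\<lambda>x. SS n (c x) t)"
proof -
  have "gsum n t \<noteq> 0" using gsum_pos[OF t, of n] n by simp
  moreover have "DD n (QQ n t) (rad (c x) t) \<noteq> 0" if "x \<in> A" for x
    using DD_pos[OF QQ_bounds[OF n t] rad_pos[OF t], of "c x" n] c(2)[OF that] by simp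
  ultimately show ?thesis
    unfolding SS_def TT_def DD_def rad_def by (intro continuous_intros c) auto
qed

lemma sg_pos: "2 \<le> n \<Longrightarrow> 0 < t \<Longrightarrow> - 1 \<le> c \<Longrightarrow> c \<le> 1 \<Longrightarrow> 0 < sg n c t"
  using SS_pos[of n t c] by (simp add: sg_def)

lemma continuous_sg:
  assumes n: "2 \<le> n" and t: "0 < t"
  shows "continuous_on A (\<lambda>x. sg n (cos x) t)"
  unfolding sg_def
proof (intro continuous_intros continuous_SS[OF n t] ballI)
  fix x assume "x \<in> A"
  show "sqrt (SS n (cos x) t) \<noteq> 0" using SS_pos[OF n t, of "cos x"] by simp
qed auto

section \<open>The height as a function of the angle, and its inverse\<close>

definition Th :: "nat \<Rightarrow> real \<Rightarrow> real \<Rightarrow> real" where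
  "Th n t \<psi> = integral {0..\<psi>} (\<lambda>s. sg n (cos s) t)"

lemma continuous_indef: "continuous_on {0..b} f \<Longrightarrow> continuous_on {0..b} (\<lambda>x. integral {0..x} f)"
  for f :: "real \<Rightarrow> real"
  by (intro indefinite_integral_continuous_1 integrable_continuous_real)

lemma DERIV_indef:
  fixes f :: "real \<Rightarrow> real"
  assumes "continuous_on {0..b} f" "0 < x" "x < b"
  shows "((\<lambda>u. integral {0..u} f) has_real_derivative f x) (at x)"
  using integral_has_real_derivative[OF assms(1), of x] assms by (simp add: at_within_Icc_at)

context
  fixes n :: nat and t :: real
  assumes n: "2 \<le> n" and t: "0 < t"
begin

lemma Th_deriv: "0 < \<psi> \<Longrightarrow> \<psi> < pi \<Longrightarrow> (Th n t has_real_derivative sg n (cos \<psi>) t) (at \<psi>)"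
  unfolding Th_def[abs_def] by (rule DERIV_indef[OF continuous_sg[OF n t], of _ pi])

lemma Th_cont: "continuous_on {0..pi} (Th n t)"
  unfolding Th_def[abs_def] by (rule continuous_indef[OF continuous_sg[OF n t]])

lemma Th_0 [simp]: "Th n t 0 = 0" by (simp add: Th_def)

lemma Th_strict: "0 \<le> x \<Longrightarrow> x < y \<Longrightarrow> y \<le> pi \<Longrightarrow> Th n t x < Th n t y"
proof (rule DERIV_pos_imp_increasing_open[of x y "Th n t"])
  assume a: "0 \<le> x" "x < y" "y \<le> pi"
  show "\<exists>D. (Th n t has_real_derivative D) (at z) \<and> 0 < D" if "x < z" "z < y" for z
    using Th_deriv[of z] sg_pos[OF n t, of "cos z"] that a by force
  show "continuous_on {x..y} (Th n t)" by (rule continuous_on_subset[OF Th_cont]) (use a in auto)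
qed

lemma Th_inj: "x \<in> {0..pi} \<Longrightarrow> y \<in> {0..pi} \<Longrightarrow> Th n t x = Th n t y \<Longrightarrow> x = y"
  using Th_strict[of x y] Th_strict[of y x] by (cases x y rule: linorder_cases) auto

text \<open>Substituting \<open>s = (1 + cos \<theta>) / 2\<close> gives the antiderivative
  \<open>- Th n t (arccos (2 * s - 1))\<close>. It is continuous up to the ends, where the integrand
  1/R is singular, and interior differentiability suffices for the Henstock-Kurzweil
  integral.\<close>

lemma zeta_eq:
  assumes \<psi>: "0 \<le> \<psi>" "\<psi> \<le> pi"
  shows "zeta n ((1 + cos \<psi>) / 2) t = Th n t \<psi>"
proof -
  have "integral {(1 + cos \<psi>) / 2..1} (\<lambda>s. 1 / Rf n s t) =
      - Th n t (arccos (2 * 1 - 1)) - - Th n t (arccos (2 * ((1 + cos \<psi>) / 2) - 1))"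
  proof (rule integral_eq_boundary_diff)
    show "(1 + cos \<psi>) / 2 \<le> 1" by simp
    have "0 \<le> 1 + cos \<psi>" using cos_ge_minus_one[of \<psi>] by linarith
    then have c: "0 \<le> (1 + cos \<psi>) / 2" by simp
    have rng: "- 1 \<le> 2 * s - 1 \<and> 2 * s - 1 \<le> 1" if "s \<in> {(1 + cos \<psi>) / 2..1}" for s
      using order_trans[OF c] that by auto
    show "continuous_on {(1 + cos \<psi>) / 2..1} (\<lambda>s. - Th n t (arccos (2 * s - 1)))"
      by (intro continuous_intros continuous_on_compose2[OF Th_cont] continuous_on_compose2[OF continuous_on_arccos'])
         (use rng arccos_lbound arccos_ubound in auto)
    fix s assume s: "(1 + cos \<psi>) / 2 < s" "s < 1"
    then have s0: "0 < s" using c by linarith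
    have r: "- 1 < 2 * s - 1" "2 * s - 1 < 1" using s s0 by auto
    have ac: "0 < arccos (2 * s - 1)" "arccos (2 * s - 1) < pi" using arccos_lt_bounded[OF r] by auto
    have cs: "cos (arccos (2 * s - 1)) = 2 * s - 1" using r by (simp add: cos_arccos)
    have d1: "((\<lambda>s. arccos (2 * s - 1)) has_real_derivative inverse (- sqrt (1 - (2 * s - 1)\<^sup>2)) * 2) (at s)"
      by (rule DERIV_chain2[where f = arccos and g = "\<lambda>s. 2 * s - 1", OF DERIV_arccos[OF r]])
         (auto intro!: derivative_eq_intros)
    have "((\<lambda>s. - Th n t (arccos (2 * s - 1))) has_real_derivative
        - (sg n (2 * s - 1) t * (inverse (- sqrt (1 - (2 * s - 1)\<^sup>2)) * 2))) (at s)"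
      using DERIV_minus[OF DERIV_chain2[OF Th_deriv[OF ac] d1]] by (simp add: cs)
    moreover have "- (sg n (2 * s - 1) t * (inverse (- sqrt (1 - (2 * s - 1)\<^sup>2)) * 2)) = 1 / Rf n s t"
    proof -
      have "1 - (2 * s - 1)\<^sup>2 = 2\<^sup>2 * (s * (1 - s))" by (simp add: power2_eq_square algebra_simps)
      then have "sqrt (1 - (2 * s - 1)\<^sup>2) = 2 * sqrt (s * (1 - s))" by (simp only: real_sqrt_mult real_sqrt_abs)
      moreover have "Rf n s t = sqrt (s * (1 - s)) * sqrt (SS n (2 * s - 1) t)"
        using Rf_eq[OF n t, of s] s s0 by (simp add: real_sqrt_mult)
      ultimately show ?thesis by (simp add: sg_def inverse_eq_divide)
    qed
    ultimately show "((\<lambda>s. - Th n t (arccos (2 * s - 1))) has_real_derivative 1 / Rf n s t) (at s)" by simp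
  qed
  then show ?thesis using \<psi> by (simp add: zeta_def arccos_cos add_divide_distrib)
qed

lemma Pf_eq: "Pf n t = Th n t pi"
  using zeta_eq[of pi] by (simp add: Pf_def)

lemma Pf_pos: "0 < Pf n t"
  using Th_strict[of 0 pi] by (simp add: Pf_eq)

lemma zeta_inv_eq:
  assumes \<psi>: "0 \<le> \<psi>" "\<psi> \<le> pi"
  shows "zeta_inv n (Th n t \<psi>) t = (1 + cos \<psi>) / 2"
  unfolding zeta_inv_def
proof (rule the_equality)
  have "0 \<le> 1 + cos \<psi>" using cos_ge_minus_one[of \<psi>] by linarith
  then show "0 \<le> (1 + cos \<psi>) / 2 \<and> (1 + cos \<psi>) / 2 \<le> 1 \<and> zeta n ((1 + cos \<psi>) / 2) t = Th n t \<psi>"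
    using zeta_eq[OF \<psi>] by simp
  fix x assume x: "0 \<le> x \<and> x \<le> 1 \<and> zeta n x t = Th n t \<psi>"
  define \<theta> where "\<theta> = arccos (2 * x - 1)"
  have \<theta>: "0 \<le> \<theta>" "\<theta> \<le> pi" "cos \<theta> = 2 * x - 1"
    using x by (auto simp: \<theta>_def arccos_lbound arccos_ubound)
  then have "Th n t \<theta> = Th n t \<psi>" using zeta_eq[OF \<theta>(1,2)] x by simp
  then have "\<theta> = \<psi>" using Th_inj \<psi> \<theta> by auto
  then show "x = (1 + cos \<psi>) / 2" using \<theta>(3) by simp
qed

text \<open>The inverse of \<open>Th n t\<close>: the angle at which the height \<open>y\<close> is
  reached.\<close>

definition Psi :: "real \<Rightarrow> real" where
  "Psi y = arccos (2 * zeta_inv n y t - 1)"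

lemma Psi_Th: "0 \<le> \<psi> \<Longrightarrow> \<psi> \<le> pi \<Longrightarrow> Psi (Th n t \<psi>) = \<psi>"
  by (simp add: Psi_def zeta_inv_eq arccos_cos add_divide_distrib)

lemma Th_surj:
  assumes "y \<in> {0..Pf n t}"
  obtains \<psi> where "0 \<le> \<psi>" "\<psi> \<le> pi" "Th n t \<psi> = y"
  using IVT'[of "Th n t" 0 y pi] Th_cont assms by (auto simp: Pf_eq)

lemma Psi_props:
  assumes y: "y \<in> {0..Pf n t}"
  shows "0 \<le> Psi y" "Psi y \<le> pi" "Th n t (Psi y) = y" "zeta_inv n y t = (1 + cos (Psi y)) / 2"
proof -
  obtain \<psi> where "0 \<le> \<psi>" "\<psi> \<le> pi" "Th n t \<psi> = y" using Th_surj[OF y] .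
  then show "0 \<le> Psi y" "Psi y \<le> pi" "Th n t (Psi y) = y" "zeta_inv n y t = (1 + cos (Psi y)) / 2"
    using Psi_Th[of \<psi>] zeta_inv_eq[of \<psi>] by auto
qed

lemma Psi_ends: "Psi 0 = 0" "Psi (Pf n t) = pi"
  using Psi_Th[of 0] Psi_Th[of pi] by (simp_all add: Pf_eq)

lemma Psi_cont: "continuous_on {0..Pf n t} Psi"
proof -
  have "Th n t ` {0..pi} = {0..Pf n t}"
  proof
    show "Th n t ` {0..pi} \<subseteq> {0..Pf n t}"
    proof safe
      fix x assume x: "x \<in> {0..pi}"
      have "0 \<le> Th n t x" using Th_strict[of 0 x] x by (cases "x = 0") auto
      moreover have "Th n t x \<le> Pf n t" using Th_strict[of x pi] x by (cases "x = pi") (auto simp: Pf_eq)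
      ultimately show "Th n t x \<in> {0..Pf n t}" by simp
    qed
    show "{0..Pf n t} \<subseteq> Th n t ` {0..pi}" using Th_surj by (metis atLeastAtMost_iff image_eqI subsetI)
  qed
  then show ?thesis
    using continuous_on_inv[OF Th_cont compact_Icc, of Psi] Psi_Th by auto
qed

lemma Psi_interior:
  assumes "0 < y" "y < Pf n t"
  shows "0 < Psi y" "Psi y < pi"
  using Psi_props[of y] assms by (auto simp: less_le Pf_eq)

lemma Psi_deriv:
  assumes y: "0 < y" "y < Pf n t"
  shows "(Psi has_real_derivative 1 / sg n (cos (Psi y)) t) (at y)"
proof -
  have "(Psi has_real_derivative inverse (sg n (cos (Psi y)) t)) (at y)"
  proof (rule DERIV_inverse_function)
    show "(Th n t has_real_derivative sg n (cos (Psi y)) t) (at (Psi y))"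
      by (rule Th_deriv[OF Psi_interior[OF y]])
    show "sg n (cos (Psi y)) t \<noteq> 0" using sg_pos[OF n t, of "cos (Psi y)"] by simp
    show "isCont Psi y" using continuous_on_interior[OF Psi_cont, of y] y by simp
  qed (use y Psi_props in auto)
  then show ?thesis by (simp add: inverse_eq_divide)
qed

lemma integral_Psi:
  assumes f: "continuous_on {0..pi} f"
  shows "integral {0..Pf n t} (\<lambda>y. f (Psi y)) = integral {0..pi} (\<lambda>\<psi>. f \<psi> * sg n (cos \<psi>) t)"
proof -
  define J where "J x = integral {0..x} (\<lambda>\<psi>. f \<psi> * sg n (cos \<psi>) t)" for x
  have c: "continuous_on {0..pi} (\<lambda>\<psi>. f \<psi> * sg n (cos \<psi>) t)"
    by (intro continuous_intros f continuous_sg[OF n t])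
  have "integral {0..Pf n t} (\<lambda>y. f (Psi y)) = J (Psi (Pf n t)) - J (Psi 0)"
  proof (rule integral_eq_boundary_diff)
    show "continuous_on {0..Pf n t} (\<lambda>y. J (Psi y))"
      unfolding J_def
      by (intro continuous_on_compose2[OF continuous_indef[OF c] Psi_cont]) (use Psi_props in auto)
    fix y assume y: "0 < y" "y < Pf n t"
    have "((\<lambda>y. J (Psi y)) has_real_derivative f (Psi y) * sg n (cos (Psi y)) t * (1 / sg n (cos (Psi y)) t)) (at y)"
      by (rule DERIV_chain2[OF _ Psi_deriv[OF y]])
         (unfold J_def, rule DERIV_indef[OF c Psi_interior[OF y]])
    then show "((\<lambda>y. J (Psi y)) has_real_derivative f (Psi y)) (at y)"
      using sg_pos[OF n t, of "cos (Psi y)"] by simp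
  qed (use Pf_pos in auto)
  then show ?thesis by (simp add: Psi_ends J_def)
qed

lemma vprof_eq:
  assumes "0 < d" "z \<in> {0..d}"
  shows "vprof n d t z = d / Pf n t * rad (cos (Psi (Pf n t * z / d))) t"
proof -
  have "Pf n t * z / d \<in> {0..Pf n t}" using assms Pf_pos by (auto simp: field_simps mult_left_mono)
  from Psi_props(4)[OF this] show ?thesis by (simp add: vprof_def rad_def)
qed

lemma Vol_eq:
  assumes d: "0 < d"
  shows "Vol n d t = unit_ball_vol n * (d / Pf n t) ^ (n + 1) * integral {0..pi} (\<lambda>\<psi>. rad (cos \<psi>) t ^ n * sg n (cos \<psi>) t)"
proof -
  define P where "P = Pf n t"
  have P: "0 < P" using Pf_pos by (simp add: P_def)
  define f where "f y = rad (cos (Psi y)) t ^ n" for y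
  have "continuous_on {0..P} f" unfolding f_def rad_def P_def by (intro continuous_intros Psi_cont) simp
  then have "(f has_integral integral {0..P} f) (cbox 0 P)"
    by (simp add: integrable_integral integrable_continuous_real)
  from has_integral_affinity[OF this, of "P / d" 0]
  have "((\<lambda>z. f (P / d * z)) has_integral (d / P) * integral {0..P} f) ((\<lambda>x. d / P * x) ` {0..P})"
    using P d by (simp add: image_affinity_atLeastAtMost)
  moreover have "(\<lambda>x. d / P * x) ` {0..P} = {0..d}"
    using P d image_affinity_atLeastAtMost[of "d / P" 0 0 P] by simp
  ultimately have h: "((\<lambda>z. (d / P) ^ n * f (P / d * z)) has_integral (d / P) ^ n * ((d / P) * integral {0..P} f)) {0..d}"
    by (intro has_integral_mult_right) simp
  have "integral {0..d} (\<lambda>z. vprof n d t z ^ n) = integral {0..d} (\<lambda>z. (d / P) ^ n * f (P / d * z))"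
    by (rule integral_cong) (use vprof_eq[OF d] in \<open>simp add: f_def P_def power_mult_distrib power_divide\<close>)
  also have "\<dots> = (d / P) ^ (n + 1) * integral {0..P} f" using integral_unique[OF h] by simp
  also have "integral {0..P} f = integral {0..pi} (\<lambda>\<psi>. rad (cos \<psi>) t ^ n * sg n (cos \<psi>) t)"
    unfolding P_def f_def
    by (rule integral_Psi) (auto simp: rad_def intro!: continuous_intros)
  finally show ?thesis by (simp add: Vol_def P_def)
qed

end

section \<open>Dependence on the family parameter\<close>

text \<open>The regularity needed to differentiate under the angular integral, packaged as a class
  closed under arithmetic and square roots, so that \<open>sg\<close> is covered without an explicit
  derivative.\<close>

definition Dt_via :: "(real \<Rightarrow> real \<Rightarrow> real) \<Rightarrow> (real \<Rightarrow> real \<Rightarrow> real) \<Rightarrow> bool" where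
  "Dt_via f f' \<longleftrightarrow> (\<forall>c t. - 1 \<le> c \<longrightarrow> c \<le> 1 \<longrightarrow> 0 < t \<longrightarrow> ((\<lambda>t. f c t) has_real_derivative f' c t) (at t)) \<and>
    continuous_on ({- 1..1} \<times> {0<..}) (\<lambda>p. f (fst p) (snd p)) \<and>
    continuous_on ({- 1..1} \<times> {0<..}) (\<lambda>p. f' (fst p) (snd p))"

definition Dt :: "(real \<Rightarrow> real \<Rightarrow> real) \<Rightarrow> bool" where
  "Dt f \<longleftrightarrow> (\<exists>f'. Dt_via f f')"

lemma DtI: "Dt_via f f' \<Longrightarrow> Dt f" by (auto simp: Dt_def)

lemma Dt_basic: "Dt (\<lambda>c t. k)" "Dt (\<lambda>c t. c)" "Dt (\<lambda>c t. t)"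
proof -
  show "Dt (\<lambda>c t. k)" by (rule DtI[where f' = "\<lambda>c t. 0"]) (simp add: Dt_via_def)
  show "Dt (\<lambda>c t. c)"
    by (rule DtI[where f' = "\<lambda>c t. 0"]) (simp add: Dt_via_def continuous_on_fst[OF continuous_on_id])
  show "Dt (\<lambda>c t. t)"
    by (rule DtI[where f' = "\<lambda>c t. 1"]) (simp add: Dt_via_def continuous_on_snd[OF continuous_on_id])
qed

lemma Dt_add: "Dt f \<Longrightarrow> Dt g \<Longrightarrow> Dt (\<lambda>c t. f c t + g c t)"
proof -
  assume "Dt f" "Dt g"
  then obtain f' g' where "Dt_via f f'" "Dt_via g g'" by (auto simp: Dt_def)
  then show ?thesis
    by (intro DtI[where f' = "\<lambda>c t. f' c t + g' c t"]) (auto simp: Dt_via_def intro!: continuous_intros derivative_intros)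
qed

lemma Dt_mult: "Dt f \<Longrightarrow> Dt g \<Longrightarrow> Dt (\<lambda>c t. f c t * g c t)"
proof -
  assume "Dt f" "Dt g"
  then obtain f' g' where "Dt_via f f'" "Dt_via g g'" by (auto simp: Dt_def)
  then show ?thesis
    by (intro DtI[where f' = "\<lambda>c t. f' c t * g c t + g' c t * f c t"])
       (auto simp: Dt_via_def intro!: continuous_intros DERIV_mult)
qed

lemma Dt_diff: "Dt f \<Longrightarrow> Dt g \<Longrightarrow> Dt (\<lambda>c t. f c t - g c t)"
  using Dt_add[of f "\<lambda>c t. (- 1) * g c t"] Dt_mult[OF Dt_basic(1)[of "- 1"], of g] by simp

lemma Dt_power: "Dt f \<Longrightarrow> Dt (\<lambda>c t. f c t ^ k)"
  by (induction k) (auto intro: Dt_basic Dt_mult)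

lemma Dt_sum: "(\<And>i. i \<in> A \<Longrightarrow> Dt (f i)) \<Longrightarrow> Dt (\<lambda>c t. \<Sum>i\<in>A. f i c t)"
  by (induction A rule: infinite_finite_induct) (auto intro: Dt_basic Dt_add)

lemma Dt_divide:
  assumes "Dt f" "Dt g" and nz: "\<And>c t. - 1 \<le> c \<Longrightarrow> c \<le> 1 \<Longrightarrow> 0 < t \<Longrightarrow> g c t \<noteq> 0"
  shows "Dt (\<lambda>c t. f c t / g c t)"
proof -
  obtain f' g' where "Dt_via f f'" "Dt_via g g'" using assms by (auto simp: Dt_def)
  then show ?thesis
    by (intro DtI[where f' = "\<lambda>c t. (f' c t * g c t - f c t * g' c t) / (g c t * g c t)"])
       (use nz in \<open>auto simp: Dt_via_def intro!: continuous_intros DERIV_divide\<close>)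
qed

lemma Dt_sqrt:
  assumes "Dt f" and pos: "\<And>c t. - 1 \<le> c \<Longrightarrow> c \<le> 1 \<Longrightarrow> 0 < t \<Longrightarrow> 0 < f c t"
  shows "Dt (\<lambda>c t. sqrt (f c t))"
proof -
  obtain f' where f': "Dt_via f f'" using assms by (auto simp: Dt_def)
  have ne: "sqrt (f c t) \<noteq> 0" if "- 1 \<le> c" "c \<le> 1" "0 < t" for c t using pos[OF that] by simp
  show ?thesis
  proof (rule DtI[where f' = "\<lambda>c t. inverse (sqrt (f c t)) / 2 * f' c t"], unfold Dt_via_def, intro conjI allI impI)
    fix c t :: real assume a: "- 1 \<le> c" "c \<le> 1" "0 < t"
    show "((\<lambda>t. sqrt (f c t)) has_real_derivative inverse (sqrt (f c t)) / 2 * f' c t) (at t)"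
      by (rule DERIV_chain2[where f = sqrt and g = "\<lambda>t. f c t", OF DERIV_real_sqrt[OF pos[OF a]]]) (use f' a in \<open>auto simp: Dt_via_def\<close>)
  qed (use f' ne in \<open>auto simp: Dt_via_def intro!: continuous_intros\<close>)
qed

lemma Dt_gsum: "Dt (\<lambda>c. gsum k)"
  unfolding gsum_def[abs_def] by (intro Dt_sum Dt_power Dt_basic)

lemma Dt_QQ: "2 \<le> n \<Longrightarrow> Dt (\<lambda>c. QQ n)"
  unfolding QQ_def[abs_def] by (intro Dt_divide Dt_gsum) (use gsum_pos[of _ n] in force)

lemma Dt_rad: "Dt rad"
proof -
  have "Dt (\<lambda>c t. 1 - (1 - t) * ((1 + c) * (1 / 2)))"
    by (intro Dt_diff Dt_mult Dt_add Dt_basic)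
  then show ?thesis by (simp add: rad_def[abs_def])
qed

lemma Dt_DD: "2 \<le> n \<Longrightarrow> Dt (\<lambda>c t. DD n (QQ n t) (rad c t))"
  unfolding DD_def by (intro Dt_diff Dt_mult Dt_add Dt_basic Dt_power Dt_rad Dt_QQ)

lemma Dt_sg:
  assumes n: "2 \<le> n"
  shows "Dt (sg n)"
proof -
  have "Dt (\<lambda>c t. TT n (rad c t) t)"
    unfolding TT_def by (intro Dt_sum Dt_mult Dt_power Dt_rad Dt_basic)
  moreover have "gsum n t * (DD n (QQ n t) (rad c t))\<^sup>2 \<noteq> 0" if "- 1 \<le> c" "c \<le> 1" "0 < t" for c t
    using gsum_pos[of t n] n that DD_pos[OF QQ_bounds[OF n that(3)] rad_pos[OF that(3,1,2)], of n] by simp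
  ultimately have "Dt (SS n)"
    unfolding SS_def[abs_def]
    by (intro Dt_divide Dt_mult Dt_add Dt_power Dt_rad Dt_gsum Dt_DD[OF n]) auto
  then have "Dt (\<lambda>c t. 1 / sqrt (SS n c t))"
    by (intro Dt_divide Dt_basic Dt_sqrt SS_pos[OF n]) (auto dest: SS_pos[OF n])
  then show ?thesis by (simp add: sg_def[abs_def])
qed

text \<open>Some t-derivative of \<open>sg\<close>. Only its existence and continuity matter; its
  relation to the geometry comes later by differentiating an identity in which \<open>sg\<close>
  occurs.\<close>

definition sgt :: "nat \<Rightarrow> real \<Rightarrow> real \<Rightarrow> real" where
  "sgt n = (SOME f'. Dt_via (sg n) f')"

lemma sgt:
  assumes n: "2 \<le> n"
  shows "- 1 \<le> c \<Longrightarrow> c \<le> 1 \<Longrightarrow> 0 < t \<Longrightarrow> ((\<lambda>t. sg n c t) has_real_derivative sgt n c t) (at t)"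
    and "continuous_on ({- 1..1} \<times> {0<..}) (\<lambda>p. sg n (fst p) (snd p))"
    and "continuous_on ({- 1..1} \<times> {0<..}) (\<lambda>p. sgt n (fst p) (snd p))"
proof -
  have "Dt_via (sg n) (sgt n)"
    using Dt_sg[OF n] unfolding sgt_def Dt_def by (rule someI_ex)
  then show "- 1 \<le> c \<Longrightarrow> c \<le> 1 \<Longrightarrow> 0 < t \<Longrightarrow> ((\<lambda>t. sg n c t) has_real_derivative sgt n c t) (at t)"
    and "continuous_on ({- 1..1} \<times> {0<..}) (\<lambda>p. sg n (fst p) (snd p))"
    and "continuous_on ({- 1..1} \<times> {0<..}) (\<lambda>p. sgt n (fst p) (snd p))"
    by (auto simp: Dt_via_def)
qed

lemma continuous_sgt:
  assumes "2 \<le> n" "0 < t"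
  shows "continuous_on A (\<lambda>x. sgt n (cos x) t)"
proof -
  have "continuous_on A (\<lambda>x. (cos x, t))" by (intro continuous_intros)
  moreover have "(\<lambda>x. (cos x, t)) ` A \<subseteq> {- 1..1} \<times> {0<..}" using assms by auto
  ultimately show ?thesis using continuous_on_compose2[OF sgt(3)[OF assms(1)]] by fastforce
qed

text \<open>The exponent is free so that \<open>k = 0\<close> yields the height and
  \<open>k = n\<close> the volume.\<close>

lemma leibniz_angle:
  assumes n: "2 \<le> n" and t: "0 < t"
  shows "((\<lambda>t. integral {0..pi} (\<lambda>\<psi>. rad (cos \<psi>) t ^ k * sg n (cos \<psi>) t)) has_real_derivative
    integral {0..pi} (\<lambda>\<psi>. k * rad (cos \<psi>) t ^ (k - 1) * ((1 + cos \<psi>) / 2) * sg n (cos \<psi>) t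
      + rad (cos \<psi>) t ^ k * sgt n (cos \<psi>) t)) (at t)"
proof -
  let ?f = "\<lambda>t \<psi>. rad (cos \<psi>) t ^ k * sg n (cos \<psi>) t"
  let ?f' = "\<lambda>t \<psi>. k * rad (cos \<psi>) t ^ (k - 1) * ((1 + cos \<psi>) / 2) * sg n (cos \<psi>) t
      + rad (cos \<psi>) t ^ k * sgt n (cos \<psi>) t"
  have drad: "((\<lambda>t. rad c t) has_real_derivative (1 + c) / 2) (at t)" for c t
    unfolding rad_def by (auto intro!: derivative_eq_intros simp: field_simps)
  have "((\<lambda>t. integral (cbox 0 pi) (?f t)) has_real_derivative integral (cbox 0 pi) (?f' t)) (at t within {0<..})"
  proof (rule leibniz_rule_field_derivative)
    fix t \<psi> :: real assume "t \<in> {0<..}" "\<psi> \<in> cbox 0 pi"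
    then have t: "0 < t" by simp
    have "((\<lambda>t. rad (cos \<psi>) t ^ k) has_real_derivative k * rad (cos \<psi>) t ^ (k - 1) * ((1 + cos \<psi>) / 2)) (at t)"
      using DERIV_power[OF drad[of "cos \<psi>" t], of k] by (simp add: mult_ac)
    from DERIV_mult[OF this sgt(1)[OF n _ _ t, of "cos \<psi>"]]
    have "((\<lambda>t. ?f t \<psi>) has_real_derivative ?f' t \<psi>) (at t)"
      by (simp only: mult.commute[of "sgt n (cos \<psi>) t"]) simp
    then show "((\<lambda>t. ?f t \<psi>) has_real_derivative ?f' t \<psi>) (at t within {0<..})"
      by (rule has_field_derivative_at_within)
  next
    fix t :: real assume "t \<in> {0<..}"
    then show "?f t integrable_on cbox 0 pi"
      by (intro integrable_continuous continuous_intros continuous_sg n) (auto simp: rad_def intro!: continuous_intros)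
  next
    have c1: "continuous_on ({0<..} \<times> cbox 0 pi) (\<lambda>x::real \<times> real. (cos (snd x), fst x))"
      by (intro continuous_intros)
    have sub: "(\<lambda>x::real \<times> real. (cos (snd x), fst x)) ` ({0<..} \<times> cbox 0 pi) \<subseteq> {- 1..1} \<times> {0<..}" by auto
    have c2: "continuous_on ({0<..} \<times> cbox 0 pi) (\<lambda>x::real \<times> real. sg n (cos (snd x)) (fst x))"
      using continuous_on_compose2[OF sgt(2)[OF n] c1 sub] by simp
    have c3: "continuous_on ({0<..} \<times> cbox 0 pi) (\<lambda>x::real \<times> real. sgt n (cos (snd x)) (fst x))"
      using continuous_on_compose2[OF sgt(3)[OF n] c1 sub] by simp
    show "continuous_on ({0<..} \<times> cbox 0 pi) (\<lambda>(t, \<psi>). ?f' t \<psi>)"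
      unfolding split_beta' rad_def by (intro continuous_intros c2 c3) auto
  qed (use t in auto)
  then show ?thesis using t by (simp add: at_within_open[of _ "{0<..}"])
qed

definition Pd :: "nat \<Rightarrow> real \<Rightarrow> real" where
  "Pd n t = integral {0..pi} (\<lambda>\<psi>. sgt n (cos \<psi>) t)"

definition II :: "nat \<Rightarrow> real \<Rightarrow> real" where
  "II n t = integral {0..pi} (\<lambda>\<psi>. rad (cos \<psi>) t ^ n * sg n (cos \<psi>) t)"

definition Ider :: "nat \<Rightarrow> real \<Rightarrow> real" where
  "Ider n t = integral {0..pi} (\<lambda>\<psi>. n * rad (cos \<psi>) t ^ (n - 1) * ((1 + cos \<psi>) / 2) * sg n (cos \<psi>) t
      + rad (cos \<psi>) t ^ n * sgt n (cos \<psi>) t)"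

lemma Pf_deriv:
  assumes n: "2 \<le> n" and t: "0 < t"
  shows "(Pf n has_real_derivative Pd n t) (at t)"
proof -
  have "((\<lambda>t. integral {0..pi} (\<lambda>\<psi>. sg n (cos \<psi>) t)) has_real_derivative Pd n t) (at t)"
    using leibniz_angle[OF n t, of 0] by (simp add: Pd_def)
  then show ?thesis
    by (rule has_field_derivative_transform_within_open[of _ _ _ "{0<..}"])
       (use t n in \<open>auto simp: Pf_eq Th_def\<close>)
qed

lemma II_deriv: "2 \<le> n \<Longrightarrow> 0 < t \<Longrightarrow> (II n has_real_derivative Ider n t) (at t)"
  unfolding II_def[abs_def] Ider_def by (rule leibniz_angle)

lemma Vol_deriv:
  assumes n: "2 \<le> n" and t: "0 < t" and d: "0 < d"
  shows "(Vol n d has_real_derivative unit_ball_vol n * d ^ (n + 1) *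
     ((Ider n t * Pf n t - (real n + 1) * II n t * Pd n t) / Pf n t ^ (n + 2))) (at t)"
proof -
  have P: "0 < Pf n t" by (rule Pf_pos[OF n t])
  have dP: "((\<lambda>t. Pf n t ^ (n + 1)) has_real_derivative (real n + 1) * Pf n t ^ n * Pd n t) (at t)"
    using DERIV_power[OF Pf_deriv[OF n t], of "n + 1"] by (simp add: mult_ac add_ac)
  have "((\<lambda>t. unit_ball_vol n * d ^ (n + 1) * (II n t / Pf n t ^ (n + 1))) has_real_derivative
     unit_ball_vol n * d ^ (n + 1) * ((Ider n t * Pf n t ^ (n + 1) - II n t * ((real n + 1) * Pf n t ^ n * Pd n t)) /
       (Pf n t ^ (n + 1) * Pf n t ^ (n + 1)))) (at t)"
    by (intro DERIV_cmult DERIV_divide II_deriv dP n t) (use P in simp)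
  moreover have "(Ider n t * Pf n t ^ (n + 1) - II n t * ((real n + 1) * Pf n t ^ n * Pd n t)) /
       (Pf n t ^ (n + 1) * Pf n t ^ (n + 1)) = (Ider n t * Pf n t - (real n + 1) * II n t * Pd n t) / Pf n t ^ (n + 2)"
    using P by (simp add: field_simps)
  ultimately have "((\<lambda>t. unit_ball_vol n * d ^ (n + 1) * (II n t / Pf n t ^ (n + 1))) has_real_derivative
     unit_ball_vol n * d ^ (n + 1) * ((Ider n t * Pf n t - (real n + 1) * II n t * Pd n t) / Pf n t ^ (n + 2))) (at t)"
    by (simp only:)
  then show ?thesis
  proof (rule has_field_derivative_transform_within_open[of _ _ _ "{0<..}"])
    fix s :: real assume "s \<in> {0<..}"
    then show "unit_ball_vol n * d ^ (n + 1) * (II n s / Pf n s ^ (n + 1)) = Vol n d s"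
      unfolding II_def using Vol_eq[OF n _ d, of s] by (simp add: power_divide)
  qed (use t in auto)
qed

subsection \<open>The reflection symmetry\<close>

lemma integral_cos_reflect:
  fixes f :: "real \<Rightarrow> real"
  shows "integral {0..pi} (\<lambda>\<psi>. f (- cos \<psi>)) = integral {0..pi} (\<lambda>\<psi>. f (cos \<psi>))"
proof -
  have "integral {0..pi} (\<lambda>\<psi>. f (- cos \<psi>)) = integral {- pi..- 0} (\<lambda>x. f (- cos (- x)))"
    using Henstock_Kurzweil_Integration.integral_reflect_real[of pi 0 "\<lambda>\<psi>. f (- cos \<psi>)"] by simp
  also have "\<dots> = integral {0 - pi..pi - pi} (\<lambda>x. f (cos (x + pi)))" by simp
  also have "\<dots> = integral {0..pi} (\<lambda>\<psi>. f (cos \<psi>))"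
    by (rule integral_shift_real_ivl[where f = "\<lambda>x. f (cos x)"])
  finally show ?thesis .
qed

text \<open>Passing from t to 1/t exchanges neck and bulge and rescales by 1/t; in the angle this is
  \<open>c\<close> to \<open>- c\<close>. By Q(1/t) = t Q(t) the slope is unchanged, and the two
  forms of \<open>sq_minus_1_eq\<close> are compared. For this the factor
  \<open>(1 + c) (1 - c)\<close> must not vanish; the excluded end points are a null set in
  \<open>Vol_reflect\<close>.\<close>

lemma sg_reflect:
  assumes n: "2 \<le> n" and t: "0 < t" and c: "- 1 < c" "c < 1"
  shows "sg n c (1 / t) = sg n (- c) t / t" and "rad c (1 / t) = rad (- c) t / t"
proof -
  show r: "rad c (1 / t) = rad (- c) t / t" using t by (simp add: rad_def field_simps)
  have Sr: "SS n c (1 / t) = t\<^sup>2 * SS n (- c) t"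
  proof (cases "t = 1")
    case True
    have "SS n c 1 = SS n (- c) 1" by (simp add: SS_def rad_def)
    then show ?thesis using True by simp
  next
    case False
    have qeq: "QQ n s * (1 - s ^ n) = 1 - s ^ (n - 1)" if "0 < s" for s
      using gsum_pos[OF that, of n] n by (simp add: QQ_def gsum_def one_diff_power_eq)
    have tn: "t ^ n = t * t ^ (n - 1)" using n by (cases n) auto
    have t1: "t ^ n \<noteq> 1" using power_eq_imp_eq_base[of t n 1] False t n by auto
    have q: "QQ n (1 / t) = t * QQ n t"
    proof -
      have "QQ n (1 / t) * (t ^ n - 1) = t * (t ^ (n - 1) - 1)"
      proof -
        define T where "T = t ^ (n - 1)"
        have "QQ n (1 / t) * (t ^ n - 1) = (QQ n (1 / t) * (1 - (1 / t) ^ n)) * t ^ n"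
          using t by (simp add: field_simps)
        also have "\<dots> = (1 - (1 / t) ^ (n - 1)) * t ^ n" using qeq[of "1 / t"] t by simp
        also have "\<dots> = t * (T - 1)" unfolding tn T_def using t by (simp add: power_one_over field_simps)
        finally show ?thesis by (simp add: T_def)
      qed
      also have "\<dots> = - t * (QQ n t * (1 - t ^ n))" unfolding qeq[OF t] by (simp add: algebra_simps)
      also have "\<dots> = t * QQ n t * (t ^ n - 1)" by (simp add: algebra_simps)
      finally show ?thesis using t1 by simp
    qed
    define a where "a = rad (- c) t"
    have a: "0 < a" unfolding a_def by (rule rad_pos[OF t]) (use c in auto)
    have "t ^ (n - 1) * DD n (t * QQ n t) (a / t) = DD n (QQ n t) a"
    proof -
      have "t ^ (n - 1) * DD n (t * QQ n t) (a / t) = t ^ (n - 1) - t ^ n * QQ n t + QQ n t * a ^ n * (t ^ n / t ^ n)"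
        by (simp add: DD_def tn power_divide algebra_simps)
      also have "t ^ (n - 1) - t ^ n * QQ n t = 1 - QQ n t" using qeq[OF t] by (simp add: algebra_simps)
      finally show ?thesis using t by (simp add: DD_def)
    qed
    then have "(a / t) ^ (n - 1) / DD n (t * QQ n t) (a / t) = a ^ (n - 1) / DD n (QQ n t) a"
      using t by (metis (no_types, lifting) divide_divide_eq_left power_divide)
    then have "(rad c (1 / t) ^ (n - 1) / DD n (QQ n (1 / t)) (rad c (1 / t)))\<^sup>2 - 1 =
        (rad (- c) t ^ (n - 1) / DD n (QQ n t) (rad (- c) t))\<^sup>2 - 1"
      unfolding r q a_def by simp
    then have "(1 - 1 / t)\<^sup>2 * (((1 + c) / 2) * ((1 - c) / 2) * SS n c (1 / t)) =
        (1 - t)\<^sup>2 * (((1 + - c) / 2) * ((1 - - c) / 2) * SS n (- c) t)"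
      using sq_minus_1_eq[OF n, of "1 / t" c] sq_minus_1_eq[OF n t, of "- c"] t c by simp
    moreover have "(1 - t)\<^sup>2 = t\<^sup>2 * (1 - 1 / t)\<^sup>2" using t by (simp add: field_simps power2_eq_square)
    moreover have "(1 - 1 / t)\<^sup>2 \<noteq> 0" "(1 + c) / 2 \<noteq> 0" "(1 - c) / 2 \<noteq> 0" using False t c by auto
    ultimately show ?thesis using False t by (auto simp: mult_ac)
  qed
  show "sg n c (1 / t) = sg n (- c) t / t"
    unfolding sg_def Sr using t by (simp add: real_sqrt_mult)
qed

lemma Vol_reflect:
  assumes n: "2 \<le> n" and t: "0 < t" and d: "0 < d"
  shows "Vol n d (1 / t) = Vol n d t"
proof -
  have key: "integral {0..pi} (\<lambda>\<psi>. rad (cos \<psi>) (1 / t) ^ k * sg n (cos \<psi>) (1 / t)) =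
      integral {0..pi} (\<lambda>\<psi>. rad (cos \<psi>) t ^ k * sg n (cos \<psi>) t) / t ^ (k + 1)" for k
  proof -
    have "integral {0..pi} (\<lambda>\<psi>. rad (cos \<psi>) (1 / t) ^ k * sg n (cos \<psi>) (1 / t)) =
       integral {0..pi} (\<lambda>\<psi>. (rad (- cos \<psi>) t ^ k * sg n (- cos \<psi>) t) / t ^ (k + 1))"
    proof (rule integral_spike[of "{0, pi}"])
      fix x assume x: "x \<in> {0..pi} - {0, pi}"
      then have "- 1 < cos x" "cos x < 1"
        using cos_monotone_0_pi[of 0 x] cos_monotone_0_pi[of x pi] by auto
      from sg_reflect[OF n t this]
      show "rad (- cos x) t ^ k * sg n (- cos x) t / t ^ (k + 1) = rad (cos x) (1 / t) ^ k * sg n (cos x) (1 / t)"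
        by (simp add: power_divide)
    qed auto
    also have "\<dots> = integral {0..pi} (\<lambda>\<psi>. rad (- cos \<psi>) t ^ k * sg n (- cos \<psi>) t) / t ^ (k + 1)"
      by simp
    also have "integral {0..pi} (\<lambda>\<psi>. rad (- cos \<psi>) t ^ k * sg n (- cos \<psi>) t) =
        integral {0..pi} (\<lambda>\<psi>. rad (cos \<psi>) t ^ k * sg n (cos \<psi>) t)"
      by (rule integral_cos_reflect[where f = "\<lambda>c. rad c t ^ k * sg n c t"])
    finally show ?thesis .
  qed
  have "Pf n (1 / t) = Pf n t / t"
    using key[of 0] t n by (simp add: Pf_eq Th_def)
  then have "d / Pf n (1 / t) = t * (d / Pf n t)" using t by simp
  then have "(d / Pf n (1 / t)) ^ (n + 1) = t ^ (n + 1) * (d / Pf n t) ^ (n + 1)"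
    by (simp only: power_mult_distrib)
  then have "Vol n d (1 / t) = unit_ball_vol n * (t ^ (n + 1) * (d / Pf n t) ^ (n + 1)) *
      (integral {0..pi} (\<lambda>\<psi>. rad (cos \<psi>) t ^ n * sg n (cos \<psi>) t) / t ^ (n + 1))"
    using Vol_eq[OF n _ d, of "1 / t"] t unfolding key by simp
  then show ?thesis unfolding Vol_eq[OF n t d] using t by simp
qed

lemma deriv_Vol_1:
  assumes n: "2 \<le> n" and d: "0 < d"
  shows "deriv (Vol n d) 1 = 0"
proof -
  obtain D where D: "(Vol n d has_real_derivative D) (at 1)" using Vol_deriv[OF n _ d, of 1] by auto
  have "((\<lambda>t. Vol n d (1 / t)) has_real_derivative D * (- 1)) (at 1)"
  proof (rule DERIV_chain2[where g = "\<lambda>t. 1 / t"])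
    show "(Vol n d has_real_derivative D) (at (1 / 1))" using D by simp
    show "((\<lambda>t::real. 1 / t) has_real_derivative - 1) (at 1)" by (auto intro!: derivative_eq_intros)
  qed
  then have "(Vol n d has_real_derivative D * (- 1)) (at 1)"
  proof (rule has_field_derivative_transform_within_open[of _ _ _ "{0<..}"])
    show "Vol n d (1 / s) = Vol n d s" if "s \<in> {0<..}" for s using Vol_reflect[OF n _ d, of s] that by simp
  qed auto
  from DERIV_unique[OF D this] have "D = 0" by simp
  then show ?thesis using DERIV_imp_deriv[OF D] by simp
qed

section \<open>The variation of the family as a Jacobi field\<close>

context profile
begin

text \<open>The hypothesis is \<open>jac (n * c) u u'\<close> integrated once against the solution \<open>\<tau>\<close> of the
  homogeneous equation; for the variation of the family it is an algebraic identity.\<close>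

lemma jac_from_wronskian:
  fixes c :: real
  assumes u: "C1 u u'"
    and wr: "\<And>z. 0 < z \<Longrightarrow> z < P \<Longrightarrow>
      \<tau> z * (p z * u' z) = - (w z ^ (n - 1) * k1 z * (\<phi> z * u z)) - c * (w z ^ n - 1)"
  shows "jac (n * c) u u'"
  unfolding jac_def
proof (intro conjI allI impI u)
  fix z assume z: "0 < z" "z < P"
  then have z': "z \<in> {0..P}" by simp
  \<comment> \<open>Differentiability of \<open>p * u'\<close> is not among the assumptions: it is
    obtained by recognising this product as \<open>R / \<tau>\<close>, all of whose ingredients are
    differentiable.\<close>
  define R where "R z = - (w z ^ (n - 1) * k1 z * (\<phi> z * u z)) - c * (w z ^ n - 1)" for z
  have du: "(u has_real_derivative u' z) (at z)" using u z by (simp add: C1_def)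
  have dR: "(R has_real_derivative
      - (((real n - 1) * (w z ^ (n - 1) / w z) * (\<tau> z / \<phi> z) * k1 z +
         - (real n - 1) * (k1 z - k2 z) * (\<tau> z / \<phi> z) / w z * w z ^ (n - 1)) * (\<phi> z * u z) +
        (k1 z * \<tau> z / \<phi> z * u z + u' z * \<phi> z) * (w z ^ (n - 1) * k1 z))
      - c * (n * w z ^ (n - 1) * (\<tau> z / \<phi> z) - 0)) (at z)"
    unfolding R_def[abs_def]
    by (intro DERIV_diff DERIV_minus DERIV_mult DERIV_cmult DERIV_const dpow[OF z] dk1[OF z] du)
  have \<tau>0: "\<tau> z \<noteq> 0" using \<tau>pos[OF z] by simp
  have "((\<lambda>z. R z / \<tau> z) has_real_derivative
      ((- (((real n - 1) * (w z ^ (n - 1) / w z) * (\<tau> z / \<phi> z) * k1 z +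
         - (real n - 1) * (k1 z - k2 z) * (\<tau> z / \<phi> z) / w z * w z ^ (n - 1)) * (\<phi> z * u z) +
        (k1 z * \<tau> z / \<phi> z * u z + u' z * \<phi> z) * (w z ^ (n - 1) * k1 z))
      - c * (n * w z ^ (n - 1) * (\<tau> z / \<phi> z) - 0)) * \<tau> z - R z * - k1 z) / (\<tau> z * \<tau> z)) (at z)"
    by (rule DERIV_divide[OF dR dk1(3)[OF z] \<tau>0])
  also have "R z = \<tau> z * (w z ^ (n - 1) * \<phi> z * u' z)" using wr[OF z] by (simp add: R_def p_def)
  also have "((- (((real n - 1) * (w z ^ (n - 1) / w z) * (\<tau> z / \<phi> z) * k1 z +
         - (real n - 1) * (k1 z - k2 z) * (\<tau> z / \<phi> z) / w z * w z ^ (n - 1)) * (\<phi> z * u z) +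
        (k1 z * \<tau> z / \<phi> z * u z + u' z * \<phi> z) * (w z ^ (n - 1) * k1 z))
      - c * (n * w z ^ (n - 1) * (\<tau> z / \<phi> z) - 0)) * \<tau> z - \<tau> z * (w z ^ (n - 1) * \<phi> z * u' z) * - k1 z) / (\<tau> z * \<tau> z) =
      - q z * u z - n * c * m z"
  proof -
    have "((- ((N * (A / W) * (s / f) * K + - N * (K - f / W) * (s / f) / W * A) * (f * U) +
        (K * s / f * U + U' * f) * (A * K)) - c * (n' * A * (s / f) - 0)) * s - s * (A * f * U') * - K) / (s * s) =
      - (A / f * (K\<^sup>2 + N * (f / W)\<^sup>2)) * U - n' * c * (A / f)"
      if "W \<noteq> 0" "f \<noteq> 0" "s \<noteq> 0" for N A W s f K U U' c n' :: real
      using that by (simp add: field_simps power2_eq_square)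
    from this[OF nz[OF z'] \<tau>0] show ?thesis unfolding q_def m_def k2_def by blast
  qed
  finally have D: "((\<lambda>z. R z / \<tau> z) has_real_derivative - q z * u z - n * c * m z) (at z)" .
  show "((\<lambda>z. p z * u' z) has_real_derivative - q z * u z - n * c * m z) (at z)"
  proof (rule has_field_derivative_transform_within_open[OF D, of "{0<..<P}"])
    fix x assume x: "x \<in> {0<..<P}"
    then show "R x / \<tau> x = p x * u' x" using wr[of x] \<tau>pos[of x] by (auto simp: R_def field_simps)
  qed (use z in auto)
qed

end

text \<open>The first integral \<open>w^(n-1) \<phi> = 1 - Q + Q w^n\<close> solved for
  \<phi>.\<close>

definition FF :: "nat \<Rightarrow> real \<Rightarrow> real \<Rightarrow> real" where
  "FF n q a = DD n q a / a ^ (n - 1)"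

text \<open>The chain rule in radius and parameter together, so that one formula serves motion along
  a profile (constant \<open>q\<close>) and motion along the family at fixed angle. The coefficient
  of \<open>a'\<close> is the profile curvature.\<close>

lemma FF_deriv:
  assumes n: "2 \<le> n" and da: "(a has_real_derivative a') (at s)" and dq: "(q has_real_derivative q') (at s)"
    and a: "0 < a s"
  shows "((\<lambda>s. FF n (q s) (a s)) has_real_derivative
    (n * q s - (real n - 1) * (FF n (q s) (a s) / a s)) * a' + (a s - 1 / a s ^ (n - 1)) * q') (at s)"
proof -
  define A where "A = a s ^ (n - 1)"
  obtain k where k: "n = Suc (Suc k)" using n by (metis Suc_1 add_2_eq_Suc le_Suc_ex)
  have A: "A \<noteq> 0" "a s \<noteq> 0" using a by (auto simp: A_def)
  have an: "a s ^ n = a s * A" by (simp add: A_def k)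
  have d1: "((\<lambda>s. a s ^ n) has_real_derivative n * A * a') (at s)"
    using DERIV_power[OF da, of n] by (simp add: A_def k mult_ac)
  have d2: "((\<lambda>s. a s ^ (n - 1)) has_real_derivative (real n - 1) * (A / a s) * a') (at s)"
    using DERIV_power[OF da, of "n - 1"] A by (simp add: A_def k mult_ac)
  have "((\<lambda>s. DD n (q s) (a s)) has_real_derivative (0 - q') + (q' * a s ^ n + n * A * a' * q s)) (at s)"
    unfolding DD_def by (intro DERIV_add DERIV_diff DERIV_const DERIV_mult d1 dq)
  from DERIV_divide[OF this d2]
  have "((\<lambda>s. FF n (q s) (a s)) has_real_derivative
    (((0 - q') + (q' * a s ^ n + n * A * a' * q s)) * a s ^ (n - 1) - DD n (q s) (a s) * ((real n - 1) * (A / a s) * a')) /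
      (a s ^ (n - 1) * a s ^ (n - 1))) (at s)"
    using A unfolding FF_def A_def by blast
  moreover have "(((0 - q') + (q' * (x * A) + n' * A * a' * q)) * A - E * (N * (A / x) * a')) / (A * A) =
     (n' * q - N * (E / A / x)) * a' + (x - 1 / A) * q'" if "x \<noteq> 0" for x q n' E N :: real
    using A that by (simp add: field_simps)
  note this[OF A(2), of n "q s" "DD n (q s) (a s)" "real n - 1"]
  ultimately show ?thesis unfolding FF_def an A_def[symmetric] by simp
qed

text \<open>The normalised profile over the height variable. As \<open>ta\<close> below is a square
  root, it is differentiated only between the ends, where \<open>ph < 1\<close>.\<close>

definition wp :: "nat \<Rightarrow> real \<Rightarrow> real \<Rightarrow> real" where
  "wp n t y = rad (cos (Psi n t y)) t"

definition ph :: "nat \<Rightarrow> real \<Rightarrow> real \<Rightarrow> real" where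
  "ph n t y = FF n (QQ n t) (wp n t y)"

definition ta :: "nat \<Rightarrow> real \<Rightarrow> real \<Rightarrow> real" where
  "ta n t y = sqrt (1 - (ph n t y)\<^sup>2)"

text \<open>The numerator is arranged so that every term has coefficient n - 1 - i, nonnegative in
  the range of summation, which shows the sign of Q'.\<close>

definition QQd :: "nat \<Rightarrow> real \<Rightarrow> real" where
  "QQd n t = - (t ^ (n - 2) * (\<Sum>i<n. (real n - 1 - real i) * t ^ i)) / (gsum n t)\<^sup>2"

lemma QQ_deriv:
  assumes n: "2 \<le> n" and t: "0 < t"
  shows "(QQ n has_real_derivative QQd n t) (at t)" "QQd n t < 0"
proof -
  obtain k where k: "n = Suc (Suc k)" using n by (metis Suc_1 add_2_eq_Suc le_Suc_ex)
  have g: "0 < gsum n s" if "0 < s" for s using gsum_pos[OF that, of n] n by simp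
  define G' where "G' = (\<Sum>i<n. real i * t ^ (i - 1))"
  have dG: "(gsum n has_real_derivative G') (at t)"
    unfolding gsum_def[abs_def] G'_def
    by (rule DERIV_sum) (auto intro!: derivative_eq_intros)
  have dp: "((\<lambda>s. s ^ (n - 1)) has_real_derivative (real n - 1) * t ^ (n - 2)) (at t)"
    using DERIV_pow[of "n - 1" t] by (simp add: k)
  have "((\<lambda>s. 1 - s ^ (n - 1) / gsum n s) has_real_derivative
     0 - ((real n - 1) * t ^ (n - 2) * gsum n t - t ^ (n - 1) * G') / (gsum n t * gsum n t)) (at t)"
    by (intro DERIV_diff DERIV_const DERIV_divide dp dG) (use g[OF t] in simp)
  moreover have "(real n - 1) * t ^ (n - 2) * gsum n t - t ^ (n - 1) * G' =
      t ^ (n - 2) * (\<Sum>i<n. (real n - 1 - real i) * t ^ i)"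
  proof -
    have "t ^ (n - 1) * G' = t ^ (n - 2) * (\<Sum>i<n. real i * t ^ i)"
    proof -
      have e: "t * (real i * t ^ (i - 1)) = real i * t ^ i" for i by (cases i) auto
      have "t * G' = (\<Sum>i<n. real i * t ^ i)" unfolding G'_def sum_distrib_left e ..
      then show ?thesis by (simp add: k mult.assoc[symmetric] mult.commute[of t])
    qed
    note e1 = this
    have e2: "(\<Sum>i<n. (real n - 1 - real i) * t ^ i) = (real n - 1) * gsum n t - (\<Sum>i<n. real i * t ^ i)"
      unfolding gsum_def sum_distrib_left sum_subtractf[symmetric] left_diff_distrib[symmetric] ..
    show ?thesis unfolding e1 e2 by (simp add: algebra_simps)
  qed
  ultimately have "((\<lambda>s. 1 - s ^ (n - 1) / gsum n s) has_real_derivative QQd n t) (at t)"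
    by (simp add: QQd_def power2_eq_square)
  then show "(QQ n has_real_derivative QQd n t) (at t)"
  proof (rule has_field_derivative_transform_within_open[of _ _ _ "{0<..}"])
    fix s :: real assume "s \<in> {0<..}"
    then show "1 - s ^ (n - 1) / gsum n s = QQ n s"
      using g[of s] gsum_last[of n s] n by (simp add: QQ_def field_simps)
  qed (use t in auto)
  have "0 < (\<Sum>i<n. (real n - 1 - real i) * t ^ i)"
  proof (rule sum_pos2[of _ 0])
    show "0 \<le> (real n - 1 - real i) * t ^ i" if "i \<in> {..<n}" for i
      using that t by (intro mult_nonneg_nonneg) auto
  qed (use n t in auto)
  then show "QQd n t < 0" using g[OF t] t by (simp add: QQd_def)
qed

context
  fixes n :: nat and t :: real
  assumes n: "2 \<le> n" and t0: "0 < t" and t1: "t < 1"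
begin

lemma FF_pos: "- 1 \<le> c \<Longrightarrow> c \<le> 1 \<Longrightarrow> 0 < FF n (QQ n t) (rad c t)"
  unfolding FF_def using rad_pos[OF t0] DD_pos[OF QQ_bounds[OF n t0]] by simp

text \<open>This is the slope relation \<open>dw/dz = \<tau> / \<phi>\<close> in the angle variable,
  with \<open>dw/d\<psi> = (1 - t) / 2 sin \<psi>\<close> and \<open>dz/d\<psi> = sg\<close>; the
  sine is nonnegative on the interval, so it gives the correct root. The parameter stays free
  because the identity is later differentiated in it.\<close>

lemma sqrt_FF:
  assumes \<psi>: "0 \<le> \<psi>" "\<psi> \<le> pi"
  shows "1 - (FF n (QQ n t) (rad (cos \<psi>) t))\<^sup>2 =
      ((1 - t) / 2 * sin \<psi> * FF n (QQ n t) (rad (cos \<psi>) t) / sg n (cos \<psi>) t)\<^sup>2"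
    and "sqrt (1 - (FF n (QQ n t) (rad (cos \<psi>) t))\<^sup>2) =
      (1 - t) / 2 * sin \<psi> * FF n (QQ n t) (rad (cos \<psi>) t) / sg n (cos \<psi>) t"
proof -
  define F where "F = FF n (QQ n t) (rad (cos \<psi>) t)"
  define S where "S = SS n (cos \<psi>) t"
  have F: "0 < F" unfolding F_def by (rule FF_pos) auto
  have S: "0 < S" unfolding S_def by (rule SS_pos[OF n t0]) auto
  have "(1 / F)\<^sup>2 - 1 = (1 - t)\<^sup>2 * (((1 + cos \<psi>) / 2) * ((1 - cos \<psi>) / 2) * S)"
    using sq_minus_1_eq[OF n t0, of "cos \<psi>"] by (simp add: F_def FF_def S_def)
  also have "((1 + cos \<psi>) / 2) * ((1 - cos \<psi>) / 2) = (sin \<psi>)\<^sup>2 / 4"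
    unfolding sin_squared_eq by (simp add: power2_eq_square algebra_simps)
  finally have "F\<^sup>2 * ((1 / F)\<^sup>2 - 1) = F\<^sup>2 * ((1 - t)\<^sup>2 * ((sin \<psi>)\<^sup>2 / 4 * S))" by simp
  moreover have "F\<^sup>2 * ((1 / F)\<^sup>2 - 1) = 1 - F\<^sup>2" using F by (simp add: field_simps)
  moreover have "F\<^sup>2 * ((1 - t)\<^sup>2 * ((sin \<psi>)\<^sup>2 / 4 * S)) = ((1 - t) / 2 * sin \<psi> * F / sg n (cos \<psi>) t)\<^sup>2"
    using S by (simp add: sg_def S_def[symmetric] power_mult_distrib power_divide)
  ultimately have eq: "1 - F\<^sup>2 = ((1 - t) / 2 * sin \<psi> * F / sg n (cos \<psi>) t)\<^sup>2" by simp
  then show "1 - (FF n (QQ n t) (rad (cos \<psi>) t))\<^sup>2 =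
      ((1 - t) / 2 * sin \<psi> * FF n (QQ n t) (rad (cos \<psi>) t) / sg n (cos \<psi>) t)\<^sup>2" by (simp add: F_def)
  have "0 \<le> (1 - t) / 2 * sin \<psi> * F / sg n (cos \<psi>) t"
    using F t1 sin_ge_zero[OF \<psi>] sg_pos[OF n t0, of "cos \<psi>"] by simp
  then show "sqrt (1 - (FF n (QQ n t) (rad (cos \<psi>) t))\<^sup>2) =
      (1 - t) / 2 * sin \<psi> * FF n (QQ n t) (rad (cos \<psi>) t) / sg n (cos \<psi>) t"
    unfolding F_def[symmetric] eq real_sqrt_abs by (rule abs_of_nonneg)
qed

end

context
  fixes n :: nat and t :: real
  assumes n: "2 \<le> n" and t0: "0 < t" and t1: "t < 1"
begin

lemma ta_eq:
  assumes "y \<in> {0..Pf n t}"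
  shows "ta n t y = (1 - t) / 2 * sin (Psi n t y) * ph n t y / sg n (cos (Psi n t y)) t"
  using sqrt_FF(2)[OF n t0 t1 Psi_props(1,2)[OF n t0 assms]] by (simp add: ta_def ph_def wp_def)

lemma rad_cos_deriv:
  assumes y: "0 < y" "y < Pf n t"
  shows "((\<lambda>y. cos (Psi n t y)) has_real_derivative - sin (Psi n t y) * (1 / sg n (cos (Psi n t y)) t)) (at y)"
    and "(wp n t has_real_derivative ta n t y / ph n t y) (at y)"
proof -
  show d: "((\<lambda>y. cos (Psi n t y)) has_real_derivative - sin (Psi n t y) * (1 / sg n (cos (Psi n t y)) t)) (at y)"
    by (rule DERIV_chain2[where f = cos, OF DERIV_cos Psi_deriv[OF n t0 y]])
  have "((\<lambda>y. 1 - (1 - t) / 2 * (1 + cos (Psi n t y))) has_real_derivative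
     0 - (1 - t) / 2 * (0 + - sin (Psi n t y) * (1 / sg n (cos (Psi n t y)) t))) (at y)"
    by (intro DERIV_diff DERIV_const DERIV_cmult DERIV_add d)
  moreover have "wp n t = (\<lambda>y. 1 - (1 - t) / 2 * (1 + cos (Psi n t y)))"
    by (auto simp: wp_def rad_def)
  moreover have "ta n t y / ph n t y = (1 - t) / 2 * sin (Psi n t y) / sg n (cos (Psi n t y)) t"
    using ta_eq[of y] FF_pos[OF n t0 t1, of "cos (Psi n t y)"] y by (simp add: ph_def wp_def)
  ultimately show "(wp n t has_real_derivative ta n t y / ph n t y) (at y)" by simp
qed

lemma wp_cont: "continuous_on {0..Pf n t} (wp n t)"
  unfolding wp_def rad_def by (intro continuous_intros Psi_cont[OF n t0]) simp

lemma wp_pos: "0 < wp n t y"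
  unfolding wp_def by (rule rad_pos[OF t0]) auto

lemma ph_pos: "0 < ph n t y"
  unfolding ph_def wp_def by (rule FF_pos[OF n t0 t1]) auto

lemma ph_cont: "continuous_on {0..Pf n t} (ph n t)"
  unfolding ph_def FF_def DD_def using wp_pos by (intro continuous_intros wp_cont) (auto simp: less_imp_neq[THEN not_sym])

lemma ta_cont: "continuous_on {0..Pf n t} (ta n t)"
  unfolding ta_def by (intro continuous_intros ph_cont)

lemma ta_pos:
  assumes y: "0 < y" "y < Pf n t"
  shows "0 < ta n t y"
  using ta_eq[of y] y t1 sin_gt_zero[OF Psi_interior[OF n t0 y]] sg_pos[OF n t0, of "cos (Psi n t y)"] ph_pos[of y]
  by simp

lemma ph_deriv:
  assumes y: "0 < y" "y < Pf n t"
  shows "(ph n t has_real_derivative (n * QQ n t - (real n - 1) * (ph n t y / wp n t y)) * ta n t y / ph n t y) (at y)"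
  using FF_deriv[OF n rad_cos_deriv(2)[OF y] DERIV_const wp_pos, of "QQ n t"]
  unfolding ph_def[abs_def] by simp

lemma ta_deriv:
  assumes y: "0 < y" "y < Pf n t"
  shows "(ta n t has_real_derivative - (n * QQ n t - (real n - 1) * (ph n t y / wp n t y))) (at y)"
proof -
  define K where "K = n * QQ n t - (real n - 1) * (ph n t y / wp n t y)"
  have pos: "0 < 1 - (ph n t y)\<^sup>2" using ta_pos[OF y] by (simp add: ta_def)
  have "((\<lambda>y. (ph n t y)\<^sup>2) has_real_derivative 2 * ph n t y * (K * ta n t y / ph n t y)) (at y)"
  proof -
    have "((\<lambda>y. (ph n t y)\<^sup>2) has_real_derivative 2 * ph n t y * D) (at y)" if "(ph n t has_real_derivative D) (at y)" for D
      using DERIV_power[OF that, of 2] by (simp add: mult_ac)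
    from this[OF ph_deriv[OF y]] show ?thesis unfolding K_def .
  qed
  then have "((\<lambda>y. 1 - (ph n t y)\<^sup>2) has_real_derivative 0 - 2 * ph n t y * (K * ta n t y / ph n t y)) (at y)"
    by (intro DERIV_diff DERIV_const)
  from DERIV_chain2[where f = sqrt, OF DERIV_real_sqrt[OF pos] this]
  have "(ta n t has_real_derivative inverse (ta n t y) / 2 * (0 - 2 * ph n t y * (K * ta n t y / ph n t y))) (at y)"
    by (simp add: ta_def[abs_def])
  moreover have "inverse (ta n t y) / 2 * (0 - 2 * ph n t y * (K * ta n t y / ph n t y)) = - K"
    using ta_pos[OF y] ph_pos[of y] by (simp add: field_simps)
  ultimately show ?thesis by (simp add: K_def)
qed

lemma profile_inst: "profile n (QQ n t) t (Pf n t) (wp n t) (ph n t) (ta n t)"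
proof
  show "(ph n t z)\<^sup>2 + (ta n t z)\<^sup>2 = 1" if z: "z \<in> {0..Pf n t}" for z
  proof -
    have "0 \<le> 1 - (ph n t z)\<^sup>2"
      using sqrt_FF(1)[OF n t0 t1 Psi_props(1,2)[OF n t0 z]] by (simp add: ph_def wp_def)
    then show ?thesis by (simp add: ta_def)
  qed
  show "wp n t z ^ (n - 1) * ph n t z = 1 - QQ n t + QQ n t * wp n t z ^ n" for z
    using wp_pos[of z] by (simp add: ph_def FF_def DD_def)
  show "ta n t 0 = 0" "ta n t (Pf n t) = 0"
    using ta_eq[of 0] ta_eq[of "Pf n t"] Pf_pos[OF n t0] by (auto simp: Psi_ends[OF n t0])
  show "wp n t 0 = t" "wp n t (Pf n t) = 1" by (simp_all add: wp_def Psi_ends[OF n t0] rad_def)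
qed (use n t0 t1 Pf_pos[OF n t0] QQ_bounds[OF n t0] wp_cont ph_cont ta_cont wp_pos ph_pos rad_cos_deriv(2)
      ph_deriv ta_deriv ta_pos QQ_ends[OF n t0 t1] in auto)

interpretation pr: profile n "QQ n t" t "Pf n t" "wp n t" "ph n t" "ta n t"
  by (rule profile_inst)

text \<open>The derivative of the height in t at fixed angle.\<close>

definition Tht :: "real \<Rightarrow> real" where
  "Tht \<psi> = integral {0..\<psi>} (\<lambda>s. sgt n (cos s) t)"

text \<open>At fixed angle the radius moves with velocity \<open>(1 + cos \<psi>) / 2\<close> and
  the height with velocity \<open>Tht\<close>; this is the component along the normal
  \<open>(- \<tau>, \<phi> \<theta>)\<close>.\<close>

definition u1f :: "real \<Rightarrow> real" where
  "u1f y = (1 + cos (Psi n t y)) / 2 * ph n t y - Tht (Psi n t y) * ta n t y"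

definition u1d :: "real \<Rightarrow> real" where
  "u1d y = (- (sin (Psi n t y) / 2) * ph n t y - sgt n (cos (Psi n t y)) t * ta n t y) / sg n (cos (Psi n t y)) t
     + (1 + cos (Psi n t y)) / 2 * (pr.k1 y * ta n t y / ph n t y) + Tht (Psi n t y) * pr.k1 y"

lemma Tht_Psi_cont: "continuous_on {0..Pf n t} (\<lambda>y. Tht (Psi n t y))"
  unfolding Tht_def
  by (rule continuous_on_compose2[OF continuous_indef[OF continuous_sgt[OF n t0], of pi] Psi_cont[OF n t0]])
     (use Psi_props[OF n t0] in auto)

lemma Tht_Psi_deriv:
  assumes y: "0 < y" "y < Pf n t"
  shows "((\<lambda>y. Tht (Psi n t y)) has_real_derivative sgt n (cos (Psi n t y)) t * (1 / sg n (cos (Psi n t y)) t)) (at y)"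
  by (rule DERIV_chain2[OF _ Psi_deriv[OF n t0 y]])
     (unfold Tht_def, rule DERIV_indef[OF continuous_sgt[OF n t0] Psi_interior[OF n t0 y]])

lemma C1_u1: "pr.C1 u1f u1d"
  unfolding pr.C1_def
proof (intro conjI allI impI)
  have cc: "continuous_on {0..Pf n t} (\<lambda>y. sg n (cos (Psi n t y)) t)"
    "continuous_on {0..Pf n t} (\<lambda>y. sgt n (cos (Psi n t y)) t)"
    by (rule continuous_on_compose2[OF continuous_sg[OF n t0] Psi_cont[OF n t0]]
        continuous_on_compose2[OF continuous_sgt[OF n t0] Psi_cont[OF n t0]], rule subset_UNIV)+
  show "continuous_on {0..Pf n t} u1f"
    unfolding u1f_def by (intro continuous_intros Psi_cont[OF n t0] Tht_Psi_cont ph_cont ta_cont) auto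
  show "continuous_on {0..Pf n t} u1d"
    unfolding u1d_def
    by (intro continuous_intros Psi_cont[OF n t0] Tht_Psi_cont ph_cont ta_cont cc pr.cont_coeffs ballI)
       (use ph_pos sg_pos[OF n t0] in \<open>auto simp: less_imp_neq[THEN not_sym]\<close>)
  fix y assume y: "0 < y" "y < Pf n t"
  have "((\<lambda>y. (1 + cos (Psi n t y)) / 2 * ph n t y - Tht (Psi n t y) * ta n t y) has_real_derivative
     (0 + - sin (Psi n t y) * (1 / sg n (cos (Psi n t y)) t)) / 2 * ph n t y +
       pr.k1 y * ta n t y / ph n t y * ((1 + cos (Psi n t y)) / 2) -
     (sgt n (cos (Psi n t y)) t * (1 / sg n (cos (Psi n t y)) t) * ta n t y + - pr.k1 y * Tht (Psi n t y))) (at y)"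
    by (intro DERIV_diff DERIV_mult DERIV_cdivide DERIV_add DERIV_const rad_cos_deriv(1)[OF y] Tht_Psi_deriv[OF y]
        pr.dk1[OF y])
  moreover have "(0 + - sin (Psi n t y) * (1 / sg n (cos (Psi n t y)) t)) / 2 * ph n t y +
       pr.k1 y * ta n t y / ph n t y * ((1 + cos (Psi n t y)) / 2) -
     (sgt n (cos (Psi n t y)) t * (1 / sg n (cos (Psi n t y)) t) * ta n t y + - pr.k1 y * Tht (Psi n t y)) = u1d y"
    unfolding u1d_def by (simp add: diff_divide_distrib algebra_simps)
  ultimately show "(u1f has_real_derivative u1d y) (at y)"
    unfolding u1f_def[abs_def] by simp
qed

text \<open>Differentiating \<open>sg \<tau> = (1 - t) / 2 sin \<psi> \<phi>\<close>, valid for all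
  parameters in (0, 1), with respect to t at fixed angle expresses \<open>sgt\<close> through
  \<open>Ft\<close>, the derivative of \<phi>. The left side is the combination that occurs in
  \<open>u1d\<close>.\<close>

lemma angle_identity:
  assumes \<psi>: "0 < \<psi>" "\<psi> < pi"
  defines "a \<equiv> rad (cos \<psi>) t" and "F \<equiv> FF n (QQ n t) (rad (cos \<psi>) t)"
  defines "\<tau> \<equiv> sqrt (1 - F\<^sup>2)"
  defines "Ft \<equiv> (n * QQ n t - (real n - 1) * (F / a)) * ((1 + cos \<psi>) / 2) + (a - 1 / a ^ (n - 1)) * QQd n t"
  shows "- (sin \<psi> / 2) * F - sgt n (cos \<psi>) t * \<tau> = - (sg n (cos \<psi>) t * Ft / (F * \<tau>))"
proof -
  have F: "0 < F" unfolding F_def by (rule FF_pos[OF n t0 t1]) auto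
  have drad: "((\<lambda>t. rad c t) has_real_derivative (1 + c) / 2) (at t)" for c
    unfolding rad_def by (auto intro!: derivative_eq_intros simp: field_simps)
  define f where "f s = FF n (QQ n s) (rad (cos \<psi>) s)" for s
  have df: "(f has_real_derivative Ft) (at t)"
    unfolding f_def[abs_def] Ft_def F_def a_def
    by (rule FF_deriv[OF n drad QQ_deriv(1)[OF n t0]]) (rule rad_pos[OF t0], auto)
  have fF: "f t = F" by (simp add: f_def F_def)
  have id: "sqrt (1 - (f s)\<^sup>2) = (1 - s) / 2 * sin \<psi> * f s / sg n (cos \<psi>) s" if "0 < s" "s < 1" for s
    unfolding f_def by (rule sqrt_FF(2)[OF n that]) (use \<psi> in auto)
  have sg0: "0 < sg n (cos \<psi>) s" if "0 < s" for s by (rule sg_pos[OF n that]) auto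
  have \<tau>: "\<tau> = (1 - t) / 2 * sin \<psi> * F / sg n (cos \<psi>) t" using id[OF t0 t1] by (simp add: \<tau>_def fF)
  then have \<tau>0: "0 < \<tau>" using F t1 sin_gt_zero[OF \<psi>] sg0[OF t0] by simp
  then have pos: "0 < 1 - (f t)\<^sup>2" by (simp add: \<tau>_def fF)
  have "((\<lambda>s. (f s)\<^sup>2) has_real_derivative 2 * F * Ft) (at t)"
    using DERIV_power[OF df, of 2] by (simp add: fF mult_ac)
  then have "((\<lambda>s. 1 - (f s)\<^sup>2) has_real_derivative 0 - 2 * F * Ft) (at t)" by (intro DERIV_diff DERIV_const)
  from DERIV_chain2[where f = sqrt, OF DERIV_real_sqrt[OF pos] this]
  have dsq: "((\<lambda>s. sqrt (1 - (f s)\<^sup>2)) has_real_derivative inverse \<tau> / 2 * (0 - 2 * F * Ft)) (at t)"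
    by (simp add: \<tau>_def fF)
  have dsg: "((\<lambda>s. sg n (cos \<psi>) s) has_real_derivative sgt n (cos \<psi>) t) (at t)"
    by (rule sgt(1)[OF n _ _ t0]) auto
  have L: "((\<lambda>s. sg n (cos \<psi>) s * sqrt (1 - (f s)\<^sup>2)) has_real_derivative
      sgt n (cos \<psi>) t * \<tau> + inverse \<tau> / 2 * (0 - 2 * F * Ft) * sg n (cos \<psi>) t) (at t)"
    using DERIV_mult[OF dsg dsq] by (simp add: \<tau>_def fF)
  have "((\<lambda>s. (1 - s) / 2 * sin \<psi>) has_real_derivative - (sin \<psi> / 2)) (at t)"
    by (auto intro!: derivative_eq_intros)
  from DERIV_mult[OF this df]
  have "((\<lambda>s. (1 - s) / 2 * sin \<psi> * f s) has_real_derivative - (sin \<psi> / 2) * F + Ft * ((1 - t) / 2 * sin \<psi>)) (at t)"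
    by (simp add: fF)
  then have "((\<lambda>s. sg n (cos \<psi>) s * sqrt (1 - (f s)\<^sup>2)) has_real_derivative
      - (sin \<psi> / 2) * F + Ft * ((1 - t) / 2 * sin \<psi>)) (at t)"
    by (rule has_field_derivative_transform_within_open[of _ _ _ "{0<..<1}"])
       (use t0 t1 id sg0 in \<open>auto simp: less_imp_neq[THEN not_sym]\<close>)
  from DERIV_unique[OF this L]
  have e: "- (sin \<psi> / 2) * F + Ft * ((1 - t) / 2 * sin \<psi>) =
      sgt n (cos \<psi>) t * \<tau> + inverse \<tau> / 2 * (0 - 2 * F * Ft) * sg n (cos \<psi>) t" .
  have s: "(1 - t) / 2 * sin \<psi> = sg n (cos \<psi>) t * \<tau> / F" using \<tau> F sg0[OF t0] by simp
  have \<tau>2: "\<tau> * \<tau> = 1 - F * F" using pos by (simp add: \<tau>_def fF power2_eq_square)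
  have "- (sin \<psi> / 2) * F - sgt n (cos \<psi>) t * \<tau> =
      - (F * Ft * sg n (cos \<psi>) t / \<tau>) - Ft * (sg n (cos \<psi>) t * \<tau> / F)"
    using e unfolding s by (simp add: field_simps)
  also have "\<dots> = - (sg n (cos \<psi>) t * Ft * (F * F + \<tau> * \<tau>) / (F * \<tau>))"
    using F \<tau>0 by (simp add: field_simps)
  finally show ?thesis unfolding \<tau>2 by simp
qed

text \<open>Since \<tau>' = - \<open>k1\<close>, the claim is that the weighted Wronskian
  \<open>p (\<tau> u1' - \<tau>' u1)\<close> equals \<open>- Q' (w^n - 1)\<close>. The t-derivative
  of \<phi> at fixed angle, substituted through \<open>angle_identity\<close>, contains both the
  curvature term and the Q' term.\<close>

lemma u1_wronskian:
  assumes y: "0 < y" "y < Pf n t"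
  shows "ta n t y * (pr.p y * u1d y) =
    - (wp n t y ^ (n - 1) * pr.k1 y * (ph n t y * u1f y)) - QQd n t * (wp n t y ^ n - 1)"
proof -
  define \<sigma> where "\<sigma> = sg n (cos (Psi n t y)) t"
  define At where "At = (1 + cos (Psi n t y)) / 2"
  define A where "A = wp n t y ^ (n - 1)"
  define Ft where "Ft = pr.k1 y * At + (wp n t y - 1 / A) * QQd n t"
  have \<sigma>: "\<sigma> \<noteq> 0" using sg_pos[OF n t0, of "cos (Psi n t y)"] by (simp add: \<sigma>_def)
  have F: "ph n t y \<noteq> 0" and \<tau>: "ta n t y \<noteq> 0" and A: "A \<noteq> 0"
    using ph_pos[of y] ta_pos[OF y] wp_pos[of y] by (simp_all add: A_def)
  have an: "wp n t y ^ n = wp n t y * A" using n by (cases n) (auto simp: A_def)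
  have "- (sin (Psi n t y) / 2) * ph n t y - sgt n (cos (Psi n t y)) t * ta n t y = - (\<sigma> * Ft / (ph n t y * ta n t y))"
    using angle_identity[OF Psi_interior[OF n t0 y]]
    by (simp add: ph_def wp_def ta_def Ft_def At_def A_def \<sigma>_def pr.k1_def pr.k2_def)
  then have u: "u1d y = - (Ft / (ph n t y * ta n t y)) + At * (pr.k1 y * ta n t y / ph n t y) + Tht (Psi n t y) * pr.k1 y"
    using \<sigma> unfolding u1d_def \<sigma>_def[symmetric] At_def[symmetric] by simp
  have \<tau>2: "ta n t y * ta n t y = 1 - ph n t y * ph n t y"
    using pr.pyth[of y] y by (simp add: power2_eq_square)
  have "s * (A * f * (- (G / (f * s)) + At * (K * s / f) + Th * K)) = A * (- G + At * K * (s * s) + Th * K * s * f)"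
    if "f \<noteq> 0" "s \<noteq> 0" for s f G K Th :: real
    using that by (simp add: field_simps)
  from this[OF F \<tau>] have "ta n t y * (pr.p y * u1d y) =
     A * (- Ft + At * pr.k1 y * (1 - ph n t y * ph n t y) + Tht (Psi n t y) * pr.k1 y * ta n t y * ph n t y)"
    unfolding u pr.p_def A_def[symmetric] \<tau>2 .
  also have "\<dots> = - (A * pr.k1 y * (ph n t y * u1f y)) - QQd n t * (wp n t y * A - 1)"
    unfolding Ft_def u1f_def At_def[symmetric] using A by (simp add: field_simps)
  finally show ?thesis by (simp add: an A_def)
qed

lemma variation_inst:
  "profile_variation n (QQ n t) t (Pf n t) (wp n t) (ph n t) (ta n t) u1f u1d (QQd n t) (Pd n t)"
proof
  show "pr.jac (n * QQd n t) u1f u1d" by (rule pr.jac_from_wronskian[OF C1_u1 u1_wronskian])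
  show "u1f 0 = 1" "u1f (Pf n t) = 0"
    by (simp_all add: u1f_def Psi_ends[OF n t0] pr.\<tau>z pr.ends)
  show "u1d 0 = 0" "u1d (Pf n t) = Pd n t * pr.kap"
    by (simp_all add: u1d_def Psi_ends[OF n t0] pr.\<tau>z pr.ends Tht_def Pd_def)
  show "QQd n t < 0" by (rule QQ_deriv(2)[OF n t0])
qed

interpretation pv: profile_variation n "QQ n t" t "Pf n t" "wp n t" "ph n t" "ta n t" u1f u1d "QQd n t" "Pd n t"
  by (rule variation_inst)

section \<open>The derivative of the volume along the family\<close>

lemma I_eq: "pr.I = II n t"
  unfolding pr.I_def II_def wp_def
  by (rule integral_Psi[OF n t0]) (auto simp: rad_def intro!: continuous_intros)

text \<open>As in \<open>M_eq\<close>, \<open>Ider\<close> includes the change \<open>Pd\<close> in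
  the length of the interval at the bulge, where \<open>w = 1\<close>, and the normal velocity
  sweeps out the rest. The antiderivative subtracts \<open>w^n Tht\<close> to pass from fixed angle
  to normal motion.\<close>

lemma M1_eq: "n * pv.M1 = Ider n t - Pd n t"
proof -
  define J where "J x = integral {0..x} (\<lambda>\<psi>. n * rad (cos \<psi>) t ^ (n - 1) * ((1 + cos \<psi>) / 2) * sg n (cos \<psi>) t
      + rad (cos \<psi>) t ^ n * sgt n (cos \<psi>) t)" for x
  have cJ: "continuous_on {0..pi} (\<lambda>\<psi>. n * rad (cos \<psi>) t ^ (n - 1) * ((1 + cos \<psi>) / 2) * sg n (cos \<psi>) t
      + rad (cos \<psi>) t ^ n * sgt n (cos \<psi>) t)"
    unfolding rad_def by (intro continuous_intros continuous_sg[OF n t0] continuous_sgt[OF n t0]) auto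
  have "integral {0..Pf n t} (\<lambda>y. n * (pr.m y * u1f y)) =
     (J (Psi n t (Pf n t)) - wp n t (Pf n t) ^ n * Tht (Psi n t (Pf n t))) - (J (Psi n t 0) - wp n t 0 ^ n * Tht (Psi n t 0))"
  proof (rule integral_eq_boundary_diff)
    show "continuous_on {0..Pf n t} (\<lambda>y. J (Psi n t y) - wp n t y ^ n * Tht (Psi n t y))"
      by (intro continuous_intros wp_cont Tht_Psi_cont continuous_on_compose2[OF continuous_indef[OF cJ, folded J_def] Psi_cont[OF n t0]])
         (use Psi_props[OF n t0] in auto)
    fix y assume y: "0 < y" "y < Pf n t"
    define \<sigma> where "\<sigma> = sg n (cos (Psi n t y)) t"
    have \<sigma>: "\<sigma> \<noteq> 0" using sg_pos[OF n t0, of "cos (Psi n t y)"] by (simp add: \<sigma>_def)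
    have "((\<lambda>y. J (Psi n t y)) has_real_derivative (n * wp n t y ^ (n - 1) * ((1 + cos (Psi n t y)) / 2) * \<sigma>
        + wp n t y ^ n * sgt n (cos (Psi n t y)) t) * (1 / \<sigma>)) (at y)"
      unfolding \<sigma>_def wp_def
      by (rule DERIV_chain2[OF _ Psi_deriv[OF n t0 y]])
         (unfold J_def, rule DERIV_indef[OF cJ Psi_interior[OF n t0 y]])
    from DERIV_diff[OF this DERIV_mult[OF pr.dpow(2)[OF y] Tht_Psi_deriv[OF y]]]
    have "((\<lambda>y. J (Psi n t y) - wp n t y ^ n * Tht (Psi n t y)) has_real_derivative
      (n * wp n t y ^ (n - 1) * ((1 + cos (Psi n t y)) / 2) * \<sigma> + wp n t y ^ n * sgt n (cos (Psi n t y)) t) * (1 / \<sigma>)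
      - (n * wp n t y ^ (n - 1) * (ta n t y / ph n t y) * Tht (Psi n t y) +
         sgt n (cos (Psi n t y)) t * (1 / \<sigma>) * wp n t y ^ n)) (at y)" by (simp add: \<sigma>_def)
    moreover have "(n * wp n t y ^ (n - 1) * ((1 + cos (Psi n t y)) / 2) * \<sigma> + wp n t y ^ n * sgt n (cos (Psi n t y)) t) * (1 / \<sigma>)
      - (n * wp n t y ^ (n - 1) * (ta n t y / ph n t y) * Tht (Psi n t y) +
         sgt n (cos (Psi n t y)) t * (1 / \<sigma>) * wp n t y ^ n) = n * (pr.m y * u1f y)"
      using \<sigma> ph_pos[of y] by (simp add: pr.m_def u1f_def field_simps)
    ultimately show "((\<lambda>y. J (Psi n t y) - wp n t y ^ n * Tht (Psi n t y)) has_real_derivative n * (pr.m y * u1f y)) (at y)"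
      by simp
  qed (use Pf_pos[OF n t0] in auto)
  then show ?thesis
    by (simp add: pv.M1_def Psi_ends[OF n t0] J_def Ider_def pr.w_ends Tht_def Pd_def)
qed

lemma deriv_Vol_V1:
  assumes d: "0 < d"
  shows "\<exists>C>0. deriv (Vol n d) t = C * pv.V1"
proof -
  have P: "0 < Pf n t" by (rule Pf_pos[OF n t0])
  have "Ider n t * Pf n t - (real n + 1) * II n t * Pd n t = n * pv.V1"
  proof -
    have "n * pv.V1 = Pf n t * (n * pv.M1) - Pd n t * (n * pr.M)" by (simp add: pv.V1_def algebra_simps)
    also have "\<dots> = Pf n t * (Ider n t - Pd n t) - Pd n t * ((real n + 1) * II n t - Pf n t)"
      unfolding M1_eq pr.M_eq I_eq ..
    finally show ?thesis by (simp add: algebra_simps)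
  qed
  then have "deriv (Vol n d) t = unit_ball_vol n * d ^ (n + 1) * (n * pv.V1 / Pf n t ^ (n + 2))"
    using DERIV_imp_deriv[OF Vol_deriv[OF n t0 d]] by simp
  then have "deriv (Vol n d) t = (unit_ball_vol n * d ^ (n + 1) * n / Pf n t ^ (n + 2)) * pv.V1" by simp
  moreover have "0 < unit_ball_vol n * d ^ (n + 1) * n / Pf n t ^ (n + 2)" using P d n by simp
  ultimately show ?thesis by blast
qed

end

section \<open>Geometry of surfaces of revolution\<close>

lemma grad_eq:
  assumes "(f has_derivative (\<lambda>h. g \<bullet> h)) (at x)"
  shows "grad f x = g"
proof -
  have "frechet_derivative f (at x) = (\<lambda>h. g \<bullet> h)" using frechet_derivative_at[OF assms] by simp
  then show ?thesis by (simp add: grad_def euclidean_representation)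
qed

lemma has_derivative_compose_fst:
  fixes f :: "real \<Rightarrow> real"
  assumes "(f has_real_derivative D) (at (fst p))"
  shows "((\<lambda>p. f (fst p)) has_derivative (\<lambda>h. D * fst h)) (at p)"
  by (rule has_derivative_compose[OF has_derivative_fst[OF has_derivative_ident] assms[unfolded has_field_derivative_def]])

lemma sum_Basis_prod:
  fixes f :: "'a::euclidean_space \<times> 'b::euclidean_space \<Rightarrow> real"
  shows "sum f Basis = (\<Sum>e\<in>Basis. f (e, 0)) + (\<Sum>e\<in>Basis. f (0, e))"
proof -
  have "inj_on (\<lambda>u. (u::'a, 0::'b)) Basis" "inj_on (\<lambda>u. (0::'a, u::'b)) Basis"
    by (auto intro!: inj_onI)
  then show ?thesis
    unfolding Basis_prod_def by (subst sum.union_disjoint) (auto simp: sum.reindex)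
qed

text \<open>The derivatives of \<phi> and \<tau> are taken at \<open>z\<close> alone, but the slope
  and the Pythagorean relation must hold on an interval: the unit normal has to be known near the
  point before it can be differentiated.\<close>

locale revolution =
  fixes w \<phi> \<tau> :: "real \<Rightarrow> real" and a b z K :: real and \<theta> :: "real^'n"
  assumes z: "a < z" "z < b"
    and dw: "\<And>x. a < x \<Longrightarrow> x < b \<Longrightarrow> (w has_real_derivative \<tau> x / \<phi> x) (at x)"
    and \<phi>pos: "\<And>x. a < x \<Longrightarrow> x < b \<Longrightarrow> 0 < \<phi> x"
    and pyth: "\<And>x. a < x \<Longrightarrow> x < b \<Longrightarrow> (\<phi> x)\<^sup>2 + (\<tau> x)\<^sup>2 = 1"
    and d\<tau>: "(\<tau> has_real_derivative - K) (at z)" and d\<phi>: "(\<phi> has_real_derivative K * \<tau> z / \<phi> z) (at z)"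
    and wpos: "0 < w z" and \<theta>: "norm \<theta> = 1"
begin

lemma grad_levelfun:
  assumes x: "a < x" "x < b" and y: "y \<noteq> (0 :: real^'n)"
  shows "grad (levelfun w) (x, y) = (- (\<tau> x / \<phi> x), y /\<^sub>R norm y)"
proof (rule grad_eq)
  have n: "((\<lambda>p. norm (snd p)) has_derivative (\<lambda>h. (y /\<^sub>R norm y) \<bullet> snd h)) (at (x, y))"
    using has_derivative_compose[OF has_derivative_snd[OF has_derivative_ident], of norm "\<lambda>h. (y /\<^sub>R norm y) \<bullet> h" "(x, y)" UNIV]
      has_derivative_norm[OF y] by (simp add: sgn_div_norm inner_commute)
  have v: "((\<lambda>p. w (fst p)) has_derivative (\<lambda>h. \<tau> x / \<phi> x * fst h)) (at (x, y))"
    by (rule has_derivative_compose_fst) (simp add: dw[OF x])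
  have "((\<lambda>p. norm (snd p) - w (fst p)) has_derivative (\<lambda>h. (y /\<^sub>R norm y) \<bullet> snd h - \<tau> x / \<phi> x * fst h)) (at (x, y))"
    by (rule has_derivative_diff[OF n v])
  then show "(levelfun w has_derivative (\<lambda>h. (- (\<tau> x / \<phi> x), y /\<^sub>R norm y) \<bullet> h)) (at (x, y))"
    unfolding levelfun_def[abs_def] by (rule has_derivative_eq_rhs) (auto simp: fun_eq_iff)
qed

lemma unit_normal_eq:
  assumes x: "a < x" "x < b" and y: "y \<noteq> (0 :: real^'n)"
  shows "unit_normal w (x, y) = (- \<tau> x, \<phi> x *\<^sub>R (y /\<^sub>R norm y))"
proof -
  have f: "0 < \<phi> x" by (rule \<phi>pos[OF x])
  have "(norm (- (\<tau> x / \<phi> x), y /\<^sub>R norm y))\<^sup>2 = (\<tau> x / \<phi> x)\<^sup>2 + 1"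
    using y by (simp add: norm_Pair power_divide)
  also have "\<dots> = (1 / \<phi> x)\<^sup>2" using pyth[OF x] f by (simp add: field_simps)
  finally have "norm (- (\<tau> x / \<phi> x), y /\<^sub>R norm y) = 1 / \<phi> x"
    using f by (subst (asm) power2_eq_iff_nonneg) auto
  then show ?thesis unfolding unit_normal_def grad_levelfun[OF x y] using f by simp
qed

definition "pt = (z, w z *\<^sub>R \<theta>)"

lemma pt_y: "w z *\<^sub>R \<theta> \<noteq> 0" "(w z *\<^sub>R \<theta>) /\<^sub>R norm (w z *\<^sub>R \<theta>) = \<theta>" "norm (w z *\<^sub>R \<theta>) = w z"
  using wpos \<theta> by auto

lemma unit_normal_pt: "unit_normal w pt = (- \<tau> z, \<phi> z *\<^sub>R \<theta>)"
  unfolding pt_def unit_normal_eq[OF z pt_y(1)] pt_y(2) ..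

text \<open>The unit tangent of the meridian is \<open>(\<phi>, \<tau> \<theta>)\<close>, which
  gives the first square; what remains is tangent to the parallel.\<close>

lemma tang_grad_sq_pt:
  "tang_grad_sq w U pt = (\<phi> z * fst (grad U pt) + \<tau> z * (snd (grad U pt) \<bullet> \<theta>))\<^sup>2
     + ((norm (snd (grad U pt)))\<^sup>2 - (snd (grad U pt) \<bullet> \<theta>)\<^sup>2)"
proof -
  obtain g1 g2 where g: "grad U pt = (g1, g2)" by fastforce
  define c where "c = g2 \<bullet> \<theta>"
  have i: "grad U pt \<bullet> unit_normal w pt = - g1 * \<tau> z + \<phi> z * c"
    unfolding g unit_normal_pt by (simp add: c_def)
  have "(norm (grad U pt))\<^sup>2 = g1\<^sup>2 + (norm g2)\<^sup>2" unfolding g by (simp add: norm_Pair)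
  moreover have "g1\<^sup>2 - (- g1 * \<tau> z + \<phi> z * c)\<^sup>2 = (\<phi> z * g1 + \<tau> z * c)\<^sup>2 - c\<^sup>2"
  proof -
    have "g1\<^sup>2 - (- g1 * \<tau> z + \<phi> z * c)\<^sup>2 - ((\<phi> z * g1 + \<tau> z * c)\<^sup>2 - c\<^sup>2) =
        (g1\<^sup>2 + c\<^sup>2) * (1 - ((\<phi> z)\<^sup>2 + (\<tau> z)\<^sup>2))" by (simp add: power2_eq_square algebra_simps)
    then show ?thesis using pyth[OF z] by simp
  qed
  ultimately show ?thesis unfolding tang_grad_sq_def i by (simp add: g c_def)
qed

lemma unit_normal_derivative:
  "(unit_normal w has_derivative (\<lambda>h. (K * fst h, (K * \<tau> z / \<phi> z * fst h) *\<^sub>R \<theta> +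
      (\<phi> z / w z) *\<^sub>R (snd h - (\<theta> \<bullet> snd h) *\<^sub>R \<theta>)))) (at pt)"
proof -
  have "((\<lambda>p. \<tau> (fst p)) has_derivative (\<lambda>h. - K * fst h)) (at pt)"
    by (rule has_derivative_compose_fst) (simp add: d\<tau> pt_def)
  then have t: "((\<lambda>p. - \<tau> (fst p)) has_derivative (\<lambda>h. K * fst h)) (at pt)"
    using has_derivative_minus[of "\<lambda>p. \<tau> (fst p)" "\<lambda>h. - K * fst h" "at pt"] by simp
  have f: "((\<lambda>p. \<phi> (fst p)) has_derivative (\<lambda>h. K * \<tau> z / \<phi> z * fst h)) (at pt)"
    by (rule has_derivative_compose_fst) (simp add: d\<phi> pt_def)
  have s: "((\<lambda>p::real \<times> (real^'n). snd p /\<^sub>R norm (snd p)) has_derivative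
     (\<lambda>h. snd h /\<^sub>R w z - ((\<theta> \<bullet> snd h) / w z) *\<^sub>R \<theta>)) (at pt)"
  proof -
    have "((\<lambda>x. x /\<^sub>R norm x) has_derivative (\<lambda>h. h /\<^sub>R w z - ((\<theta> \<bullet> h) / w z) *\<^sub>R \<theta>)) (at (snd pt))"
      using has_derivative_normalize[OF pt_y(1)] unfolding pt_y(2) unfolding pt_y(3) pt_def snd_conv .
    from has_derivative_compose[OF has_derivative_snd[OF has_derivative_ident] this] show ?thesis .
  qed
  have \<theta>e: "snd pt /\<^sub>R norm (snd pt) = \<theta>" "fst pt = z" unfolding pt_def snd_conv pt_y(2) by simp_all
  have "((\<lambda>p. (- \<tau> (fst p), \<phi> (fst p) *\<^sub>R (snd p /\<^sub>R norm (snd p)))) has_derivative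
     (\<lambda>h. (K * fst h, \<phi> z *\<^sub>R (snd h /\<^sub>R w z - ((\<theta> \<bullet> snd h) / w z) *\<^sub>R \<theta>) + (K * \<tau> z / \<phi> z * fst h) *\<^sub>R \<theta>))) (at pt)"
    using has_derivative_Pair[OF t has_derivative_scaleR[OF f s]] unfolding \<theta>e .
  then have D: "((\<lambda>p. (- \<tau> (fst p), \<phi> (fst p) *\<^sub>R (snd p /\<^sub>R norm (snd p)))) has_derivative
     (\<lambda>h. (K * fst h, (K * \<tau> z / \<phi> z * fst h) *\<^sub>R \<theta> +
      (\<phi> z / w z) *\<^sub>R (snd h - (\<theta> \<bullet> snd h) *\<^sub>R \<theta>)))) (at pt)"
    by (rule has_derivative_eq_rhs) (auto simp: fun_eq_iff scaleR_diff_right divide_inverse mult_ac)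
  show ?thesis
  proof (rule has_derivative_transform_within_open[OF D])
    show "open ({a<..<b} \<times> (- {0 :: real^'n}))" by (intro open_Times) auto
    show "pt \<in> {a<..<b} \<times> - {0}" using z pt_y(1) by (simp add: pt_def)
    fix p assume p: "p \<in> {a<..<b} \<times> - {0 :: real^'n}"
    then have "a < fst p" "fst p < b" "snd p \<noteq> 0" by auto
    from unit_normal_eq[OF this]
    show "(- \<tau> (fst p), \<phi> (fst p) *\<^sub>R (snd p /\<^sub>R norm (snd p))) = unit_normal w p" by simp
  qed
qed

text \<open>The shape operator has eigenvalue \<open>K\<close> along the meridian and
  \<open>\<phi> / w\<close> on the n - 1 directions of the parallel. The sum runs over the ambient
  standard basis, where the meridian term splits into \<open>\<phi>^2 K^2\<close> from the axis
  vector and \<open>\<tau>^2 K^2\<close> from the others.\<close>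

lemma sff_sq_pt: "sff_sq w pt = K\<^sup>2 + (real CARD('n) - 1) * (\<phi> z / w z)\<^sup>2"
proof -
  define f t k2 where "f = \<phi> z" and "t = \<tau> z" and "k2 = \<phi> z / w z"
  have ft: "f * f + t * t = 1" using pyth[OF z] by (simp add: f_def t_def power2_eq_square)
  have f0: "f \<noteq> 0" using \<phi>pos[OF z] by (simp add: f_def)
  define A where "A h = (K * fst h, (K * t / f * fst h) *\<^sub>R \<theta> + k2 *\<^sub>R (snd h - (\<theta> \<bullet> snd h) *\<^sub>R \<theta>))" for h :: "real \<times> (real^'n)"
  have fr: "frechet_derivative (unit_normal w) (at pt) = A"
    using frechet_derivative_at[OF unit_normal_derivative] by (simp add: A_def[abs_def] f_def t_def k2_def)
  have \<theta>2: "\<theta> \<bullet> \<theta> = 1" using \<theta> by (simp add: norm_eq_1)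
  define N where "N = (- t, f *\<^sub>R \<theta>)"
  have un: "unit_normal w pt = N" by (simp add: unit_normal_pt N_def f_def t_def)
  have first: "(norm (A ((1, 0) - ((1, 0) \<bullet> N) *\<^sub>R N)))\<^sup>2 = f\<^sup>2 * K\<^sup>2"
  proof -
    have "(1, 0) - ((1, 0) \<bullet> N) *\<^sub>R N = (f * f, (t * f) *\<^sub>R \<theta>)"
      using ft by (simp add: N_def algebra_simps)
    moreover have "A (f * f, (t * f) *\<^sub>R \<theta>) = (K * f * f, (K * t * f) *\<^sub>R \<theta>)"
      using f0 by (simp add: A_def \<theta>2)
    ultimately have "(norm (A ((1, 0) - ((1, 0) \<bullet> N) *\<^sub>R N)))\<^sup>2 = (K * f * f)\<^sup>2 + (K * t * f)\<^sup>2"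
      using \<theta> by (simp add: norm_Pair power_mult_distrib)
    also have "\<dots> = K\<^sup>2 * f\<^sup>2 * (f * f + t * t)" by (simp add: power2_eq_square algebra_simps)
    finally show ?thesis by (simp add: ft mult.commute)
  qed
  have second: "(norm (A ((0, e) - ((0, e) \<bullet> N) *\<^sub>R N)))\<^sup>2 = (\<theta> \<bullet> e)\<^sup>2 * (t\<^sup>2 * K\<^sup>2) + k2\<^sup>2 * (1 - (\<theta> \<bullet> e)\<^sup>2)"
    if e: "norm e = 1" for e :: "real^'n"
  proof -
    define c where "c = \<theta> \<bullet> e"
    have e2: "e \<bullet> e = 1" using e by (simp add: norm_eq_1)
    have ip: "(0, e) \<bullet> N = f * c" by (simp add: N_def c_def inner_commute)
    have "(0, e) - ((0, e) \<bullet> N) *\<^sub>R N = (f * c * t, e - (f * c * f) *\<^sub>R \<theta>)"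
      unfolding ip by (simp add: N_def)
    moreover have "A (f * c * t, e - (f * c * f) *\<^sub>R \<theta>) = (K * t * c * f, (K * t * t * c) *\<^sub>R \<theta> + k2 *\<^sub>R (e - c *\<^sub>R \<theta>))"
    proof -
      have "(e - (f * c * f) *\<^sub>R \<theta>) - (\<theta> \<bullet> (e - (f * c * f) *\<^sub>R \<theta>)) *\<^sub>R \<theta> = e - c *\<^sub>R \<theta>"
        by (simp add: inner_diff_right \<theta>2 c_def[symmetric] scaleR_left_diff_distrib)
      then show ?thesis using f0 by (simp add: A_def mult_ac)
    qed
    ultimately have "(norm (A ((0, e) - ((0, e) \<bullet> N) *\<^sub>R N)))\<^sup>2 =
        (K * t * c * f)\<^sup>2 + (norm ((K * t * t * c) *\<^sub>R \<theta> + k2 *\<^sub>R (e - c *\<^sub>R \<theta>)))\<^sup>2"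
      by (simp add: norm_Pair)
    also have "(norm ((K * t * t * c) *\<^sub>R \<theta> + k2 *\<^sub>R (e - c *\<^sub>R \<theta>)))\<^sup>2 = (K * t * t * c)\<^sup>2 + k2\<^sup>2 * (1 - c\<^sup>2)"
    proof -
      define v where "v = e - c *\<^sub>R \<theta>"
      have ec: "e \<bullet> \<theta> = c" "\<theta> \<bullet> e = c" by (simp_all add: c_def inner_commute)
      have "\<theta> \<bullet> v = 0" "v \<bullet> \<theta> = 0" "v \<bullet> v = 1 - c\<^sup>2"
        unfolding v_def by (simp_all add: inner_diff_right inner_diff_left \<theta>2 e2 ec power2_eq_square)
      then show ?thesis unfolding power2_norm_eq_inner v_def[symmetric]
        by (simp add: inner_add_left inner_add_right \<theta>2 power2_eq_square)
    qed
    also have "(K * t * c * f)\<^sup>2 + ((K * t * t * c)\<^sup>2 + k2\<^sup>2 * (1 - c\<^sup>2)) = c\<^sup>2 * (t\<^sup>2 * K\<^sup>2) * (f * f + t * t) + k2\<^sup>2 * (1 - c\<^sup>2)"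
      by (simp add: power2_eq_square algebra_simps)
    finally show ?thesis by (simp add: ft c_def)
  qed
  have s1: "(\<Sum>e\<in>(Basis :: (real^'n) set). (\<theta> \<bullet> e)\<^sup>2) = 1"
    using euclidean_inner[of \<theta> \<theta>] \<theta>2 by (simp add: power2_eq_square)
  have "sff_sq w pt = (\<Sum>e\<in>(Basis :: real set). (norm (A ((e, 0) - ((e, 0) \<bullet> N) *\<^sub>R N)))\<^sup>2) +
     (\<Sum>e\<in>(Basis :: (real^'n) set). (norm (A ((0, e) - ((0, e) \<bullet> N) *\<^sub>R N)))\<^sup>2)"
    unfolding sff_sq_def fr un by (rule sum_Basis_prod)
  also have "\<dots> = f\<^sup>2 * K\<^sup>2 + (\<Sum>e\<in>(Basis :: (real^'n) set). (\<theta> \<bullet> e)\<^sup>2 * (t\<^sup>2 * K\<^sup>2) + k2\<^sup>2 * (1 - (\<theta> \<bullet> e)\<^sup>2))"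
    using sum.cong[OF refl second[OF norm_Basis], of Basis] by (simp add: first)
  also have "(\<Sum>e\<in>(Basis :: (real^'n) set). (\<theta> \<bullet> e)\<^sup>2 * (t\<^sup>2 * K\<^sup>2) + k2\<^sup>2 * (1 - (\<theta> \<bullet> e)\<^sup>2)) =
      t\<^sup>2 * K\<^sup>2 + k2\<^sup>2 * (real CARD('n) - 1)"
    by (simp add: sum.distrib sum_subtractf s1 flip: sum_distrib_left sum_distrib_right)
  also have "f\<^sup>2 * K\<^sup>2 + (t\<^sup>2 * K\<^sup>2 + k2\<^sup>2 * (real CARD('n) - 1)) = K\<^sup>2 * (f * f + t * t) + (real CARD('n) - 1) * k2\<^sup>2"
    by (simp add: power2_eq_square algebra_simps)
  finally show ?thesis by (simp add: ft k2_def)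
qed

end

section \<open>Integration over spheres\<close>

lemma sphere_int_cong:
  fixes f g :: "real^'n \<Rightarrow> real"
  assumes "\<And>\<theta>. norm \<theta> = 1 \<Longrightarrow> f \<theta> = g \<theta>"
  shows "sphere_int f = sphere_int g"
proof -
  have "integral (ball 0 1) (\<lambda>x. f (x /\<^sub>R norm x)) = integral (ball 0 1) (\<lambda>x. g (x /\<^sub>R norm x))"
    by (rule integral_spike[of "{0}"]) (use assms in auto)
  then show ?thesis by (simp add: sphere_int_def)
qed

context
  fixes f g :: "real^'n \<Rightarrow> real"
  assumes f: "continuous_on (sphere 0 1) f" and g: "continuous_on (sphere 0 1) g"
begin

lemma sphere_int_add: "sphere_int (\<lambda>x. f x + g x) = sphere_int f + sphere_int g"
  unfolding sphere_int_lborel(2)[OF f] sphere_int_lborel(2)[OF g] sphere_int_lborel(2)[OF continuous_on_add[OF f g]]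
  by (simp add: distrib_left sphere_int_lborel(1)[OF f] sphere_int_lborel(1)[OF g])

lemma sphere_int_mono:
  assumes "\<And>\<theta>. norm \<theta> = 1 \<Longrightarrow> f \<theta> \<le> g \<theta>"
  shows "sphere_int f \<le> sphere_int g"
proof -
  have "(\<integral>x. indicator (ball 0 1) x * f (x /\<^sub>R norm x) \<partial>lborel) \<le> (\<integral>x. indicator (ball 0 1) x * g (x /\<^sub>R norm x) \<partial>lborel)"
  proof (rule integral_mono_AE)
    show "AE x in lborel. indicator (ball 0 1) x * f (x /\<^sub>R norm x) \<le> indicator (ball 0 1) x * g (x /\<^sub>R norm x)"
      using AE_norm_neq[of 0] by eventually_elim (use assms in \<open>auto simp: indicator_def\<close>)
  qed (rule sphere_int_lborel(1)[OF f] sphere_int_lborel(1)[OF g])+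
  then show ?thesis
    unfolding sphere_int_lborel(2)[OF f] sphere_int_lborel(2)[OF g] by (rule mult_left_mono) simp
qed

end

lemma sphere_int_cmult:
  fixes f :: "real^'n \<Rightarrow> real"
  shows "sphere_int (\<lambda>x. c * f x) = c * sphere_int f"
  by (simp add: sphere_int_def)

lemma sphere_int_1_pos: "0 < sphere_int (\<lambda>x::real^'n. 1)"
  unfolding sphere_int_lborel(2)[OF continuous_on_const]
  by (simp add: content_ball_pos)

lemma sphere_int_diff:
  fixes f g :: "real^'n \<Rightarrow> real"
  assumes f: "continuous_on (sphere 0 1) f" and g: "continuous_on (sphere 0 1) g"
  shows "sphere_int (\<lambda>x. f x - g x) = sphere_int f - sphere_int g"
  using sphere_int_add[OF f continuous_on_minus[OF g]] sphere_int_cmult[of "- 1" g] by simp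

lemma sphere_int_nonneg:
  fixes f :: "real^'n \<Rightarrow> real"
  assumes "continuous_on (sphere 0 1) f" "\<And>\<theta>. norm \<theta> = 1 \<Longrightarrow> 0 \<le> f \<theta>"
  shows "0 \<le> sphere_int f"
  using sphere_int_mono[OF continuous_on_const[of _ 0] assms] by (simp add: sphere_int_def)

lemma continuous_on_slice:
  assumes "continuous_on (A \<times> B) h" "s \<in> A"
  shows "continuous_on B (\<lambda>x. h (s, x))"
  by (rule continuous_on_compose2[OF assms(1)]) (use assms(2) in \<open>auto intro!: continuous_intros\<close>)

lemma continuous_on_sphere_int:
  fixes h :: "real \<times> (real^'n) \<Rightarrow> real"
  assumes h: "continuous_on ({a..b} \<times> sphere 0 1) h"
  shows "continuous_on {a..b} (\<lambda>s. sphere_int (\<lambda>x. h (s, x)))"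
  unfolding continuous_on_iff
proof (intro ballI allI impI)
  fix s :: real and e :: real assume s: "s \<in> {a..b}" and e: "0 < e"
  define S where "S = sphere_int (\<lambda>x::real^'n. 1)"
  have S: "0 < S" unfolding S_def by (rule sphere_int_1_pos)
  have "uniformly_continuous_on ({a..b} \<times> sphere 0 1) h"
    by (intro compact_uniformly_continuous h compact_Times) auto
  then obtain d where d: "0 < d" "\<And>p q. p \<in> {a..b} \<times> sphere 0 1 \<Longrightarrow> q \<in> {a..b} \<times> sphere 0 1 \<Longrightarrow> dist q p < d \<Longrightarrow> dist (h q) (h p) < e / (2 * S)"
    using e S unfolding uniformly_continuous_on_def by (metis divide_pos_pos mult_pos_pos zero_less_numeral)
  have "dist (sphere_int (\<lambda>x. h (s', x))) (sphere_int (\<lambda>x. h (s, x))) < e" if s': "s' \<in> {a..b}" "dist s' s < d" for s'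
  proof -
    have c: "continuous_on (sphere 0 1) (\<lambda>x. h (s', x))" "continuous_on (sphere 0 1) (\<lambda>x. h (s, x))"
      using continuous_on_slice[OF h] s s' by auto
    have b: "\<bar>h (s', x) - h (s, x)\<bar> \<le> e / (2 * S)" if "norm x = 1" for x
      using d(2)[of "(s, x)" "(s', x)"] s s' that by (simp add: dist_Pair_Pair dist_real_def)
    have "sphere_int (\<lambda>x. h (s', x)) - sphere_int (\<lambda>x. h (s, x)) = sphere_int (\<lambda>x. h (s', x) - h (s, x))"
      by (rule sphere_int_diff[OF c, symmetric])
    moreover have "sphere_int (\<lambda>x. h (s', x) - h (s, x)) \<le> sphere_int (\<lambda>x::real^'n. e / (2 * S) * 1)"
      by (rule sphere_int_mono) (use b in \<open>auto intro!: continuous_intros c simp: abs_le_iff\<close>)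
    moreover have "sphere_int (\<lambda>x::real^'n. (- e / (2 * S)) * 1) \<le> sphere_int (\<lambda>x. h (s', x) - h (s, x))"
      by (rule sphere_int_mono) (use b in \<open>auto intro!: continuous_intros c simp: abs_le_iff\<close>, smt (verit) b)
    ultimately have "\<bar>sphere_int (\<lambda>x. h (s', x)) - sphere_int (\<lambda>x. h (s, x))\<bar> \<le> e / 2"
      unfolding sphere_int_cmult S_def[symmetric] using S by (simp add: abs_le_iff)
    then show ?thesis using e by (simp add: dist_real_def)
  qed
  then show "\<exists>d>0. \<forall>s'\<in>{a..b}. dist s' s < d \<longrightarrow> dist (sphere_int (\<lambda>x. h (s', x))) (sphere_int (\<lambda>x. h (s, x))) < e"
    using d(1) by blast
qed

lemma sphere_int_Fubini:
  fixes h :: "real \<times> (real^'n) \<Rightarrow> real"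
  assumes h: "continuous_on ({a..b} \<times> sphere 0 1) h"
  shows "continuous_on (sphere 0 1) (\<lambda>x. integral {a..b} (\<lambda>s. h (s, x)))"
    and "integral {a..b} (\<lambda>s. sphere_int (\<lambda>x. h (s, x))) = sphere_int (\<lambda>x. integral {a..b} (\<lambda>s. h (s, x)))"
proof -
  have swap: "continuous_on (sphere 0 1 \<times> {a..b}) (\<lambda>p. h (snd p, fst p))"
    by (rule continuous_on_compose2[OF h]) (auto intro!: continuous_intros)
  have "continuous_on (sphere 0 1) (\<lambda>x. integral (cbox a b) (\<lambda>s. h (s, x)))"
    by (rule integral_continuous_on_param) (use swap in \<open>simp add: split_beta'\<close>)
  then show ci: "continuous_on (sphere 0 1) (\<lambda>x. integral {a..b} (\<lambda>s. h (s, x)))" by simp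
  have "bounded (h ` ({a..b} \<times> sphere 0 1))"
    by (intro compact_imp_bounded compact_continuous_image h compact_Times) auto
  then obtain C where C: "\<And>s x. s \<in> {a..b} \<Longrightarrow> norm x = 1 \<Longrightarrow> \<bar>h (s, x)\<bar> \<le> C" unfolding bounded_iff by force
  \<comment> \<open>The centre is removed because normalisation is discontinuous there; on the
    punctured ball the integrand is continuous, hence measurable.\<close>
  define B where "B = ball 0 1 - {0 :: real^'n}"
  define f where "f = (\<lambda>s x. indicator {a..b} s * (indicator B x * h (s, x /\<^sub>R norm x)))"
  have AB: "{a..b} \<times> B \<in> sets (borel :: (real \<times> (real^'n)) measure)"
    unfolding B_def by (intro borel_Times) auto
  have cont: "continuous_on ({a..b} \<times> B) (\<lambda>p. h (fst p, snd p /\<^sub>R norm (snd p)))"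
    by (rule continuous_on_compose2[OF h]) (auto simp: B_def intro!: continuous_intros)
  have fm: "case_prod f \<in> borel_measurable borel"
  proof -
    have "(\<lambda>p. indicator ({a..b} \<times> B) p *\<^sub>R h (fst p, snd p /\<^sub>R norm (snd p))) \<in> borel_measurable borel"
      by (rule borel_measurable_continuous_on_indicator[OF AB cont])
    moreover have "(\<lambda>p. indicator ({a..b} \<times> B) p *\<^sub>R h (fst p, snd p /\<^sub>R norm (snd p))) = case_prod f"
      by (auto simp: f_def fun_eq_iff indicator_def)
    ultimately show ?thesis by simp
  qed
  have int: "integrable (lborel \<Otimes>\<^sub>M lborel) (case_prod f)"
  proof (rule Bochner_Integration.integrable_bound[where f = "\<lambda>p. indicator ({a..b} \<times> ball 0 1) p * C"])
    have "emeasure (lborel \<Otimes>\<^sub>M lborel) ({a..b} \<times> ball 0 1 :: (real \<times> (real^'n)) set) < \<infinity>"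
      by (subst lborel.emeasure_pair_measure_Times) (auto simp: emeasure_ball ennreal_mult_less_top emeasure_lborel_Icc_eq)
    then show "integrable (lborel \<Otimes>\<^sub>M lborel) (\<lambda>p. indicator ({a..b} \<times> ball 0 1 :: (real \<times> (real^'n)) set) p * C)"
      by (intro integrable_mult_left integrable_real_indicator pair_measureI) auto
    show "case_prod f \<in> borel_measurable (lborel \<Otimes>\<^sub>M lborel)" using fm by (simp add: lborel_prod)
    have "norm (f s x) \<le> norm (indicator ({a..b} \<times> ball 0 1) (s, x) * C)" for s x
      using C[of s "x /\<^sub>R norm x"] by (auto simp: f_def B_def indicator_def)
    then show "AE p in lborel \<Otimes>\<^sub>M lborel. norm (case_prod f p) \<le> norm (indicator ({a..b} \<times> ball 0 1 :: (real \<times> (real^'n)) set) p * C)"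
      by (intro AE_I2) auto
  qed
  have inner_x: "(\<integral>x. f s x \<partial>lborel) = indicator {a..b} s * (sphere_int (\<lambda>x. h (s, x)) / CARD('n))" for s
  proof (cases "s \<in> {a..b}")
    case True
    then have c: "continuous_on (sphere 0 1) (\<lambda>x. h (s, x))" using continuous_on_slice[OF h] by auto
    have "(\<integral>x. f s x \<partial>lborel) = (\<integral>x. indicator (ball 0 1) x * h (s, x /\<^sub>R norm x) \<partial>lborel)"
    proof (rule integral_cong_AE)
      have "(\<lambda>x. case_prod f (s, x)) \<in> borel_measurable borel"
        by (rule measurable_compose[OF borel_measurable_continuous_onI fm]) (intro continuous_intros)
      then show "f s \<in> borel_measurable lborel" by simp
      show "(\<lambda>x. indicator (ball 0 1) x * h (s, x /\<^sub>R norm x)) \<in> borel_measurable lborel"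
        using sphere_int_lborel(1)[OF c] by auto
      show "AE x in lborel. f s x = indicator (ball 0 1) x * h (s, x /\<^sub>R norm x)"
        using AE_norm_neq[of 0] by eventually_elim (use True in \<open>auto simp: f_def B_def indicator_def\<close>)
    qed
    then show ?thesis using sphere_int_lborel(2)[OF c] True by simp
  qed (simp add: f_def)
  have inner_s: "(\<integral>s. f s x \<partial>lborel) = indicator B x * integral {a..b} (\<lambda>s. h (s, x /\<^sub>R norm x))" for x
  proof (cases "x \<in> B")
    case True
    then have n1: "norm (x /\<^sub>R norm x) = 1" by (simp add: B_def)
    have "continuous_on {a..b} (\<lambda>s. h (s, x /\<^sub>R norm x))"
      by (rule continuous_on_compose2[OF h]) (use n1 in \<open>auto intro!: continuous_intros\<close>)
    from integral_indicator_Icc[OF this] show ?thesis using True by (simp add: f_def)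
  qed (simp add: f_def)
  have "integral {a..b} (\<lambda>s. sphere_int (\<lambda>x. h (s, x))) = (\<integral>s. indicator {a..b} s * sphere_int (\<lambda>x. h (s, x)) \<partial>lborel)"
    by (rule integral_indicator_Icc[symmetric]) (rule continuous_on_sphere_int[OF h])
  also have "\<dots> = (\<integral>s. CARD('n) * (\<integral>x. f s x \<partial>lborel) \<partial>lborel)" unfolding inner_x by simp
  also have "\<dots> = CARD('n) * (\<integral>s. (\<integral>x. f s x \<partial>lborel) \<partial>lborel)" by simp
  also have "(\<integral>s. (\<integral>x. f s x \<partial>lborel) \<partial>lborel) = (\<integral>x. (\<integral>s. f s x \<partial>lborel) \<partial>lborel)"
    by (rule lborel_pair.Fubini_integral[OF int, symmetric])
  also have "\<dots> = (\<integral>x. indicator (ball 0 1) x * integral {a..b} (\<lambda>s. h (s, x /\<^sub>R norm x)) \<partial>lborel)"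
    unfolding inner_s
  proof (rule integral_cong_AE)
    show m: "(\<lambda>x. indicator (ball 0 1) x * integral {a..b} (\<lambda>s. h (s, x /\<^sub>R norm x))) \<in> borel_measurable lborel"
      using sphere_int_lborel(1)[OF ci] by auto
    show "AE x in lborel. indicator B x * integral {a..b} (\<lambda>s. h (s, x /\<^sub>R norm x)) =
        indicator (ball 0 1) x * integral {a..b} (\<lambda>s. h (s, x /\<^sub>R norm x))"
      using AE_norm_neq[of 0] by eventually_elim (auto simp: B_def indicator_def)
    have "(\<lambda>x. indicator (- {0}) x * (indicator (ball 0 1) x * integral {a..b} (\<lambda>s. h (s, x /\<^sub>R norm x)))) \<in> borel_measurable lborel"
      by (rule borel_measurable_times[OF _ m]) simp
    moreover have "(\<lambda>x. indicator (- {0}) x * (indicator (ball 0 1) x * integral {a..b} (\<lambda>s. h (s, x /\<^sub>R norm x)))) =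
       (\<lambda>x. indicator B x * integral {a..b} (\<lambda>s. h (s, x /\<^sub>R norm x)))"
      by (auto simp: B_def indicator_def fun_eq_iff)
    ultimately show "(\<lambda>x. indicator B x * integral {a..b} (\<lambda>s. h (s, x /\<^sub>R norm x))) \<in> borel_measurable lborel" by simp
  qed
  finally show "integral {a..b} (\<lambda>s. sphere_int (\<lambda>x. h (s, x))) = sphere_int (\<lambda>x. integral {a..b} (\<lambda>s. h (s, x)))"
    unfolding sphere_int_lborel(2)[OF ci] by simp
qed

section \<open>Smooth functions and polynomial approximation\<close>

lemma smooth_fun_grad:
  fixes U :: "'a::euclidean_space \<Rightarrow> real"
  assumes "smooth_fun U"
  shows "(U has_derivative (\<lambda>h. grad U x \<bullet> h)) (at x)" "continuous_on UNIV (grad U)" "continuous_on UNIV U"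
proof -
  have C1: "Ck (Suc 0) U" using assms by (simp add: smooth_fun_def)
  then have d: "(U has_derivative frechet_derivative U (at x)) (at x)" for x
    using frechet_derivative_works by auto
  have "frechet_derivative U (at x) h = grad U x \<bullet> h" for h
  proof -
    have lin: "linear (frechet_derivative U (at x))" using d has_derivative_linear by blast
    have "frechet_derivative U (at x) h = frechet_derivative U (at x) (\<Sum>b\<in>Basis. (h \<bullet> b) *\<^sub>R b)"
      by (simp add: euclidean_representation)
    also have "\<dots> = (\<Sum>b\<in>Basis. (h \<bullet> b) * frechet_derivative U (at x) b)"
      by (simp add: linear_sum[OF lin] linear_scale[OF lin])
    also have "\<dots> = grad U x \<bullet> h" by (simp add: grad_def inner_sum_left mult.commute inner_commute[of h])
    finally show ?thesis .
  qed
  then have "frechet_derivative U (at x) = (\<lambda>h. grad U x \<bullet> h)" by auto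
  with d[of x] show "(U has_derivative (\<lambda>h. grad U x \<bullet> h)) (at x)" by simp
  show "continuous_on UNIV (grad U)"
    unfolding grad_def using C1 by (intro continuous_intros) auto
  show "continuous_on UNIV U" using assms by (auto simp: smooth_fun_def dest: spec[of _ 0])
qed

lemma has_derivative_poly_fst:
  "((\<lambda>p. poly q (fst p)) has_derivative (\<lambda>h. poly (pderiv q) (fst p) * fst h)) (at p)"
  for p :: "real \<times> 'a::euclidean_space"
  by (rule has_derivative_compose_fst) (rule poly_DERIV)

text \<open>Polynomials in the height serve as test functions since their partial derivatives are
  again of this form, so the induction on the order closes.\<close>

lemma smooth_poly_fst: "smooth_fun (\<lambda>p :: real \<times> 'a::euclidean_space. poly q (fst p))"
  unfolding smooth_fun_def
proof
  fix k
  show "Ck k (\<lambda>p :: real \<times> 'a. poly q (fst p))"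
  proof (induction k arbitrary: q)
    case 0
    show ?case by (auto intro!: continuous_intros)
  next
    case (Suc k)
    have "frechet_derivative (\<lambda>p :: real \<times> 'a. poly q (fst p)) (at x) = (\<lambda>h. poly (pderiv q) (fst x) * fst h)" for x
      by (rule frechet_derivative_at[OF has_derivative_poly_fst, symmetric])
    then have eq: "(\<lambda>x. frechet_derivative (\<lambda>p :: real \<times> 'a. poly q (fst p)) (at x) b) = (\<lambda>x. poly (smult (fst b) (pderiv q)) (fst x))" for b
      by (simp add: mult.commute)
    show ?case
      unfolding Ck.simps eq
    proof (intro conjI allI ballI)
      show "(\<lambda>p :: real \<times> 'a. poly q (fst p)) differentiable at x" for x
        by (rule differentiableI[OF has_derivative_poly_fst])
    qed (rule Suc.IH)
  qed
qed

text \<open>Weierstrass approximation is applied to the derivative and then integrated, starting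
  from the exact value at 0; this controls function and derivative together.\<close>

lemma poly_C1_approximation:
  fixes u u' :: "real \<Rightarrow> real"
  assumes P: "0 < P" and cu: "continuous_on {0..P} u" and cu': "continuous_on {0..P} u'"
    and du: "\<And>z. 0 < z \<Longrightarrow> z < P \<Longrightarrow> (u has_real_derivative u' z) (at z)" and e: "0 < e"
  shows "\<exists>q. \<forall>z\<in>{0..P}. \<bar>poly q z - u z\<bar> \<le> e \<and> \<bar>poly (pderiv q) z - u' z\<bar> \<le> e"
proof -
  \<comment> \<open>Dividing by \<open>P + 1\<close> makes the error at most \<open>e\<close> both
    for the derivative and after integration over a length of at most \<open>P\<close>.\<close>
  define e' where "e' = e / (P + 1)"
  have e': "0 < e'" "e' \<le> e" "e' * P \<le> e" using P e by (simp_all add: e'_def field_simps)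
  obtain g where g: "real_polynomial_function g" "\<And>z. z \<in> {0..P} \<Longrightarrow> \<bar>u' z - g z\<bar> < e'"
    using Stone_Weierstrass_real_polynomial_function[OF compact_Icc cu' e'(1)] by auto
  obtain a N where ga: "g = (\<lambda>x. \<Sum>i\<le>N. a i * x ^ i)"
    using g(1) real_polynomial_function_iff_sum by blast
  define q where "q = [:u 0:] + (\<Sum>i\<le>N. monom (a i / (real i + 1)) (Suc i))"
  have "pderiv (\<Sum>i\<le>N. monom (a i / (real i + 1)) (Suc i)) = (\<Sum>i\<le>N. monom (a i) i)"
    by (induction N) (simp_all add: pderiv_add pderiv_monom add.commute)
  then have "pderiv q = (\<Sum>i\<le>N. monom (a i) i)"
    by (simp add: q_def pderiv_add pderiv_pCons)
  then have pd: "poly (pderiv q) z = g z" for z by (simp add: ga poly_sum poly_monom)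
  have q0: "poly q 0 = u 0" by (simp add: q_def poly_sum poly_monom)
  have "\<bar>poly q z - u z\<bar> \<le> e" if z: "z \<in> {0..P}" for z
  proof -
    have bnd: "s * (poly q z - u z) \<le> e' * z" if s: "s = 1 \<or> s = - 1" for s :: real
    proof -
      have "s * (poly q z - u z) - s * (poly q 0 - u 0) \<le> integral {0..z} (\<lambda>x. e')"
      proof (rule integral_ge_boundary_diff)
        show "continuous_on {0..z} (\<lambda>x. s * (poly q x - u x))"
          using z by (intro continuous_intros continuous_on_subset[OF cu]) auto
        fix x assume x: "0 < x" "x < z"
        have "((\<lambda>x. s * (poly q x - u x)) has_real_derivative s * (g x - u' x)) (at x)"
          using DERIV_cmult[OF DERIV_diff[OF poly_DERIV[of q x] du[of x]], of s] x z by (simp add: pd)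
        moreover have "s * (g x - u' x) \<le> e'" using g(2)[of x] x z s by auto
        ultimately show "\<exists>y. ((\<lambda>x. s * (poly q x - u x)) has_real_derivative y) (at x) \<and> y \<le> e'" by blast
      qed (use z in auto)
      then show ?thesis using z q0 by (simp add: mult.commute)
    qed
    have "e' * z \<le> e' * P" using z e' by (intro mult_left_mono) auto
    with bnd[of 1] bnd[of "- 1"] e'(3) show ?thesis by (simp add: abs_le_iff)
  qed
  moreover have "\<bar>poly (pderiv q) z - u' z\<bar> \<le> e" if "z \<in> {0..P}" for z
    using g(2)[OF that] e'(2) by (simp add: pd abs_minus_commute)
  ultimately show ?thesis by blast
qed

section \<open>Polynomial test functions for the quadratic form\<close>

context profile
begin

lemma C1_poly: "C1 (poly g) (poly (pderiv g))"
  unfolding C1_def by (auto intro!: continuous_intros poly_DERIV)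

text \<open>Only an upper bound is wanted, to preserve negativity, so the term
  \<open>- q f^2\<close> is dropped. The bound \<open>e <= 1\<close> makes the remaining quadratic
  term linear in \<open>e\<close>.\<close>

lemma bil_le:
  assumes u: "C1 u u'" and f: "C1 f f'" and e: "0 \<le> e" "e \<le> 1"
    and b: "\<And>z. z \<in> {0..P} \<Longrightarrow> \<bar>f z\<bar> \<le> e" "\<And>z. z \<in> {0..P} \<Longrightarrow> \<bar>f' z\<bar> \<le> e"
  shows "bil (\<lambda>z. u z + f z) (\<lambda>z. u' z + f' z) (\<lambda>z. u z + f z) (\<lambda>z. u' z + f' z) \<le>
    bil u u' u u' + e * integral {0..P} (\<lambda>z. 2 * (p z * \<bar>u' z\<bar> + q z * \<bar>u z\<bar>) + p z)"
proof -
  have cu: "continuous_on {0..P} u" "continuous_on {0..P} u'" "continuous_on {0..P} f" "continuous_on {0..P} f'"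
    using u f by (auto simp: C1_def)
  have "integral {0..P} (\<lambda>z. p z * (u' z + f' z) * (u' z + f' z) - q z * (u z + f z) * (u z + f z)) \<le>
     integral {0..P} (\<lambda>z. (p z * u' z * u' z - q z * u z * u z) + e * (2 * (p z * \<bar>u' z\<bar> + q z * \<bar>u z\<bar>) + p z))"
  proof (rule integral_le)
    fix z assume z: "z \<in> {0..P}"
    have p0: "0 \<le> p z" and q0: "0 \<le> q z" using pos_coeffs[OF z] by auto
    have 1: "u' z * f' z \<le> e * \<bar>u' z\<bar>" "- (u z * f z) \<le> e * \<bar>u z\<bar>"
      using abs_ge_self[of "u' z * f' z"] abs_ge_minus_self[of "u z * f z"]
        mult_left_mono[OF b(2)[OF z], of "\<bar>u' z\<bar>"] mult_left_mono[OF b(1)[OF z], of "\<bar>u z\<bar>"]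
      by (simp_all add: abs_mult mult.commute)
    have 2: "f' z * f' z \<le> e"
    proof -
      have "\<bar>f' z\<bar> * \<bar>f' z\<bar> \<le> e * 1" using b(2)[OF z] e by (intro mult_mono) auto
      then show ?thesis by simp
    qed
    have "p z * (u' z + f' z) * (u' z + f' z) - q z * (u z + f z) * (u z + f z) =
       (p z * u' z * u' z - q z * u z * u z) + 2 * (p z * (u' z * f' z)) + 2 * (q z * - (u z * f z)) + p z * (f' z * f' z) - q z * (f z * f z)"
      by (simp add: algebra_simps)
    also have "\<dots> \<le> (p z * u' z * u' z - q z * u z * u z) + 2 * (p z * (e * \<bar>u' z\<bar>)) + 2 * (q z * (e * \<bar>u z\<bar>)) + p z * e - 0"
      using mult_left_mono[OF 1(1) p0] mult_left_mono[OF 1(2) q0] mult_left_mono[OF 2 p0] mult_nonneg_nonneg[OF q0, of "f z * f z"]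
      by auto
    finally show "p z * (u' z + f' z) * (u' z + f' z) - q z * (u z + f z) * (u z + f z) \<le>
       (p z * u' z * u' z - q z * u z * u z) + e * (2 * (p z * \<bar>u' z\<bar> + q z * \<bar>u z\<bar>) + p z)"
      by (simp add: algebra_simps)
  qed (intro integrable_continuous_real continuous_intros cu cont_coeffs)+
  also have "\<dots> = bil u u' u u' + e * integral {0..P} (\<lambda>z. 2 * (p z * \<bar>u' z\<bar> + q z * \<bar>u z\<bar>) + p z)"
    unfolding bil_def
    by (subst Henstock_Kurzweil_Integration.integral_add)
       (auto intro!: integrable_continuous_real continuous_intros cu cont_coeffs)
  finally show ?thesis by (simp add: bil_def)
qed

lemma poly_test_function:
  assumes u: "C1 u u'" and mean: "integral {0..P} (\<lambda>z. m z * u z) = 0" and neg: "bil u u' u u' < 0"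
  shows "\<exists>G. integral {0..P} (\<lambda>z. m z * poly G z) = 0 \<and> bil (poly G) (poly (pderiv G)) (poly G) (poly (pderiv G)) < 0"
proof -
  have cu: "continuous_on {0..P} u" "continuous_on {0..P} u'" using u by (auto simp: C1_def)
  define K where "K = integral {0..P} (\<lambda>z. 2 * (p z * \<bar>u' z\<bar> + q z * \<bar>u z\<bar>) + p z)"
  have K0: "0 \<le> K" unfolding K_def
  proof (rule Henstock_Kurzweil_Integration.integral_nonneg)
    show "(\<lambda>z. 2 * (p z * \<bar>u' z\<bar> + q z * \<bar>u z\<bar>) + p z) integrable_on {0..P}"
      by (intro integrable_continuous_real continuous_intros cu cont_coeffs)
    show "0 \<le> 2 * (p z * \<bar>u' z\<bar> + q z * \<bar>u z\<bar>) + p z" if "z \<in> {0..P}" for z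
      using pos_coeffs[OF that] by simp
  qed
  \<comment> \<open>Small enough that the perturbation \<open>e * K\<close> stays below the margin
    \<open>- bil u u' u u'\<close>; the 1 in \<open>K + 1\<close> excludes division by zero.\<close>
  define e where "e = min 1 (- bil u u' u u' / (2 * (K + 1)))"
  have "0 < - bil u u' u u' / (2 * (K + 1))" using neg K0 by (intro divide_pos_pos) auto
  then have e: "0 < e" "e \<le> 1" by (simp_all add: e_def)
  have eK: "e * K < - bil u u' u u'"
  proof -
    have "e \<le> - bil u u' u u' / (2 * (K + 1))" by (simp add: e_def)
    then have "e * (2 * (K + 1)) \<le> - bil u u' u u'" using K0 by (subst (asm) pos_le_divide_eq) auto
    moreover have "e * (2 * (K + 1)) = e * K + e * K + 2 * e" by (simp add: algebra_simps)
    moreover have "0 \<le> e * K" using e K0 by simp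
    ultimately show ?thesis using e by linarith
  qed
  obtain r where r: "\<And>z. z \<in> {0..P} \<Longrightarrow> \<bar>poly r z - u z\<bar> \<le> e / 2" "\<And>z. z \<in> {0..P} \<Longrightarrow> \<bar>poly (pderiv r) z - u' z\<bar> \<le> e / 2"
  proof -
    have "\<exists>r. \<forall>z\<in>{0..P}. \<bar>poly r z - u z\<bar> \<le> e / 2 \<and> \<bar>poly (pderiv r) z - u' z\<bar> \<le> e / 2"
      by (rule poly_C1_approximation[OF P0 cu]) (use u e in \<open>auto simp: C1_def\<close>)
    then show thesis using that by blast
  qed
  define mu where "mu = integral {0..P} (\<lambda>z. m z * 1)"
  have mi: "m integrable_on {0..P}" by (intro integrable_continuous_real cont_coeffs)
  have mu: "0 < mu"
  proof -
    obtain z0 where z0: "z0 \<in> {0..P}" "\<And>z. z \<in> {0..P} \<Longrightarrow> m z0 \<le> m z"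
      using continuous_attains_inf[OF compact_Icc _ cont_coeffs(4)] P0 by auto
    have "integral {0..P} (\<lambda>z. m z0) \<le> integral {0..P} m"
      by (rule integral_le) (use z0 mi in auto)
    moreover have "0 < P * m z0" using pos_coeffs(2)[OF z0(1)] P0 by simp
    ultimately show ?thesis using P0 by (simp add: mu_def)
  qed
  \<comment> \<open>Subtracting the weighted mean restores mean zero. As \<open>u\<close> has mean
    zero, \<open>c\<close> is at most \<open>e / 2\<close>, which is why the approximation was made
    to within \<open>e / 2\<close>.\<close>
  define c where "c = integral {0..P} (\<lambda>z. m z * poly r z) / mu"
  have C1c: "C1 (\<lambda>z. 1) (\<lambda>z. 0)" by (auto simp: C1_def)
  have cb: "\<bar>c\<bar> \<le> e / 2"
  proof -
    have i: "(\<lambda>z. m z * v z) integrable_on {0..P}" if "continuous_on {0..P} v" for v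
      by (intro integrable_continuous_real continuous_intros cont_coeffs that)
    have "integral {0..P} (\<lambda>z. m z * poly r z) - integral {0..P} (\<lambda>z. m z * u z) =
        integral {0..P} (\<lambda>z. m z * poly r z - m z * u z)"
      by (rule Henstock_Kurzweil_Integration.integral_diff[symmetric]) (intro i continuous_intros cu)+
    then have "\<bar>integral {0..P} (\<lambda>z. m z * poly r z)\<bar> = norm (integral {0..P} (\<lambda>z. m z * (poly r z - u z)))"
      by (simp add: mean right_diff_distrib)
    also have "\<dots> \<le> integral {0..P} (\<lambda>z. e / 2 * (m z * 1))"
    proof (rule integral_norm_bound_integral)
      show "norm (m z * (poly r z - u z)) \<le> e / 2 * (m z * 1)" if "z \<in> {0..P}" for z
        using r(1)[OF that] pos_coeffs(2)[OF that] mult_left_mono[OF r(1)[OF that], of "m z"] by (simp add: abs_mult mult.commute)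
    qed (intro integrable_continuous_real continuous_intros cu cont_coeffs)+
    finally have "\<bar>integral {0..P} (\<lambda>z. m z * poly r z)\<bar> \<le> e / 2 * mu" by (simp add: mu_def)
    then show ?thesis using mu by (simp add: c_def pos_divide_le_eq)
  qed
  define G where "G = r + [:- c:]"
  have Gp: "poly G z = 1 * poly r z + (- c) * 1" "pderiv G = pderiv r" for z
    by (simp_all add: G_def pderiv_add pderiv_pCons)
  have "integral {0..P} (\<lambda>z. m z * poly G z) = 0"
    unfolding Gp(1) mean_add[OF C1_poly C1c] using mu by (simp add: c_def mu_def)
  moreover have "bil (poly G) (poly (pderiv G)) (poly G) (poly (pderiv G)) < 0"
  proof -
    define f where "f z = 1 * poly G z + (- 1) * u z" for z
    define f' where "f' z = 1 * poly (pderiv G) z + (- 1) * u' z" for z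
    have Cf: "C1 f f'" unfolding f_def f'_def by (rule C1_lin[OF C1_poly u])
    have fb: "\<bar>f z\<bar> \<le> e" if z: "z \<in> {0..P}" for z
    proof -
      have "f z = (poly r z - u z) - c" by (simp add: f_def Gp)
      then show ?thesis using r(1)[OF z] cb abs_triangle_ineq4[of "poly r z - u z" c] by simp
    qed
    have fb': "\<bar>f' z\<bar> \<le> e" if z: "z \<in> {0..P}" for z
    proof -
      have "f' z = poly (pderiv r) z - u' z" by (simp add: f'_def Gp)
      then show ?thesis using r(2)[OF z] e by simp
    qed
    have "poly G = (\<lambda>z. u z + f z)" "poly (pderiv G) = (\<lambda>z. u' z + f' z)" by (auto simp: f_def f'_def)
    then have "bil (poly G) (poly (pderiv G)) (poly G) (poly (pderiv G)) \<le> bil u u' u u' + e * K"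
      using bil_le[OF u Cf _ e(2) fb fb'] e(1) by (simp add: K_def)
    then show ?thesis using eK by simp
  qed
  ultimately show ?thesis by blast
qed

end

section \<open>Reduction of the stability form to the profile curve\<close>

context
  fixes nn :: nat and t d :: real
  assumes nn: "CARD('n::finite) = nn" and card: "2 \<le> nn" and t0: "0 < t" and t1: "t < 1" and d: "0 < d"
begin

interpretation pr: profile nn "QQ nn t" t "Pf nn t" "wp nn t" "ph nn t" "ta nn t"
  by (rule profile_inst[OF card t0 t1])

interpretation pv: profile_variation nn "QQ nn t" t "Pf nn t" "wp nn t" "ph nn t" "ta nn t"
    "u1f nn t" "u1d nn t" "QQd nn t" "Pd nn t"
  by (rule variation_inst[OF card t0 t1])

text \<open>The scale between the normalised profile, of maximal radius 1 and height
  \<open>Pf nn t\<close>, and the unduloid in the slab.\<close>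

definition lam :: real where "lam = d / Pf nn t"

lemma lam_pos: "0 < lam" using d pr.P0 by (simp add: lam_def)

lemma lam_interior: "0 < z \<Longrightarrow> z < d \<Longrightarrow> 0 < z / lam \<and> z / lam < Pf nn t"
  using d pr.P0 by (simp add: lam_def field_simps)

lemma vprof_lam: "z \<in> {0..d} \<Longrightarrow> vprof nn d t z = lam * wp nn t (z / lam)"
  using vprof_eq[OF card t0 d] by (simp add: lam_def wp_def mult.commute)

lemma scaled_deriv:
  assumes "(f has_real_derivative D) (at (z / lam))"
  shows "((\<lambda>z. f (z / lam)) has_real_derivative D / lam) (at z)"
  using DERIV_chain2[where f = f and g = "\<lambda>z. z / lam", OF assms DERIV_cdivide[OF DERIV_ident]] by simp

lemma vprof_deriv:
  assumes z: "0 < z" "z < d"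
  shows "(vprof nn d t has_real_derivative ta nn t (z / lam) / ph nn t (z / lam)) (at z)"
proof -
  have "((\<lambda>z. lam * wp nn t (z / lam)) has_real_derivative
     lam * (ta nn t (z / lam) / ph nn t (z / lam) / lam)) (at z)"
    using lam_interior[OF z] by (intro DERIV_cmult scaled_deriv pr.dw) auto
  then have "((\<lambda>z. lam * wp nn t (z / lam)) has_real_derivative ta nn t (z / lam) / ph nn t (z / lam)) (at z)"
    using lam_pos by simp
  then show ?thesis
    by (rule has_field_derivative_transform_within_open[of _ _ _ "{0<..<d}"]) (use z vprof_lam in auto)
qed

lemma revolution_inst:
  fixes \<theta> :: "real^'n"
  assumes z: "0 < z" "z < d" and \<theta>: "norm \<theta> = 1"
  shows "revolution (vprof nn d t) (\<lambda>z. ph nn t (z / lam)) (\<lambda>z. ta nn t (z / lam)) 0 d z (pr.k1 (z / lam) / lam) \<theta>"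
proof
  show "((\<lambda>z. ta nn t (z / lam)) has_real_derivative - (pr.k1 (z / lam) / lam)) (at z)"
    using scaled_deriv[OF pr.dk1(3)] lam_interior[OF z] by fastforce
  show "((\<lambda>z. ph nn t (z / lam)) has_real_derivative pr.k1 (z / lam) / lam * ta nn t (z / lam) / ph nn t (z / lam)) (at z)"
    using scaled_deriv[OF pr.dk1(2)[of "z / lam"]] lam_interior[OF z] by (simp add: mult.commute)
  show "0 < vprof nn d t z" using vprof_lam[of z] z lam_pos pr.w0[of "z / lam"] lam_interior[OF z] by simp
qed (use z \<theta> vprof_deriv lam_interior in \<open>auto intro!: pr.\<phi>0 pr.pyth less_imp_le\<close>)

lemma surf_int_eq:
  fixes F :: "real \<times> (real^'n) \<Rightarrow> real"
  assumes H: "continuous_on {0..Pf nn t} H"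
    and FH: "\<And>y. 0 < y \<Longrightarrow> y < Pf nn t \<Longrightarrow> sphere_int (\<lambda>\<theta>. F (lam * y, (lam * wp nn t y) *\<^sub>R \<theta>)) = H y"
  shows "surf_int (vprof nn d t) d F = lam ^ nn * integral {0..Pf nn t} (\<lambda>y. pr.m y * H y)"
proof -
  have "continuous_on {0..Pf nn t} (\<lambda>y. pr.m y * H y)" by (intro continuous_intros pr.cont_coeffs H)
  then have "((\<lambda>y. pr.m y * H y) has_integral integral {0..Pf nn t} (\<lambda>y. pr.m y * H y)) (cbox 0 (Pf nn t))"
    by (simp add: integrable_integral integrable_continuous_real)
  from has_integral_affinity[OF this, of "1 / lam" 0]
  have "((\<lambda>z. pr.m (z / lam) * H (z / lam)) has_integral lam * integral {0..Pf nn t} (\<lambda>y. pr.m y * H y)) ((\<lambda>x. lam * x) ` {0..Pf nn t})"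
    using lam_pos by (simp add: image_affinity_atLeastAtMost)
  moreover have "(\<lambda>x. lam * x) ` {0..Pf nn t} = {0..d}"
    using lam_pos pr.P0 image_affinity_atLeastAtMost[of lam 0 0 "Pf nn t"] by (simp add: lam_def)
  ultimately have "((\<lambda>z. lam ^ (nn - 1) * (pr.m (z / lam) * H (z / lam))) has_integral
      lam ^ (nn - 1) * (lam * integral {0..Pf nn t} (\<lambda>y. pr.m y * H y))) {0..d}"
    by (intro has_integral_mult_right) simp
  then have I: "integral {0..d} (\<lambda>z. lam ^ (nn - 1) * (pr.m (z / lam) * H (z / lam))) = lam ^ nn * integral {0..Pf nn t} (\<lambda>y. pr.m y * H y)"
    using card power_minus_mult[of nn lam] by (simp add: integral_unique mult.assoc[symmetric])
  have "surf_int (vprof nn d t) d F = integral {0..d} (\<lambda>z. lam ^ (nn - 1) * (pr.m (z / lam) * H (z / lam)))"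
    unfolding surf_int_def nn
  \<comment> \<open>At the two ends \<open>deriv\<close> of the profile has no controlled value, so
    they are discarded as a null set.\<close>
  proof (rule integral_spike[of "{0, d}"])
    fix z assume "z \<in> {0..d} - {0, d}"
    then have z: "0 < z" "z < d" by auto
    define y where "y = z / lam"
    have y: "0 < y" "y < Pf nn t" using lam_interior[OF z] by (simp_all add: y_def)
    have zy: "z = lam * y" using lam_pos by (simp add: y_def)
    have v: "vprof nn d t z = lam * wp nn t y" using vprof_lam[of z] z by (simp add: y_def)
    have ph0: "0 < ph nn t y" using pr.\<phi>0[of y] y by simp
    have "1 + (deriv (vprof nn d t) z)\<^sup>2 = 1 + (ta nn t y / ph nn t y)\<^sup>2"
      using DERIV_imp_deriv[OF vprof_deriv[OF z]] by (simp add: y_def)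
    also have "\<dots> = (1 / ph nn t y)\<^sup>2" using pr.pyth[of y] y ph0 by (simp add: field_simps)
    finally have s: "sqrt (1 + (deriv (vprof nn d t) z)\<^sup>2) = 1 / ph nn t y"
      using ph0 by (simp only: real_sqrt_abs) simp
    show "lam ^ (nn - 1) * (pr.m (z / lam) * H (z / lam)) =
      vprof nn d t z ^ (nn - 1) * sqrt (1 + (deriv (vprof nn d t) z)\<^sup>2) * sphere_int (\<lambda>\<theta>. F (z, vprof nn d t z *\<^sub>R \<theta>))"
      unfolding s v FH[OF y, folded zy] y_def[symmetric]
      by (simp add: pr.m_def power_mult_distrib)
  qed auto
  then show ?thesis using I by simp
qed

section \<open>Pullback of the stability form to the cylinder\<close>

context
  fixes U :: "real \<times> (real^'n) \<Rightarrow> real"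
  assumes U: "smooth_fun U"
begin

definition pos :: "real \<times> (real^'n) \<Rightarrow> real \<times> (real^'n)" where
  "pos q = (lam * fst q, (lam * wp nn t (fst q)) *\<^sub>R snd q)"

definition uu :: "real \<times> (real^'n) \<Rightarrow> real" where
  "uu q = U (pos q)"

text \<open>The derivative of \<open>uu\<close> along the axis, by the chain rule with slope
  \<open>\<tau> / \<phi>\<close>; written through \<open>grad U\<close> it is jointly continuous up
  to the ends.\<close>

definition vv :: "real \<times> (real^'n) \<Rightarrow> real" where
  "vv q = lam * (fst (grad U (pos q)) + ta nn t (fst q) / ph nn t (fst q) * (snd (grad U (pos q)) \<bullet> snd q))"

text \<open>The squared gradient of \<open>uu\<close> along the unit sphere divided by
  \<open>w^2\<close>, expressed through the ambient gradient.\<close>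

definition tt :: "real \<times> (real^'n) \<Rightarrow> real" where
  "tt q = lam\<^sup>2 * ((norm (snd (grad U (pos q))))\<^sup>2 - (snd (grad U (pos q)) \<bullet> snd q)\<^sup>2)"

abbreviation (input) "cyl \<equiv> {0..Pf nn t} \<times> sphere (0::real^'n) 1"

lemma cont_fst: "continuous_on {0..Pf nn t} f \<Longrightarrow> continuous_on cyl (\<lambda>q. f (fst q))"
  for f :: "real \<Rightarrow> real"
  by (rule continuous_on_compose2[where g = f]) (auto intro!: continuous_intros)

lemma cont_pos: "continuous_on cyl pos"
  unfolding pos_def by (intro continuous_intros cont_fst pr.cw)

lemma cont_uu: "continuous_on cyl uu" "continuous_on cyl vv" "continuous_on cyl tt"
proof -
  note cU = continuous_on_compose2[OF smooth_fun_grad(3)[OF U] cont_pos subset_UNIV]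
    continuous_on_compose2[OF smooth_fun_grad(2)[OF U] cont_pos subset_UNIV]
  show "continuous_on cyl uu" unfolding uu_def by (rule cU)
  show "continuous_on cyl vv" unfolding vv_def
    by (intro continuous_intros cU cont_fst pr.c\<tau> pr.c\<phi> ballI) (use pr.nz in auto)
  show "continuous_on cyl tt" unfolding tt_def by (intro continuous_intros cU)
qed

lemma uu_C1:
  assumes \<theta>: "norm \<theta> = 1"
  shows "pr.C1 (\<lambda>y. uu (y, \<theta>)) (\<lambda>y. vv (y, \<theta>))"
  unfolding pr.C1_def
proof (intro conjI allI impI)
  have sl: "continuous_on {0..Pf nn t} (\<lambda>y. h (y, \<theta>))" if "continuous_on cyl h" for h :: "_ \<Rightarrow> real"
    by (rule continuous_on_compose2[OF that]) (use \<theta> in \<open>auto intro!: continuous_intros\<close>)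
  show "continuous_on {0..Pf nn t} (\<lambda>y. uu (y, \<theta>))" "continuous_on {0..Pf nn t} (\<lambda>y. vv (y, \<theta>))"
    by (rule sl, rule cont_uu)+
  fix y assume y: "0 < y" "y < Pf nn t"
  define D where "D = ta nn t y / ph nn t y"
  have a: "((\<lambda>y. lam * y) has_derivative (\<lambda>h. lam * h)) (at y)" by (auto intro!: derivative_eq_intros)
  have b: "((\<lambda>y. (lam * wp nn t y) *\<^sub>R \<theta>) has_derivative (\<lambda>h. (lam * (D * h)) *\<^sub>R \<theta>)) (at y)"
    using pr.dw[OF y] unfolding has_field_derivative_def D_def[symmetric]
    by (auto intro!: derivative_eq_intros)
  have "((\<lambda>y. U (lam * y, (lam * wp nn t y) *\<^sub>R \<theta>)) has_derivative
     (\<lambda>h. grad U (lam * y, (lam * wp nn t y) *\<^sub>R \<theta>) \<bullet> (lam * h, (lam * (D * h)) *\<^sub>R \<theta>))) (at y)"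
    by (rule has_derivative_compose[OF has_derivative_Pair[OF a b] smooth_fun_grad(1)[OF U]])
  then have "((\<lambda>y. uu (y, \<theta>)) has_derivative (\<lambda>h. vv (y, \<theta>) * h)) (at y)"
    unfolding uu_def pos_def fst_conv snd_conv
    by (rule has_derivative_eq_rhs)
       (simp add: vv_def pos_def D_def[symmetric] inner_prod_def fun_eq_iff algebra_simps)
  then show "((\<lambda>y. uu (y, \<theta>)) has_real_derivative vv (y, \<theta>)) (at y)"
    unfolding has_field_derivative_def by (rule has_derivative_eq_rhs) auto
qed

lemma mean_eq:
  "surf_int (vprof nn d t) d U = lam ^ nn * integral {0..Pf nn t} (\<lambda>y. pr.m y * sphere_int (\<lambda>\<theta>. uu (y, \<theta>)))"
  by (rule surf_int_eq[OF continuous_on_sphere_int[OF cont_uu(1)]]) (simp add: uu_def pos_def)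

lemma square_eq:
  "surf_int (vprof nn d t) d (\<lambda>p. (U p)\<^sup>2) = lam ^ nn * integral {0..Pf nn t} (\<lambda>y. pr.m y * sphere_int (\<lambda>\<theta>. (uu (y, \<theta>))\<^sup>2))"
  by (rule surf_int_eq[OF continuous_on_sphere_int]) (auto simp: uu_def pos_def intro!: continuous_intros cont_uu(1)[unfolded uu_def pos_def])

text \<open>Both squared lengths in the integrand scale like an inverse square, hence the factor
  \<open>1 / lam^2\<close>. The weights arise from \<open>m \<phi>^2 = p\<close> and from
  \<open>q\<close> as \<open>m\<close> times the squared second fundamental form.\<close>

lemma form_eq:
  "surf_int (vprof nn d t) d (\<lambda>p. tang_grad_sq (vprof nn d t) U p - sff_sq (vprof nn d t) p * (U p)\<^sup>2) =
   lam ^ nn / lam\<^sup>2 * integral {0..Pf nn t} (\<lambda>y. pr.p y * sphere_int (\<lambda>\<theta>. (vv (y, \<theta>))\<^sup>2)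
      + pr.m y * sphere_int (\<lambda>\<theta>. tt (y, \<theta>)) - pr.q y * sphere_int (\<lambda>\<theta>. (uu (y, \<theta>))\<^sup>2))"
proof -
  define A where "A y = (pr.k1 y)\<^sup>2 + (real nn - 1) * (pr.k2 y)\<^sup>2" for y
  have cA: "continuous_on {0..Pf nn t} A" unfolding A_def by (intro continuous_intros pr.cont_coeffs)
  define h where "h q = (1 / lam\<^sup>2) * (((ph nn t (fst q))\<^sup>2 * (vv q)\<^sup>2 + tt q) - A (fst q) * (uu q)\<^sup>2)" for q
  have ch: "continuous_on cyl h"
    unfolding h_def by (intro continuous_intros cont_uu cont_fst pr.c\<phi> cA)
  have sl: "continuous_on (sphere 0 1) (\<lambda>\<theta>. f (y, \<theta>))" if "continuous_on cyl f" "y \<in> {0..Pf nn t}" for f :: "_ \<Rightarrow> real" and y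
    by (rule continuous_on_slice[OF that])
  have "surf_int (vprof nn d t) d (\<lambda>p. tang_grad_sq (vprof nn d t) U p - sff_sq (vprof nn d t) p * (U p)\<^sup>2) =
    lam ^ nn * integral {0..Pf nn t} (\<lambda>y. pr.m y * sphere_int (\<lambda>\<theta>. h (y, \<theta>)))"
  proof (rule surf_int_eq[OF continuous_on_sphere_int[OF ch]], rule sphere_int_cong)
    fix y and \<theta> :: "real^'n" assume y: "0 < y" "y < Pf nn t" and \<theta>: "norm \<theta> = 1"
    define z where "z = lam * y"
    have zy: "z / lam = y" using lam_pos by (simp add: z_def)
    have z: "0 < z" "z < d" using y lam_pos d pr.P0 by (simp_all add: z_def lam_def field_simps)
    interpret rv: revolution "vprof nn d t" "\<lambda>z. ph nn t (z / lam)" "\<lambda>z. ta nn t (z / lam)" 0 d z "pr.k1 (z / lam) / lam" \<theta>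
      by (rule revolution_inst[OF z \<theta>])
    have v: "vprof nn d t z = lam * wp nn t y" using vprof_lam[of z] z by (simp add: zy)
    have pt: "rv.pt = pos (y, \<theta>)" unfolding rv.pt_def pos_def v by (simp add: z_def)
    have ph0: "ph nn t y \<noteq> 0" using pr.nz(2)[of y] y by simp
    have s: "sff_sq (vprof nn d t) (pos (y, \<theta>)) = A y / lam\<^sup>2"
      using rv.sff_sq_pt lam_pos unfolding nn pt v zy A_def pr.k2_def
      by (simp add: power_divide power_mult_distrib add_divide_distrib mult.commute)
    have g: "tang_grad_sq (vprof nn d t) U (pos (y, \<theta>)) = (1 / lam\<^sup>2) * ((ph nn t y)\<^sup>2 * (vv (y, \<theta>))\<^sup>2 + tt (y, \<theta>))"
    proof -
      define g1 g2 where "g1 = fst (grad U (pos (y, \<theta>)))" and "g2 = snd (grad U (pos (y, \<theta>)))"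
      have "ph nn t y * vv (y, \<theta>) = lam * (ph nn t y * g1 + ta nn t y * (g2 \<bullet> \<theta>))"
        using ph0 by (simp add: vv_def g1_def g2_def algebra_simps)
      then have "(ph nn t y)\<^sup>2 * (vv (y, \<theta>))\<^sup>2 = lam\<^sup>2 * (ph nn t y * g1 + ta nn t y * (g2 \<bullet> \<theta>))\<^sup>2"
        by (metis power_mult_distrib)
      moreover have "tt (y, \<theta>) = lam\<^sup>2 * ((norm g2)\<^sup>2 - (g2 \<bullet> \<theta>)\<^sup>2)" by (simp add: tt_def g2_def)
      moreover have "tang_grad_sq (vprof nn d t) U (pos (y, \<theta>)) =
          (ph nn t y * g1 + ta nn t y * (g2 \<bullet> \<theta>))\<^sup>2 + ((norm g2)\<^sup>2 - (g2 \<bullet> \<theta>)\<^sup>2)"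
        using rv.tang_grad_sq_pt[of U] unfolding pt zy g1_def g2_def .
      ultimately show ?thesis using lam_pos by (simp add: distrib_left[symmetric])
    qed
    have "tang_grad_sq (vprof nn d t) U (pos (y, \<theta>)) - sff_sq (vprof nn d t) (pos (y, \<theta>)) * (U (pos (y, \<theta>)))\<^sup>2 = h (y, \<theta>)"
      unfolding s g h_def by (simp add: uu_def right_diff_distrib)
    then show "tang_grad_sq (vprof nn d t) U (lam * y, (lam * wp nn t y) *\<^sub>R \<theta>) -
       sff_sq (vprof nn d t) (lam * y, (lam * wp nn t y) *\<^sub>R \<theta>) * (U (lam * y, (lam * wp nn t y) *\<^sub>R \<theta>))\<^sup>2 = h (y, \<theta>)"
      by (simp add: pos_def)
  qed
  also have "integral {0..Pf nn t} (\<lambda>y. pr.m y * sphere_int (\<lambda>\<theta>. h (y, \<theta>))) =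
     integral {0..Pf nn t} (\<lambda>y. 1 / lam\<^sup>2 * (pr.p y * sphere_int (\<lambda>\<theta>. (vv (y, \<theta>))\<^sup>2)
      + pr.m y * sphere_int (\<lambda>\<theta>. tt (y, \<theta>)) - pr.q y * sphere_int (\<lambda>\<theta>. (uu (y, \<theta>))\<^sup>2)))"
  proof (rule integral_cong)
    fix y assume y: "y \<in> {0..Pf nn t}"
    have c: "continuous_on (sphere 0 1) (\<lambda>\<theta>. (vv (y, \<theta>))\<^sup>2)" "continuous_on (sphere 0 1) (\<lambda>\<theta>. tt (y, \<theta>))"
      "continuous_on (sphere 0 1) (\<lambda>\<theta>. (uu (y, \<theta>))\<^sup>2)"
      by (intro continuous_intros sl[OF cont_uu(1) y] sl[OF cont_uu(2) y] sl[OF cont_uu(3) y])+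
    have "sphere_int (\<lambda>\<theta>. h (y, \<theta>)) = 1 / lam\<^sup>2 * (((ph nn t y)\<^sup>2 * sphere_int (\<lambda>\<theta>. (vv (y, \<theta>))\<^sup>2)
        + sphere_int (\<lambda>\<theta>. tt (y, \<theta>))) - A y * sphere_int (\<lambda>\<theta>. (uu (y, \<theta>))\<^sup>2))"
      unfolding h_def fst_conv sphere_int_cmult
      by (subst sphere_int_diff, (intro continuous_intros c)+, subst sphere_int_add, (intro continuous_intros c)+)
         (simp add: sphere_int_cmult)
    moreover have "pr.m y * (ph nn t y)\<^sup>2 = pr.p y" using pr.nz(2)[OF y] by (simp add: pr.m_def pr.p_def power2_eq_square)
    moreover have "pr.m y * A y = pr.q y" by (simp add: pr.q_def A_def)
    moreover have "M * (1 / L * ((F * a + b) - AA * c)) = 1 / L * ((M * F) * a + M * b - (M * AA) * c)" for M L F a b AA c :: real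
      by (simp add: algebra_simps)
    ultimately show "pr.m y * sphere_int (\<lambda>\<theta>. h (y, \<theta>)) = 1 / lam\<^sup>2 * (pr.p y * sphere_int (\<lambda>\<theta>. (vv (y, \<theta>))\<^sup>2)
      + pr.m y * sphere_int (\<lambda>\<theta>. tt (y, \<theta>)) - pr.q y * sphere_int (\<lambda>\<theta>. (uu (y, \<theta>))\<^sup>2))" by (simp only:)
  qed
  finally show ?thesis by simp
qed

text \<open>\<open>U\<close> is split on each parallel into its spherical mean \<open>u0\<close> and
  a remainder \<open>g\<close>. The two parts are orthogonal there, so their forms add:
  \<open>stable_form\<close> handles \<open>u0\<close>, and the Poincare inequality reduces
  \<open>g\<close> to \<open>nonradial_form\<close>.\<close>

lemma form_nonneg:
  assumes V: "0 < pv.V1" and mean: "surf_int (vprof nn d t) d U = 0"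
  shows "0 \<le> surf_int (vprof nn d t) d (\<lambda>p. tang_grad_sq (vprof nn d t) U p - sff_sq (vprof nn d t) p * (U p)\<^sup>2)"
proof -
  define S where "S = sphere_int (\<lambda>x::real^'n. 1)"
  have S: "0 < S" unfolding S_def by (rule sphere_int_1_pos)
  define u0 where "u0 y = sphere_int (\<lambda>\<theta>. uu (y, \<theta>)) / S" for y
  define u0' where "u0' y = sphere_int (\<lambda>\<theta>. vv (y, \<theta>)) / S" for y
  have cu0: "continuous_on {0..Pf nn t} u0" "continuous_on {0..Pf nn t} u0'"
    unfolding u0_def u0'_def using S
    by (intro continuous_intros continuous_on_sphere_int[OF cont_uu(1)] continuous_on_sphere_int[OF cont_uu(2)]; simp)+
  have sl: "continuous_on (sphere 0 1) (\<lambda>\<theta>. f (y, \<theta>))" if "continuous_on cyl f" "y \<in> {0..Pf nn t}" for f :: "_ \<Rightarrow> real" and y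
    by (rule continuous_on_slice[OF that])
  \<comment> \<open>Writing \<open>u0\<close> as an integral by Fubini replaces differentiation
    under the sphere integral: its derivative then comes from the fundamental theorem.\<close>
  have u0_int: "u0 y = u0 0 + integral {0..y} u0'" if y: "y \<in> {0..Pf nn t}" for y
  proof -
    have c: "continuous_on ({0..y} \<times> sphere 0 1) vv"
      by (rule continuous_on_subset[OF cont_uu(2)]) (use y in auto)
    have "sphere_int (\<lambda>\<theta>. uu (y, \<theta>)) - sphere_int (\<lambda>\<theta>. uu (0, \<theta>)) = sphere_int (\<lambda>\<theta>. uu (y, \<theta>) - uu (0, \<theta>))"
      by (rule sphere_int_diff[symmetric]) (use y in \<open>auto intro!: sl cont_uu\<close>)
    also have "\<dots> = sphere_int (\<lambda>\<theta>. integral {0..y} (\<lambda>s. vv (s, \<theta>)))"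
    proof (rule sphere_int_cong)
      fix \<theta> :: "real^'n" assume \<theta>: "norm \<theta> = 1"
      show "uu (y, \<theta>) - uu (0, \<theta>) = integral {0..y} (\<lambda>s. vv (s, \<theta>))"
        using uu_C1[OF \<theta>] y unfolding pr.C1_def
        by (intro integral_eq_boundary_diff[symmetric]) (auto intro: continuous_on_subset)
    qed
    also have "\<dots> = integral {0..y} (\<lambda>s. sphere_int (\<lambda>\<theta>. vv (s, \<theta>)))"
      by (rule sphere_int_Fubini(2)[OF c, symmetric])
    finally have "sphere_int (\<lambda>\<theta>. uu (y, \<theta>)) = sphere_int (\<lambda>\<theta>. uu (0, \<theta>)) + integral {0..y} (\<lambda>s. sphere_int (\<lambda>\<theta>. vv (s, \<theta>)))"
      by (simp add: diff_eq_eq add.commute)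
    then show ?thesis by (simp add: u0_def u0'_def[abs_def] add_divide_distrib)
  qed
  have C0: "pr.C1 u0 u0'"
    unfolding pr.C1_def
  proof (intro conjI allI impI cu0)
    fix y assume y: "0 < y" "y < Pf nn t"
    have "((\<lambda>y. u0 0 + integral {0..y} u0') has_real_derivative 0 + u0' y) (at y)"
      by (intro DERIV_add DERIV_const DERIV_indef[OF cu0(2) y])
    then have "((\<lambda>y. u0 0 + integral {0..y} u0') has_real_derivative u0' y) (at y)" by simp
    then show "(u0 has_real_derivative u0' y) (at y)"
    proof (rule has_field_derivative_transform_within_open[of _ _ _ "{0<..<Pf nn t}"])
      show "u0 0 + integral {0..x} u0' = u0 x" if "x \<in> {0<..<Pf nn t}" for x
        by (rule u0_int[symmetric]) (use that in auto)
    qed (use y in auto)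
  qed
  have i0: "integral {0..Pf nn t} (\<lambda>y. pr.m y * sphere_int (\<lambda>\<theta>. uu (y, \<theta>))) = 0"
    using mean lam_pos unfolding mean_eq mult_eq_0_iff by auto
  have "(\<lambda>y. pr.m y * u0 y) = (\<lambda>y. 1 / S * (pr.m y * sphere_int (\<lambda>\<theta>. uu (y, \<theta>))))"
    by (auto simp: u0_def)
  then have "integral {0..Pf nn t} (\<lambda>y. pr.m y * u0 y) = 0"
    using integral_mult_right[of "{0..Pf nn t}" "1 / S" "\<lambda>y. pr.m y * sphere_int (\<lambda>\<theta>. uu (y, \<theta>))"] i0 by (simp only: mult_zero_right)
  from pv.stable_form[OF C0 this V] have rad: "0 \<le> pr.bil u0 u0' u0 u0'" .
  define g where "g q = uu q - u0 (fst q)" for q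
  define g' where "g' q = vv q - u0' (fst q)" for q
  have cg: "continuous_on cyl g" "continuous_on cyl g'"
    unfolding g_def g'_def by (intro continuous_intros cont_uu cont_fst cu0)+
  define k where "k q = pr.p (fst q) * (g' q)\<^sup>2 + ((real nn - 1) * pr.m (fst q) / (wp nn t (fst q))\<^sup>2 - pr.q (fst q)) * (g q)\<^sup>2" for q
  have cc: "continuous_on {0..Pf nn t} (\<lambda>y. (real nn - 1) * pr.m y / (wp nn t y)\<^sup>2 - pr.q y)"
    by (intro continuous_intros pr.cont_coeffs pr.cw ballI) (use pr.nz in auto)
  have ck: "continuous_on cyl k"
    unfolding k_def by (intro continuous_intros cg cont_fst[OF pr.cont_coeffs(3)] cont_fst[OF cc])
  \<comment> \<open>With the integrals exchanged, \<open>nonradial_form\<close> applies along each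
    meridian separately.\<close>
  have nonrad: "0 \<le> integral {0..Pf nn t} (\<lambda>y. sphere_int (\<lambda>\<theta>. k (y, \<theta>)))"
    unfolding sphere_int_Fubini(2)[OF ck]
  proof (rule sphere_int_nonneg[OF sphere_int_Fubini(1)[OF ck]])
    fix \<theta> :: "real^'n" assume \<theta>: "norm \<theta> = 1"
    have "pr.C1 (\<lambda>y. 1 * uu (y, \<theta>) + (- 1) * u0 y) (\<lambda>y. 1 * vv (y, \<theta>) + (- 1) * u0' y)"
      by (rule pr.C1_lin[OF uu_C1[OF \<theta>] C0])
    from pv.nonradial_form[OF this] show "0 \<le> integral {0..Pf nn t} (\<lambda>y. k (y, \<theta>))"
      by (simp add: k_def g_def g'_def)
  qed
  \<comment> \<open>At each height, variance identities split off the means of \<open>uu\<close> and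
    \<open>vv\<close>; the potential \<open>(n - 1) m / w^2\<close> in \<open>k\<close> is what the
    Poincare inequality bounds by the angular energy \<open>tt\<close>.\<close>
  have pw: "S * (pr.p y * u0' y * u0' y - pr.q y * u0 y * u0 y) + sphere_int (\<lambda>\<theta>. k (y, \<theta>)) \<le>
     pr.p y * sphere_int (\<lambda>\<theta>. (vv (y, \<theta>))\<^sup>2) + pr.m y * sphere_int (\<lambda>\<theta>. tt (y, \<theta>)) - pr.q y * sphere_int (\<lambda>\<theta>. (uu (y, \<theta>))\<^sup>2)"
    if y: "y \<in> {0..Pf nn t}" for y
  proof -
    have var: "sphere_int (\<lambda>\<theta>. (f (y, \<theta>))\<^sup>2) = S * c * c + sphere_int (\<lambda>\<theta>. (f (y, \<theta>) - c)\<^sup>2)"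
      if f: "continuous_on cyl f" and c: "c = sphere_int (\<lambda>\<theta>. f (y, \<theta>)) / S" for f :: "_ \<Rightarrow> real" and c
    proof -
      have cf: "continuous_on (sphere 0 1) (\<lambda>\<theta>. f (y, \<theta>))" by (rule sl[OF f y])
      have "sphere_int (\<lambda>\<theta>. (f (y, \<theta>) - c)\<^sup>2) = sphere_int (\<lambda>\<theta>. ((f (y, \<theta>))\<^sup>2 - (2 * c) * f (y, \<theta>)) + c\<^sup>2 * 1)"
        by (rule arg_cong[where f = sphere_int]) (simp add: fun_eq_iff power2_eq_square algebra_simps)
      also have "\<dots> = (sphere_int (\<lambda>\<theta>. (f (y, \<theta>))\<^sup>2) - (2 * c) * sphere_int (\<lambda>\<theta>. f (y, \<theta>))) + c\<^sup>2 * S"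
        by (subst sphere_int_add, (intro continuous_intros cf)+, subst sphere_int_diff, (intro continuous_intros cf)+)
           (simp only: sphere_int_cmult S_def)
      also have "sphere_int (\<lambda>\<theta>. f (y, \<theta>)) = c * S" using c S by simp
      finally show ?thesis by (simp add: power2_eq_square algebra_simps)
    qed
    have w0: "0 < wp nn t y" by (rule pr.w0[OF y])
    have poin: "(real nn - 1) * sphere_int (\<lambda>\<theta>. (g (y, \<theta>))\<^sup>2) \<le> (wp nn t y)\<^sup>2 * sphere_int (\<lambda>\<theta>. tt (y, \<theta>))"
    proof -
      \<comment> \<open>The actual radius of the parallel. Its square divided by the
        \<open>lam^2\<close> contained in \<open>tt\<close> leaves the factor \<open>w^2\<close> of
        the claim.\<close>
      define r where "r = lam * wp nn t y"
      define G where "G x = U (lam * y, r *\<^sub>R x) - u0 y" for x :: "real^'n"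
      define gG where "gG x = r *\<^sub>R snd (grad U (lam * y, r *\<^sub>R x))" for x :: "real^'n"
      have Gg: "G \<theta> = g (y, \<theta>)" for \<theta> by (simp add: G_def g_def uu_def pos_def r_def)
      have "(real nn - 1) * sphere_int (\<lambda>x. (G x)\<^sup>2) \<le> sphere_int (\<lambda>x. (norm (gG x))\<^sup>2 - (gG x \<bullet> x)\<^sup>2)"
      proof (rule sphere_poincare[where 'n = 'n, unfolded nn, OF card])
        fix x :: "real^'n"
        have "((\<lambda>x. (lam * y, r *\<^sub>R x)) has_derivative (\<lambda>h. (0, r *\<^sub>R h))) (at x)"
          by (auto intro!: derivative_eq_intros)
        from has_derivative_compose[OF this smooth_fun_grad(1)[OF U]]
        have "((\<lambda>x. U (lam * y, r *\<^sub>R x)) has_derivative (\<lambda>h. grad U (lam * y, r *\<^sub>R x) \<bullet> (0, r *\<^sub>R h))) (at x)" .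
        from has_derivative_diff[OF this has_derivative_const[of "u0 y"]]
        show "(G has_derivative (\<lambda>h. gG x \<bullet> h)) (at x)"
          unfolding G_def[abs_def] by (rule has_derivative_eq_rhs) (simp add: gG_def inner_prod_def fun_eq_iff)
      next
        have "continuous_on UNIV (\<lambda>x::real^'n. (lam * y, r *\<^sub>R x))" by (intro continuous_intros)
        from continuous_on_compose2[OF smooth_fun_grad(2)[OF U] this subset_UNIV]
        show "continuous_on UNIV gG" unfolding gG_def by (intro continuous_intros)
      next
        have "sphere_int G = sphere_int (\<lambda>\<theta>. uu (y, \<theta>) - u0 y * 1)"
          by (rule arg_cong[where f = sphere_int]) (simp add: fun_eq_iff Gg g_def)
        also have "\<dots> = sphere_int (\<lambda>\<theta>. uu (y, \<theta>)) - u0 y * S"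
          by (subst sphere_int_diff) (simp_all only: sl[OF cont_uu(1) y] continuous_on_const sphere_int_cmult S_def)
        finally show "sphere_int G = 0" using S by (simp add: u0_def)
      qed
      also have "sphere_int (\<lambda>x. (norm (gG x))\<^sup>2 - (gG x \<bullet> x)\<^sup>2) = sphere_int (\<lambda>\<theta>. (wp nn t y)\<^sup>2 * tt (y, \<theta>))"
        by (rule arg_cong[where f = sphere_int])
           (simp add: fun_eq_iff gG_def tt_def pos_def r_def power_mult_distrib algebra_simps)
      finally show ?thesis by (simp add: sphere_int_cmult Gg)
    qed
    have "sphere_int (\<lambda>\<theta>. k (y, \<theta>)) = pr.p y * sphere_int (\<lambda>\<theta>. (g' (y, \<theta>))\<^sup>2) +
        ((real nn - 1) * pr.m y / (wp nn t y)\<^sup>2 - pr.q y) * sphere_int (\<lambda>\<theta>. (g (y, \<theta>))\<^sup>2)"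
      unfolding k_def fst_conv
      by (subst sphere_int_add, (intro continuous_intros sl[OF cg(1) y] sl[OF cg(2) y])+) (simp only: sphere_int_cmult)
    moreover have "(real nn - 1) * pr.m y / (wp nn t y)\<^sup>2 * sphere_int (\<lambda>\<theta>. (g (y, \<theta>))\<^sup>2) \<le> pr.m y * sphere_int (\<lambda>\<theta>. tt (y, \<theta>))"
    proof -
      have "(real nn - 1) * pr.m y / (wp nn t y)\<^sup>2 * sphere_int (\<lambda>\<theta>. (g (y, \<theta>))\<^sup>2) =
         pr.m y / (wp nn t y)\<^sup>2 * ((real nn - 1) * sphere_int (\<lambda>\<theta>. (g (y, \<theta>))\<^sup>2))" by simp
      also have "\<dots> \<le> pr.m y / (wp nn t y)\<^sup>2 * ((wp nn t y)\<^sup>2 * sphere_int (\<lambda>\<theta>. tt (y, \<theta>)))"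
        using pr.pos_coeffs(2)[OF y] by (intro mult_left_mono poin) simp
      finally show ?thesis using w0 by simp
    qed
    moreover have "sphere_int (\<lambda>\<theta>. (vv (y, \<theta>))\<^sup>2) = S * u0' y * u0' y + sphere_int (\<lambda>\<theta>. (g' (y, \<theta>))\<^sup>2)"
      unfolding g'_def fst_conv by (rule var[OF cont_uu(2) u0'_def])
    moreover have "sphere_int (\<lambda>\<theta>. (uu (y, \<theta>))\<^sup>2) = S * u0 y * u0 y + sphere_int (\<lambda>\<theta>. (g (y, \<theta>))\<^sup>2)"
      unfolding g_def fst_conv by (rule var[OF cont_uu(1) u0_def])
    ultimately show ?thesis by (simp add: algebra_simps)
  qed
  have ci: "continuous_on {0..Pf nn t} (\<lambda>y. sphere_int (\<lambda>\<theta>. (vv (y, \<theta>))\<^sup>2))"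
    "continuous_on {0..Pf nn t} (\<lambda>y. sphere_int (\<lambda>\<theta>. tt (y, \<theta>)))"
    "continuous_on {0..Pf nn t} (\<lambda>y. sphere_int (\<lambda>\<theta>. (uu (y, \<theta>))\<^sup>2))"
    "continuous_on {0..Pf nn t} (\<lambda>y. sphere_int (\<lambda>\<theta>. k (y, \<theta>)))"
    by (rule continuous_on_sphere_int; intro continuous_intros cont_uu ck)+
  have "S * pr.bil u0 u0' u0 u0' + integral {0..Pf nn t} (\<lambda>y. sphere_int (\<lambda>\<theta>. k (y, \<theta>))) =
     integral {0..Pf nn t} (\<lambda>y. S * (pr.p y * u0' y * u0' y - pr.q y * u0 y * u0 y) + sphere_int (\<lambda>\<theta>. k (y, \<theta>)))"
    unfolding pr.bil_def
    by (subst Henstock_Kurzweil_Integration.integral_add)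
       (auto intro!: integrable_continuous_real continuous_intros pr.cont_coeffs cu0 ci)
  also have "\<dots> \<le> integral {0..Pf nn t} (\<lambda>y. pr.p y * sphere_int (\<lambda>\<theta>. (vv (y, \<theta>))\<^sup>2)
      + pr.m y * sphere_int (\<lambda>\<theta>. tt (y, \<theta>)) - pr.q y * sphere_int (\<lambda>\<theta>. (uu (y, \<theta>))\<^sup>2))"
    by (rule integral_le) (use pw in \<open>auto intro!: integrable_continuous_real continuous_intros pr.cont_coeffs cu0 ci\<close>)
  finally have "0 \<le> integral {0..Pf nn t} (\<lambda>y. pr.p y * sphere_int (\<lambda>\<theta>. (vv (y, \<theta>))\<^sup>2)
      + pr.m y * sphere_int (\<lambda>\<theta>. tt (y, \<theta>)) - pr.q y * sphere_int (\<lambda>\<theta>. (uu (y, \<theta>))\<^sup>2))"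
    using rad nonrad S mult_nonneg_nonneg[of S "pr.bil u0 u0' u0 u0'"] by linarith
  then show ?thesis unfolding form_eq using lam_pos by (intro mult_nonneg_nonneg) auto
qed

lemma square_nonneg: "0 \<le> surf_int (vprof nn d t) d (\<lambda>p. (U p)\<^sup>2)"
  unfolding square_eq
proof (intro mult_nonneg_nonneg Henstock_Kurzweil_Integration.integral_nonneg)
  have c2: "continuous_on cyl (\<lambda>q. (uu q)\<^sup>2)" by (intro continuous_intros cont_uu)
  show "(\<lambda>y. pr.m y * sphere_int (\<lambda>\<theta>. (uu (y, \<theta>))\<^sup>2)) integrable_on {0..Pf nn t}"
    by (intro integrable_continuous_real continuous_intros pr.cont_coeffs continuous_on_sphere_int[OF c2])
  fix y assume y: "y \<in> {0..Pf nn t}"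
  show "0 \<le> pr.m y" using pr.pos_coeffs(2)[OF y] by simp
  show "0 \<le> sphere_int (\<lambda>\<theta>. (uu (y, \<theta>))\<^sup>2)"
    by (rule sphere_int_nonneg[OF continuous_on_slice[OF c2 y]]) simp
qed (use lam_pos in simp)

end

section \<open>From the sign of \<open>V1\<close> to stability and instability\<close>

lemma stable_of_V1_pos:
  assumes "0 < pv.V1"
  shows "stable_rot TYPE('n) (vprof nn d t) d"
  unfolding stable_rot_def Jfun_def
  using form_nonneg[OF _ assms] square_nonneg by (auto intro!: divide_nonneg_nonneg)

lemma unstable_of_V1_neg:
  assumes "pv.V1 < 0"
  shows "\<not> stable_rot TYPE('n) (vprof nn d t) d"
proof
  assume st: "stable_rot TYPE('n) (vprof nn d t) d"
  obtain u u' where "pr.C1 u u'" "integral {0..Pf nn t} (\<lambda>z. pr.m z * u z) = 0" "pr.bil u u' u u' < 0"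
    using pv.unstable_form[OF assms] by blast
  from pr.poly_test_function[OF this] obtain G where
    G0: "integral {0..Pf nn t} (\<lambda>z. pr.m z * poly G z) = 0" and
    Gneg: "pr.bil (poly G) (poly (pderiv G)) (poly G) (poly (pderiv G)) < 0" by blast
  \<comment> \<open>The height in the slab is \<open>lam\<close> times the normalised one, so the
    rescaled polynomial pulls back exactly to \<open>G\<close>.\<close>
  define Gc where "Gc = pcompose G [:0, 1 / lam:]"
  define U :: "real \<times> (real^'n) \<Rightarrow> real" where "U p = poly Gc (fst p)" for p
  have smooth: "smooth_fun U" unfolding U_def[abs_def] by (rule smooth_poly_fst)
  have gU: "grad U p = (poly (pderiv Gc) (fst p), 0)" for p
    by (rule grad_eq) (use has_derivative_poly_fst[of Gc p] in \<open>simp add: U_def[abs_def] inner_prod_def mult.commute\<close>)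
  have uuG: "uu U (y, \<theta>) = poly G y" for y and \<theta> :: "real^'n"
    using lam_pos by (simp add: uu_def[OF smooth] pos_def[OF smooth] U_def Gc_def poly_pcompose)
  have vvG: "vv U (y, \<theta>) = poly (pderiv G) y" for y and \<theta> :: "real^'n"
    using lam_pos by (simp add: vv_def[OF smooth] gU pos_def[OF smooth] Gc_def pderiv_pcompose poly_pcompose pderiv_pCons)
  have ttG: "tt U (y, \<theta>) = 0" for y and \<theta> :: "real^'n"
    by (simp add: tt_def[OF smooth] gU)
  define S where "S = sphere_int (\<lambda>x::real^'n. 1)"
  have S: "0 < S" unfolding S_def by (rule sphere_int_1_pos)
  have sc: "sphere_int (\<lambda>\<theta>::real^'n. c) = c * S" for c
    using sphere_int_cmult[of c "\<lambda>_::real^'n. 1"] by (simp add: S_def)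
  have G_nz: "G \<noteq> 0" using Gneg by (auto simp: pr.bil_def)
  \<comment> \<open>A nonzero polynomial has finitely many roots. The point found here shows that
    \<open>U\<close> is nonzero on the surface and that the denominator of \<open>Jfun\<close> is
    positive.\<close>
  have "\<exists>y\<in>{0..Pf nn t}. poly G y \<noteq> 0"
  proof (rule ccontr)
    assume "\<not> ?thesis"
    then have "{0..Pf nn t} \<subseteq> {x. poly G x = 0}" by auto
    then have "finite {0..Pf nn t}" using poly_roots_finite[OF G_nz] finite_subset by blast
    then show False using infinite_Icc[OF pr.P0] by simp
  qed
  then obtain y0 where y0: "y0 \<in> {0..Pf nn t}" "poly G y0 \<noteq> 0" by blast
  have mean: "surf_int (vprof nn d t) d U = 0"
  proof -
    have "integral {0..Pf nn t} (\<lambda>y. S * (pr.m y * poly G y)) = 0" using G0 by simp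
    then show ?thesis unfolding mean_eq[OF smooth] uuG sc by (auto simp: mult_ac)
  qed
  have num: "surf_int (vprof nn d t) d (\<lambda>p. tang_grad_sq (vprof nn d t) U p - sff_sq (vprof nn d t) p * (U p)\<^sup>2) < 0"
  proof -
    have "(\<lambda>y. pr.p y * ((poly (pderiv G) y)\<^sup>2 * S) + pr.m y * (0 * S) - pr.q y * ((poly G y)\<^sup>2 * S)) =
        (\<lambda>y. S * (pr.p y * poly (pderiv G) y * poly (pderiv G) y - pr.q y * poly G y * poly G y))"
      by (simp add: fun_eq_iff power2_eq_square algebra_simps)
    then have "integral {0..Pf nn t} (\<lambda>y. pr.p y * ((poly (pderiv G) y)\<^sup>2 * S) + pr.m y * (0 * S) - pr.q y * ((poly G y)\<^sup>2 * S)) =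
       S * pr.bil (poly G) (poly (pderiv G)) (poly G) (poly (pderiv G))"
      by (simp only: pr.bil_def integral_mult_right)
    then show ?thesis unfolding form_eq[OF smooth] uuG vvG ttG sc
      using S Gneg lam_pos by (simp add: mult_pos_neg divide_neg_pos)
  qed
  have den: "0 < surf_int (vprof nn d t) d (\<lambda>p. (U p)\<^sup>2)"
  proof -
    have c: "continuous_on {0..Pf nn t} (\<lambda>y. pr.m y * ((poly G y)\<^sup>2 * S))"
      by (intro continuous_intros pr.cont_coeffs)
    have nn0: "0 \<le> pr.m y * ((poly G y)\<^sup>2 * S)" if "y \<in> {0..Pf nn t}" for y
      using pr.pos_coeffs(2)[OF that] S by simp
    have "integral {0..Pf nn t} (\<lambda>y. pr.m y * ((poly G y)\<^sup>2 * S)) \<noteq> 0"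
    proof
      assume "integral {0..Pf nn t} (\<lambda>y. pr.m y * ((poly G y)\<^sup>2 * S)) = 0"
      then have "\<forall>y\<in>{0..Pf nn t}. pr.m y * ((poly G y)\<^sup>2 * S) = 0"
        using integral_eq_0_iff[OF c _ nn0] pr.P0 by auto
      then have "pr.m y0 * ((poly G y0)\<^sup>2 * S) = 0" using y0 by blast
      then show False using y0 pr.pos_coeffs(2)[OF y0(1)] S by simp
    qed
    moreover have "0 \<le> integral {0..Pf nn t} (\<lambda>y. pr.m y * ((poly G y)\<^sup>2 * S))"
      by (rule Henstock_Kurzweil_Integration.integral_nonneg[OF integrable_continuous_real[OF c] nn0])
    ultimately show ?thesis unfolding square_eq[OF smooth] uuG sc using lam_pos by simp
  qed
  obtain \<theta> :: "real^'n" where \<theta>: "norm \<theta> = 1" using vector_choose_size[of 1] by auto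
  have "(lam * y0, vprof nn d t (lam * y0) *\<^sub>R \<theta>) \<in> rot_surf (vprof nn d t) d"
  proof -
    have "lam * y0 \<le> lam * Pf nn t" using y0 lam_pos by (intro mult_left_mono) auto
    then have "lam * y0 \<le> d" using pr.P0 by (simp add: lam_def)
    moreover have "0 \<le> lam * y0" using y0 lam_pos by simp
    ultimately show ?thesis unfolding rot_surf_def using \<theta> by blast
  qed
  moreover have "U (lam * y0, vprof nn d t (lam * y0) *\<^sub>R \<theta>) \<noteq> 0"
    using y0 lam_pos by (simp add: U_def Gc_def poly_pcompose)
  ultimately have "0 \<le> Jfun (vprof nn d t) d U"
    using st smooth mean unfolding stable_rot_def by blast
  moreover have "Jfun (vprof nn d t) d U < 0"
    unfolding Jfun_def using num den by (rule divide_neg_pos)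
  ultimately show False by simp
qed

lemma stability_iff_deriv_Vol:
  "deriv (Vol nn d) t < 0 \<Longrightarrow> \<not> stable_rot TYPE('n) (vprof nn d t) d"
  "0 < deriv (Vol nn d) t \<Longrightarrow> stable_rot TYPE('n) (vprof nn d t) d"
proof -
  obtain C where C: "0 < C" "deriv (Vol nn d) t = C * pv.V1"
    using deriv_Vol_V1[OF card t0 t1 d] by blast
  show "deriv (Vol nn d) t < 0 \<Longrightarrow> \<not> stable_rot TYPE('n) (vprof nn d t) d"
    using unstable_of_V1_neg C by (simp add: mult_less_0_iff)
  show "0 < deriv (Vol nn d) t \<Longrightarrow> stable_rot TYPE('n) (vprof nn d t) d"
    using stable_of_V1_pos C by (simp add: zero_less_mult_iff)
qed

end

theorem theorem2p3:
  fixes d t0 :: real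
  assumes "d > 0"
    and "CARD('n::finite) \<ge> 2"
    and "\<forall>t\<in>{0<..<1}. deriv (Vol CARD('n) d) t = 0 \<longrightarrow>
           deriv (deriv (Vol CARD('n) d)) t \<noteq> 0 \<and> deriv (eta CARD('n) d) t < 0"
    and "t0 \<in> {0<..1}"
  shows "(deriv (Vol CARD('n) d) t0 < 0 \<longrightarrow> \<not> stable_rot TYPE('n) (vprof CARD('n) d t0) d)
       \<and> (deriv (Vol CARD('n) d) t0 > 0 \<longrightarrow> stable_rot TYPE('n) (vprof CARD('n) d t0) d)"
proof (cases "t0 = 1")
  case True
  then show ?thesis using deriv_Vol_1[OF assms(2,1)] by simp
next
  case False
  then have "0 < t0" "t0 < 1" using assms(4) by auto
  then show ?thesis using stability_iff_deriv_Vol[OF refl assms(2) _ _ assms(1), of t0] by blast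
qed

end
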